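(* Let $n\in\mathbb{Z}^+$ with $n\geq 2$ and $0<R_1<R_2<\infty$. Let $f:\overline{A(R_1,R_2)}\to\mathbb{R}$ be real analytic on $\overline{A(R_1,R_2)}$ and satisfy $\int_{A(R_1,R_2)} f\,\mathrm{Vol}_{\mathbb{R}^n}=0$. Then there exists a vector field $\mathbf{U}:\overline{A(R_1,R_2)}\to\mathbb{R}^n$, real analytic on $\overline{A(R_1,R_2)}$, such that $\operatorname{div}_{\mathbb{R}^n}\mathbf{U}(x)=f(x)$ for all $x\in\overline{A(R_1,R_2)}$ and $\mathbf{U}|_{\partial A(R_1,R_2)}=0$.
   Context: $A(R_1,R_2)=\{x\in\mathbb{R}^n: R_1<|x|<R_2\}$ and $\overline{A(R_1,R_2)}=\{x\in\mathbb{R}^n: R_1\leq|x|\leq R_2\}$. A function (scalar- or $\mathbb{R}^n$-valued) on $\overline{A(R_1,R_2)}$ is called real analytic on $\overline{A(R_1,R_2)}$ if there exist $\delta\in(0,1)$ and a real analytic function $\widetilde f$ on the open annulus $A(R_1(1-\delta),R_2(1+\delta))$ whose restriction to $\overline{A(R_1,R_2)}$ equals the given function. $\mathrm{Vol}_{\mathbb{R}^n}$ is Lebesgue measure. *)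

theory Defs
  imports "HOL-Analysis.Analysis"
begin

definition annulus :: "real \<Rightarrow> real \<Rightarrow> (real^'n) set" where
  "annulus R1 R2 = {x. R1 < norm x \<and> norm x < R2}"

definition cannulus :: "real \<Rightarrow> real \<Rightarrow> (real^'n) set" where
  "cannulus R1 R2 = {x. R1 \<le> norm x \<and> norm x \<le> R2}"

definition real_analytic_on :: "(real^'n \<Rightarrow> 'b::real_normed_vector) \<Rightarrow> (real^'n) set \<Rightarrow> bool" where
  "real_analytic_on f S \<longleftrightarrow>
     (\<forall>a\<in>S. \<exists>r>0. ball a r \<subseteq> S \<and>
        (\<exists>c :: ('n \<Rightarrow> nat) \<Rightarrow> 'b.
           \<forall>x\<in>ball a r. ((\<lambda>\<alpha>. (\<Prod>i\<in>UNIV. (x$i - a$i) ^ \<alpha> i) *\<^sub>R c \<alpha>) has_sum f x) UNIV))"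

definition analytic_extension ::
  "real \<Rightarrow> real \<Rightarrow> (real^'n \<Rightarrow> 'b::real_normed_vector) \<Rightarrow> real \<Rightarrow> (real^'n \<Rightarrow> 'b) \<Rightarrow> bool" where
  "analytic_extension R1 R2 f d g \<longleftrightarrow>
     0 < d \<and> d < 1 \<and> real_analytic_on g (annulus (R1 * (1 - d)) (R2 * (1 + d))) \<and>
     (\<forall>x\<in>cannulus R1 R2. g x = f x)"

definition real_analytic_on_cannulus ::
  "real \<Rightarrow> real \<Rightarrow> (real^'n \<Rightarrow> 'b::real_normed_vector) \<Rightarrow> bool" where
  "real_analytic_on_cannulus R1 R2 f \<longleftrightarrow> (\<exists>d g. analytic_extension R1 R2 f d g)"

definition divergence :: "(real^'n \<Rightarrow> real^'n) \<Rightarrow> real^'n \<Rightarrow> real" where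
  "divergence U x = (\<Sum>i\<in>UNIV. deriv (\<lambda>t. U (x + t *\<^sub>R axis i 1) $ i) 0)"

end

theory Submission
  imports Defs
begin

text \<open>
  Radial integration of \<open>f\<close> from the inner sphere gives a field \<open>F(x) x / |x|\<^sup>n\<close> with divergence \<open>f\<close>
  which vanishes on the inner sphere, while on the outer sphere its radial component is a multiple of
  the radial moment \<open>G\<close> of \<open>f\<close>, a function of the direction with spherical mean zero.  It remains to
  write \<open>G\<close> as the divergence of an analytic tangential field \<open>T\<close>: with a smoothstep cutoff \<open>\<eta>\<close> in
  \<open>|x|\<^sup>2\<close>, the field \<open>- \<eta> G x / |x|\<^sup>n + |x|\<^sup>1\<^sup>-\<^sup>n \<eta>' T\<close> is divergence free and corrects the boundary values.

  To find \<open>T\<close>, no elliptic theory is used.  If \<open>h'\<close> is the average of \<open>h \<circ> R(\<beta>)\<close> over a random angle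
  \<open>\<beta>\<close>, where \<open>R\<close> is the rotation group of a coordinate plane with generator \<open>X\<close>, then \<open>h - h' = X H\<close>
  where \<open>H\<close> is the average of minus the integral of \<open>h \<circ> R(t)\<close> over \<open>t\<close> from \<open>0\<close> to \<open>\<beta>\<close>; and \<open>X H\<close> is
  the divergence of the tangential field \<open>H X\<close>.  Finitely many such averages (generalised Euler angles)
  turn \<open>G\<close> into its spherical mean, which is zero.  All operators involved are integrals of analytic
  functions over a parameter, so analyticity is preserved.
\<close>

section \<open>Power series with measurable parameters\<close>

text \<open>Exact boundary values must be met inside the analytic class, where no bump function
  exists. The smoothstep \<open>3u^2 - 2u^3\<close> suffices: its values 0 and 1 on the two spheres
  settle the radial component, and its derivative, zero on both, removes the tangential correction
  there. The mean of \<open>G\<close> vanishes because averaged rotations preserve integrals against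
  rotation invariant measures: \<open>f\<close> may be replaced by its spherical mean, and the
  radial moment of a radial function is its integral over the shell up to a constant. All operators
  move points along spheres or rays inside the open annulus, so the solution is analytic on the same
  enlarged annulus as the given extension of \<open>f\<close>. Integration over a parameter requires
  a radius and a bound valid for all its values. Hence the majorants: \<open>M\<close> bounds a
  weighted l^1 norm of the coefficients, which behaves well under sums, products, substitutions and
  integrals. Dependence on the parameter is only measurable, so that pieces found by compactness can
  be glued.\<close>

definition mon :: "real^'n \<Rightarrow> ('n \<Rightarrow> nat) \<Rightarrow> real" where
  "mon v \<alpha> = (\<Prod>i\<in>UNIV. (v$i) ^ \<alpha> i)"

definition deg :: "('n::finite \<Rightarrow> nat) \<Rightarrow> nat" where
  "deg \<alpha> = (\<Sum>i\<in>UNIV. \<alpha> i)"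

text \<open>Sup-norm boxes fit multi-index series better than balls: a monomial of degree
  \<open>k\<close> is at most \<open>\<rho> ^ k\<close> on the box, with equality at a
  corner.\<close>

definition box_at :: "real^'n \<Rightarrow> real \<Rightarrow> (real^'n) set" where
  "box_at a \<rho> = {x. \<forall>i. \<bar>x$i - a$i\<bar> \<le> \<rho>}"

text \<open>The coefficients are measurable on the whole parameter space while bounds and
  convergence concern \<open>N\<close> only. Composing with a measurable map into \<open>N\<close>
  therefore keeps both.\<close>

definition majorant ::
  "'p::topological_space set \<Rightarrow> real^'n \<Rightarrow> real \<Rightarrow> ('p \<Rightarrow> real^'n \<Rightarrow> real) \<Rightarrow> real \<Rightarrow>
   (('n \<Rightarrow> nat) \<Rightarrow> 'p \<Rightarrow> real) \<Rightarrow> (('n \<Rightarrow> nat) \<Rightarrow> real) \<Rightarrow> bool" where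
  "majorant N a \<rho> h M c C \<longleftrightarrow>
     (\<forall>\<alpha>. c \<alpha> \<in> borel_measurable borel) \<and> (\<forall>\<alpha>. 0 \<le> C \<alpha>) \<and> (\<forall>\<alpha>. \<forall>t\<in>N. \<bar>c \<alpha> t\<bar> \<le> C \<alpha>) \<and>
     (\<lambda>\<alpha>. C \<alpha> * \<rho> ^ deg \<alpha>) summable_on UNIV \<and> (\<Sum>\<^sub>\<infinity>\<alpha>. C \<alpha> * \<rho> ^ deg \<alpha>) \<le> M \<and>
     (\<forall>t\<in>N. \<forall>x\<in>box_at a \<rho>. ((\<lambda>\<alpha>. mon (x - a) \<alpha> * c \<alpha> t) has_sum h t x) UNIV)"

definition majorized ::
  "'p::topological_space set \<Rightarrow> real^'n \<Rightarrow> real \<Rightarrow> ('p \<Rightarrow> real^'n \<Rightarrow> real) \<Rightarrow> real \<Rightarrow> bool" where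
  "majorized N a \<rho> h M \<longleftrightarrow> (\<exists>c C. majorant N a \<rho> h M c C)"

lemma abs_mon_le:
  assumes "\<And>i. \<bar>v$i\<bar> \<le> \<rho>"
  shows "\<bar>mon v \<alpha>\<bar> \<le> \<rho> ^ deg \<alpha>"
proof -
  have "\<bar>mon v \<alpha>\<bar> = (\<Prod>i\<in>UNIV. \<bar>v$i\<bar> ^ \<alpha> i)"
    by (simp add: mon_def abs_prod power_abs)
  also have "\<dots> \<le> (\<Prod>i\<in>UNIV. \<rho> ^ \<alpha> i)"
    by (intro prod_mono conjI power_mono assms) auto
  also have "\<dots> = \<rho> ^ deg \<alpha>"
    by (simp add: deg_def power_sum)
  finally show ?thesis .
qed

lemma majorantD:
  assumes "majorant N a \<rho> h M c C"
  shows "\<And>\<alpha>. c \<alpha> \<in> borel_measurable borel" "\<And>\<alpha>. 0 \<le> C \<alpha>"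
    "\<And>\<alpha> t. t \<in> N \<Longrightarrow> \<bar>c \<alpha> t\<bar> \<le> C \<alpha>"
    "(\<lambda>\<alpha>. C \<alpha> * \<rho> ^ deg \<alpha>) summable_on UNIV" "(\<Sum>\<^sub>\<infinity>\<alpha>. C \<alpha> * \<rho> ^ deg \<alpha>) \<le> M"
    "\<And>t x. t \<in> N \<Longrightarrow> x \<in> box_at a \<rho> \<Longrightarrow> ((\<lambda>\<alpha>. mon (x - a) \<alpha> * c \<alpha> t) has_sum h t x) UNIV"
  using assms unfolding majorant_def by blast+

lemma majorizedI:
  assumes "\<And>\<alpha>. c \<alpha> \<in> borel_measurable borel" "\<And>\<alpha>. 0 \<le> C \<alpha>"
    "\<And>\<alpha> t. t \<in> N \<Longrightarrow> \<bar>c \<alpha> t\<bar> \<le> C \<alpha>"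
    "(\<lambda>\<alpha>. C \<alpha> * \<rho> ^ deg \<alpha>) summable_on UNIV" "(\<Sum>\<^sub>\<infinity>\<alpha>. C \<alpha> * \<rho> ^ deg \<alpha>) \<le> M"
    "\<And>t x. t \<in> N \<Longrightarrow> x \<in> box_at a \<rho> \<Longrightarrow> ((\<lambda>\<alpha>. mon (x - a) \<alpha> * c \<alpha> t) has_sum h t x) UNIV"
  shows "majorized N a \<rho> h M"
  unfolding majorized_def majorant_def using assms by (intro exI[of _ c] exI[of _ C]) auto

lemma abs_summable_mon:
  assumes "\<And>\<alpha>. 0 \<le> C \<alpha>" "\<And>\<alpha>. \<bar>c \<alpha>\<bar> \<le> C \<alpha>" "x \<in> box_at a \<rho>"
    "(\<lambda>\<alpha>. C \<alpha> * \<rho> ^ deg \<alpha>) summable_on UNIV"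
  shows "(\<lambda>\<alpha>. mon (x - a) \<alpha> * c \<alpha>) summable_on UNIV"
    and "\<bar>\<Sum>\<^sub>\<infinity>\<alpha>. mon (x - a) \<alpha> * c \<alpha>\<bar> \<le> (\<Sum>\<^sub>\<infinity>\<alpha>. C \<alpha> * \<rho> ^ deg \<alpha>)"
    and "\<bar>mon (x - a) \<alpha> * c \<alpha>\<bar> \<le> C \<alpha> * \<rho> ^ deg \<alpha>"
proof -
  have *: "\<bar>mon (x - a) \<alpha> * c \<alpha>\<bar> \<le> C \<alpha> * \<rho> ^ deg \<alpha>" for \<alpha>
  proof -
    have "\<bar>mon (x - a) \<alpha>\<bar> \<le> \<rho> ^ deg \<alpha>"
      by (rule abs_mon_le) (use assms(3) in \<open>auto simp: box_at_def\<close>)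
    then have "\<bar>mon (x - a) \<alpha>\<bar> * \<bar>c \<alpha>\<bar> \<le> \<rho> ^ deg \<alpha> * C \<alpha>"
      using assms(1,2) by (intro mult_mono) (auto intro: order_trans[OF abs_ge_zero])
    then show ?thesis by (simp add: abs_mult mult.commute)
  qed
  then show "\<bar>mon (x - a) \<alpha> * c \<alpha>\<bar> \<le> C \<alpha> * \<rho> ^ deg \<alpha>" .
  have abs: "(\<lambda>\<alpha>. norm (mon (x - a) \<alpha> * c \<alpha>)) summable_on UNIV"
    using * by (intro summable_on_comparison_test[OF assms(4)]) auto
  then show "(\<lambda>\<alpha>. mon (x - a) \<alpha> * c \<alpha>) summable_on UNIV"
    by (rule abs_summable_summable)
  show "\<bar>\<Sum>\<^sub>\<infinity>\<alpha>. mon (x - a) \<alpha> * c \<alpha>\<bar> \<le> (\<Sum>\<^sub>\<infinity>\<alpha>. C \<alpha> * \<rho> ^ deg \<alpha>)"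
    using norm_infsum_le[OF has_sum_infsum[OF abs_summable_summable[OF abs]] has_sum_infsum[OF assms(4)]] *
    by simp
qed

lemma majorized_abs_le:
  assumes "majorized N a \<rho> h M" "t \<in> N" "x \<in> box_at a \<rho>"
  shows "\<bar>h t x\<bar> \<le> M"
proof -
  from assms(1) obtain c C where cm: "majorant N a \<rho> h M c C"
    unfolding majorized_def by blast
  note * = majorantD[OF cm]
  have "\<bar>\<Sum>\<^sub>\<infinity>\<alpha>. mon (x - a) \<alpha> * c \<alpha> t\<bar> \<le> (\<Sum>\<^sub>\<infinity>\<alpha>. C \<alpha> * \<rho> ^ deg \<alpha>)"
    by (rule abs_summable_mon) (use * assms in auto)
  then show ?thesis using *(5) infsumI[OF *(6)[OF assms(2,3)]] by simp
qed

lemma majorized_nonneg: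
  assumes "majorized N a \<rho> h M" "0 \<le> \<rho>" shows "0 \<le> M"
proof -
  from assms(1) obtain c C where "majorant N a \<rho> h M c C"
    unfolding majorized_def by blast
  note * = majorantD[OF this]
  have "0 \<le> (\<Sum>\<^sub>\<infinity>\<alpha>. C \<alpha> * \<rho> ^ deg \<alpha>)"
    using *(2) assms(2) by (intro infsum_nonneg mult_nonneg_nonneg) auto
  then show ?thesis using *(5) by linarith
qed

lemma box_at_mono: "\<rho>' \<le> \<rho> \<Longrightarrow> box_at a \<rho>' \<subseteq> box_at a \<rho>"
  unfolding box_at_def by (auto intro: order_trans)

lemma majorized_mono:
  assumes "majorized N a \<rho> h M" "N' \<subseteq> N" "0 \<le> \<rho>'" "\<rho>' \<le> \<rho>" "M \<le> M'"
    and "\<And>t x. t \<in> N' \<Longrightarrow> x \<in> box_at a \<rho>' \<Longrightarrow> h' t x = h t x"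
  shows "majorized N' a \<rho>' h' M'"
proof -
  from assms(1) obtain c C where cm: "majorant N a \<rho> h M c C"
    unfolding majorized_def by blast
  note * = majorantD[OF cm]
  have le: "C \<alpha> * \<rho>' ^ deg \<alpha> \<le> C \<alpha> * \<rho> ^ deg \<alpha>" for \<alpha>
    using assms *(2) by (intro mult_left_mono power_mono) auto
  have s: "(\<lambda>\<alpha>. C \<alpha> * \<rho>' ^ deg \<alpha>) summable_on UNIV"
    using le *(2) assms(3) by (intro summable_on_comparison_test[OF *(4)]) auto
  have "(\<Sum>\<^sub>\<infinity>\<alpha>. C \<alpha> * \<rho>' ^ deg \<alpha>) \<le> M'"
    using infsum_mono[OF s *(4) le] *(5) assms(5) by linarith
  moreover have "((\<lambda>\<alpha>. mon (x - a) \<alpha> * c \<alpha> t) has_sum h' t x) UNIV" if "t \<in> N'" "x \<in> box_at a \<rho>'" for t x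
    using *(6) that assms box_at_mono[OF assms(4)] by (metis subsetD)
  ultimately show ?thesis
    using * s assms(2) by (intro majorizedI[of c C]) auto
qed

text \<open>Ordinary series give access to measurability of limits and to termwise integration.
  Indices outside the range of \<open>to_nat\<close> contribute zero, since \<open>from_nat\<close>
  is junk there.\<close>

lemma has_sum_imp_sums_to_nat:
  fixes f :: "'j::countable \<Rightarrow> real"
  assumes "(f has_sum s) UNIV"
  shows "(\<lambda>k. if k \<in> range (to_nat :: 'j \<Rightarrow> nat) then f (from_nat k) else 0) sums s"
proof -
  have "((\<lambda>k. f (from_nat k)) has_sum s) (range (to_nat :: 'j \<Rightarrow> nat))"
    using assms by (subst has_sum_reindex) (auto simp: o_def)
  then have "((\<lambda>k. if k \<in> range (to_nat :: 'j \<Rightarrow> nat) then f (from_nat k) else 0) has_sum s) UNIV"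
    by (subst (asm) has_sum_cong_neutral[where T=UNIV
          and g="\<lambda>k. if k \<in> range (to_nat :: 'j \<Rightarrow> nat) then f (from_nat k) else 0"]) auto
  then show ?thesis by (rule has_sum_imp_sums)
qed

text \<open>Completeness of the weighted l^1 norm: the double family
  \<open>C j \<alpha> * \<rho> ^ deg \<alpha>\<close> is summable, so the double series may be
  rearranged. Products and substitutions are reduced to this lemma.\<close>

lemma majorized_infsum:
  fixes h :: "'j::countable \<Rightarrow> 'p::topological_space \<Rightarrow> real^'n \<Rightarrow> real"
  assumes h: "\<And>j. majorized N a \<rho> (h j) (K j)" and K: "(K has_sum S) UNIV" and \<rho>: "0 < \<rho>"
    and g: "\<And>t x. t \<in> N \<Longrightarrow> x \<in> box_at a \<rho> \<Longrightarrow> ((\<lambda>j. h j t x) has_sum g t x) UNIV"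
  shows "majorized N a \<rho> g S"
proof -
  obtain c C where maj: "\<And>j. majorant N a \<rho> (h j) (K j) (c j) (C j)"
    using h unfolding majorized_def by metis
  have c: "\<And>j \<alpha>. c j \<alpha> \<in> borel_measurable borel" and C0: "\<And>j \<alpha>. 0 \<le> C j \<alpha>"
    and cC: "\<And>j \<alpha> t. t\<in>N \<Longrightarrow> \<bar>c j \<alpha> t\<bar> \<le> C j \<alpha>"
    and Cs: "\<And>j. (\<lambda>\<alpha>. C j \<alpha> * \<rho> ^ deg \<alpha>) summable_on UNIV"
    and CK: "\<And>j. (\<Sum>\<^sub>\<infinity>\<alpha>. C j \<alpha> * \<rho> ^ deg \<alpha>) \<le> K j"
    and ch: "\<And>j t x. t\<in>N \<Longrightarrow> x\<in>box_at a \<rho> \<Longrightarrow> ((\<lambda>\<alpha>. mon (x - a) \<alpha> * c j \<alpha> t) has_sum h j t x) UNIV"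
    using majorantD[OF maj] by blast+
  have nn: "0 \<le> C j \<alpha> * \<rho> ^ deg \<alpha>" for j \<alpha>
    using C0 \<rho> by (intro mult_nonneg_nonneg) auto
  have outer: "(\<lambda>j. \<Sum>\<^sub>\<infinity>\<alpha>. C j \<alpha> * \<rho> ^ deg \<alpha>) summable_on UNIV"
    by (rule summable_on_comparison_test[OF has_sum_imp_summable[OF K]])
       (use CK nn in \<open>auto intro: infsum_nonneg\<close>)
  have D: "(\<lambda>(j,\<alpha>). C j \<alpha> * \<rho> ^ deg \<alpha>) summable_on (UNIV \<times> UNIV)"
    by (rule summable_on_SigmaI[where g = "\<lambda>j. \<Sum>\<^sub>\<infinity>\<alpha>. C j \<alpha> * \<rho> ^ deg \<alpha>"]) (use Cs outer nn in auto)
  then have D': "(\<lambda>(\<alpha>,j). C j \<alpha> * \<rho> ^ deg \<alpha>) summable_on (UNIV \<times> UNIV)"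
    by (subst summable_on_swap) simp
  have Da: "(\<lambda>j. C j \<alpha> * \<rho> ^ deg \<alpha>) summable_on UNIV" for \<alpha>
    using summable_on_SigmaD1[OF D', of \<alpha>] by simp
  have Ca: "(\<lambda>j. C j \<alpha>) summable_on UNIV" for \<alpha>
    using summable_on_cmult_left[OF Da[of \<alpha>], of "inverse (\<rho> ^ deg \<alpha>)"] \<rho> by (simp add: field_simps)
  define C' where "C' \<alpha> = (\<Sum>\<^sub>\<infinity>j. C j \<alpha>)" for \<alpha>
  \<comment> \<open>Written as a sequential series, \<open>c'\<close> is measurable everywhere, also
    off \<open>N\<close> where the series need not converge.\<close>
  define c' where "c' \<alpha> t = (\<Sum>k. if k \<in> range (to_nat :: 'j \<Rightarrow> nat) then c (from_nat k) \<alpha> t else 0)" for \<alpha> t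
  have c's: "((\<lambda>j. c j \<alpha> t) has_sum c' \<alpha> t) UNIV" if "t \<in> N" for \<alpha> t
  proof -
    have "(\<lambda>j. norm (c j \<alpha> t)) summable_on UNIV"
      by (rule summable_on_comparison_test[OF Ca[of \<alpha>]]) (use cC that in auto)
    then obtain s where s: "((\<lambda>j. c j \<alpha> t) has_sum s) UNIV"
      using abs_summable_summable summable_on_def by blast
    with has_sum_imp_sums_to_nat[OF s] show ?thesis by (simp add: c'_def sums_iff)
  qed
  have meas: "c' \<alpha> \<in> borel_measurable borel" for \<alpha>
  proof -
    have "(\<lambda>t. if k \<in> range (to_nat :: 'j \<Rightarrow> nat) then c (from_nat k) \<alpha> t else 0) \<in> borel_measurable borel" for k
      using c by simp
    then show ?thesis unfolding c'_def by (intro borel_measurable_suminf) 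
  qed
  have sw: "(\<Sum>\<^sub>\<infinity>j. C j \<alpha> * \<rho> ^ deg \<alpha>) = C' \<alpha> * \<rho> ^ deg \<alpha>" for \<alpha>
    by (simp add: C'_def infsum_cmult_left')
  have s': "(\<lambda>\<alpha>. C' \<alpha> * \<rho> ^ deg \<alpha>) summable_on UNIV"
    using summable_on_Sigma_banach[of "\<lambda>\<alpha> j. C j \<alpha> * \<rho> ^ deg \<alpha>" UNIV "\<lambda>_. UNIV"] D' sw by simp
  have "(\<Sum>\<^sub>\<infinity>\<alpha>. C' \<alpha> * \<rho> ^ deg \<alpha>) = (\<Sum>\<^sub>\<infinity>\<alpha>. \<Sum>\<^sub>\<infinity>j. C j \<alpha> * \<rho> ^ deg \<alpha>)"
    by (simp add: sw)
  also have "\<dots> = (\<Sum>\<^sub>\<infinity>j. \<Sum>\<^sub>\<infinity>\<alpha>. C j \<alpha> * \<rho> ^ deg \<alpha>)"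
    by (rule infsum_swap_banach) (use D' in simp)
  also have "\<dots> \<le> S"
    using infsum_mono[OF outer has_sum_imp_summable[OF K] CK] infsumI[OF K] by simp
  finally have le: "(\<Sum>\<^sub>\<infinity>\<alpha>. C' \<alpha> * \<rho> ^ deg \<alpha>) \<le> S" .
  show ?thesis
  proof (rule majorizedI[OF meas _ _ s' le])
    show "0 \<le> C' \<alpha>" for \<alpha> unfolding C'_def by (intro infsum_nonneg C0)
    show "\<bar>c' \<alpha> t\<bar> \<le> C' \<alpha>" if "t \<in> N" for \<alpha> t
      using norm_infsum_le[OF c's[OF that] has_sum_infsum[OF Ca]] cC[OF that] by (simp add: C'_def)
  next
    fix t x assume tx: "t \<in> N" "x \<in> box_at a \<rho>"
    have "(\<lambda>p. norm ((\<lambda>(\<alpha>,j). mon (x - a) \<alpha> * c j \<alpha> t) p)) summable_on (UNIV \<times> UNIV)"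
      by (rule summable_on_comparison_test[OF D'])
         (use abs_summable_mon(3)[OF C0 cC[OF tx(1)] tx(2) Cs] in auto)
    then have sm: "(\<lambda>(\<alpha>,j). mon (x - a) \<alpha> * c j \<alpha> t) summable_on (UNIV \<times> UNIV)"
      using abs_summable_summable by blast
    have i1: "(\<Sum>\<^sub>\<infinity>j. mon (x - a) \<alpha> * c j \<alpha> t) = mon (x - a) \<alpha> * c' \<alpha> t" for \<alpha>
      using c's[OF tx(1), of \<alpha>] by (simp add: infsum_cmult_right' infsumI)
    have i2: "(\<Sum>\<^sub>\<infinity>\<alpha>. mon (x - a) \<alpha> * c' \<alpha> t) = g t x"
    proof -
      have "(\<Sum>\<^sub>\<infinity>\<alpha>. mon (x - a) \<alpha> * c' \<alpha> t) = (\<Sum>\<^sub>\<infinity>j. \<Sum>\<^sub>\<infinity>\<alpha>. mon (x - a) \<alpha> * c j \<alpha> t)"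
        unfolding i1[symmetric] by (rule infsum_swap_banach) (use sm in simp)
      also have "\<dots> = (\<Sum>\<^sub>\<infinity>j. h j t x)" by (intro infsum_cong infsumI ch[OF tx])
      also have "\<dots> = g t x" using g[OF tx] by (simp add: infsumI)
      finally show ?thesis .
    qed
    have "(\<lambda>\<alpha>. mon (x - a) \<alpha> * c' \<alpha> t) summable_on UNIV"
      using summable_on_Sigma_banach[of "\<lambda>\<alpha> j. mon (x - a) \<alpha> * c j \<alpha> t" UNIV "\<lambda>_. UNIV"] sm i1 by simp
    then show "((\<lambda>\<alpha>. mon (x - a) \<alpha> * c' \<alpha> t) has_sum g t x) UNIV"
      using i2 has_sum_infsum by force
  qed
qed

section \<open>Sums, products and substitutions of majorized families\<close>

lemma mon_add: "mon v (\<lambda>i. \<alpha> i + \<beta> i) = mon v \<alpha> * mon v \<beta>"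
  by (simp add: mon_def power_add prod.distrib)

lemma deg_add: "deg (\<lambda>i. \<alpha> i + \<beta> i) = deg \<alpha> + deg \<beta>"
  by (simp add: deg_def sum.distrib)

text \<open>The coefficients are shifted by the multi-index \<beta>. In the product of two families,
  \<open>b\<close> will be a coefficient of the other factor.\<close>

lemma majorized_mon_mult:
  assumes h: "majorized N a \<rho> h M" and \<rho>: "0 < \<rho>"
    and b: "b \<in> borel_measurable borel" "\<And>t. t \<in> N \<Longrightarrow> \<bar>b t\<bar> \<le> B" "0 \<le> B"
  shows "majorized N a \<rho> (\<lambda>t x. mon (x - a) \<beta> * b t * h t x) (B * \<rho> ^ deg \<beta> * M)"
proof -
  from h obtain c C where cm: "majorant N a \<rho> h M c C"
    unfolding majorized_def by blast
  note * = majorantD[OF cm]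
  define s where "s = (\<lambda>\<alpha>::'b\<Rightarrow>nat. \<lambda>i. \<alpha> i + \<beta> i)"
  have inj: "inj s" by (auto simp: s_def inj_def fun_eq_iff)
  define c' where "c' = (\<lambda>\<gamma> t. if \<gamma> \<in> range s then b t * c (inv s \<gamma>) t else 0)"
  define C' where "C' = (\<lambda>\<gamma>. if \<gamma> \<in> range s then B * C (inv s \<gamma>) else 0)"
  have hs: "((\<lambda>\<gamma>. F \<gamma> * (if \<gamma> \<in> range s then G (inv s \<gamma>) else 0)) has_sum S) UNIV
     \<longleftrightarrow> ((\<lambda>\<alpha>. F (s \<alpha>) * G \<alpha>) has_sum S) UNIV" for F G :: "('b\<Rightarrow>nat) \<Rightarrow> real" and S
  proof -
    have "((\<lambda>\<gamma>. F \<gamma> * (if \<gamma> \<in> range s then G (inv s \<gamma>) else 0)) has_sum S) UNIV \<longleftrightarrow>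
       ((\<lambda>\<gamma>. F \<gamma> * G (inv s \<gamma>)) has_sum S) (range s)"
      by (rule has_sum_cong_neutral) auto
    also have "\<dots> \<longleftrightarrow> ((\<lambda>\<alpha>. F (s \<alpha>) * G \<alpha>) has_sum S) UNIV"
      by (subst has_sum_reindex[OF inj]) (simp add: o_def inj)
    finally show ?thesis .
  qed
  have "((\<lambda>\<alpha>. B * \<rho> ^ deg \<beta> * (C \<alpha> * \<rho> ^ deg \<alpha>)) has_sum
      (B * \<rho> ^ deg \<beta> * (\<Sum>\<^sub>\<infinity>\<alpha>. C \<alpha> * \<rho> ^ deg \<alpha>))) UNIV"
    by (intro has_sum_cmult_right has_sum_infsum *)
  then have "((\<lambda>\<alpha>. \<rho> ^ deg (s \<alpha>) * (B * C \<alpha>)) has_sum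
      (B * \<rho> ^ deg \<beta> * (\<Sum>\<^sub>\<infinity>\<alpha>. C \<alpha> * \<rho> ^ deg \<alpha>))) UNIV"
    by (simp add: s_def deg_add power_add mult_ac)
  then have "((\<lambda>\<gamma>. \<rho> ^ deg \<gamma> * (if \<gamma> \<in> range s then B * C (inv s \<gamma>) else 0)) has_sum
      (B * \<rho> ^ deg \<beta> * (\<Sum>\<^sub>\<infinity>\<alpha>. C \<alpha> * \<rho> ^ deg \<alpha>))) UNIV"
    by (rule hs[of "\<lambda>\<gamma>. \<rho> ^ deg \<gamma>" "\<lambda>\<alpha>. B * C \<alpha>", THEN iffD2])
  moreover have "(\<lambda>\<gamma>. C' \<gamma> * \<rho> ^ deg \<gamma>) = (\<lambda>\<gamma>. \<rho> ^ deg \<gamma> * (if \<gamma> \<in> range s then B * C (inv s \<gamma>) else 0))"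
    by (simp add: C'_def fun_eq_iff)
  ultimately have C's: "((\<lambda>\<gamma>. C' \<gamma> * \<rho> ^ deg \<gamma>) has_sum (B * \<rho> ^ deg \<beta> * (\<Sum>\<^sub>\<infinity>\<alpha>. C \<alpha> * \<rho> ^ deg \<alpha>))) UNIV"
    by simp
  show ?thesis
  proof (rule majorizedI[of c' C'])
    show "c' \<alpha> \<in> borel_measurable borel" for \<alpha>
      unfolding c'_def using *(1) b by simp
    show "0 \<le> C' \<alpha>" for \<alpha> unfolding C'_def using * b by simp
    show "\<bar>c' \<alpha> t\<bar> \<le> C' \<alpha>" if "t \<in> N" for \<alpha> t
      unfolding c'_def C'_def using * b that by (auto simp: abs_mult intro!: mult_mono)
    show "(\<lambda>\<gamma>. C' \<gamma> * \<rho> ^ deg \<gamma>) summable_on UNIV" using C's by (rule has_sum_imp_summable)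
    show "(\<Sum>\<^sub>\<infinity>\<gamma>. C' \<gamma> * \<rho> ^ deg \<gamma>) \<le> B * \<rho> ^ deg \<beta> * M"
      using infsumI[OF C's] *(5) b \<rho> by (simp add: mult_left_mono)
    show "((\<lambda>\<alpha>. mon (x - a) \<alpha> * c' \<alpha> t) has_sum mon (x - a) \<beta> * b t * h t x) UNIV"
      if "t \<in> N" "x \<in> box_at a \<rho>" for t x
    proof -
      have "((\<lambda>\<alpha>. mon (x - a) \<beta> * b t * (mon (x - a) \<alpha> * c \<alpha> t)) has_sum (mon (x - a) \<beta> * b t * h t x)) UNIV"
        by (intro has_sum_cmult_right * that)
      then have "((\<lambda>\<alpha>. mon (x - a) (s \<alpha>) * (b t * c \<alpha> t)) has_sum (mon (x - a) \<beta> * b t * h t x)) UNIV"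
        by (simp add: s_def mon_add mult_ac)
      then show ?thesis unfolding c'_def
        by (rule hs[of "mon (x - a)" "\<lambda>\<alpha>. b t * c \<alpha> t", THEN iffD2])
    qed
  qed
qed

text \<open>Only \<open>g\<close> is expanded into monomials; the product becomes an infinite sum of
  shifted copies of \<open>h\<close>, which replaces a Cauchy product over multi-indices.\<close>

lemma majorized_mult:
  assumes g: "majorized N a \<rho> g K" and h: "majorized N a \<rho> h M" and \<rho>: "0 < \<rho>"
  shows "majorized N a \<rho> (\<lambda>t x. g t x * h t x) (K * M)"
proof -
  from g obtain c C where cm: "majorant N a \<rho> g K c C"
    unfolding majorized_def by blast
  note * = majorantD[OF cm]
  have M: "0 \<le> M" using h \<rho> majorized_nonneg by fastforce
  have "majorized N a \<rho> (\<lambda>t x. g t x * h t x) ((\<Sum>\<^sub>\<infinity>\<alpha>. C \<alpha> * \<rho> ^ deg \<alpha>) * M)"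
  proof (rule majorized_infsum[OF majorized_mon_mult[OF h \<rho> *(1) *(3) *(2)] _ \<rho>])
    show "((\<lambda>j. C j * \<rho> ^ deg j * M) has_sum (\<Sum>\<^sub>\<infinity>\<alpha>. C \<alpha> * \<rho> ^ deg \<alpha>) * M) UNIV"
      by (intro has_sum_cmult_left has_sum_infsum *)
    show "((\<lambda>j. mon (x - a) j * c j t * h t x) has_sum g t x * h t x) UNIV"
      if "t \<in> N" "x \<in> box_at a \<rho>" for t x
      by (intro has_sum_cmult_left * that)
  qed
  then show ?thesis
    by (rule majorized_mono) (use *(5) M \<rho> in \<open>auto intro: mult_right_mono\<close>)
qed

lemma majorized_add:
  assumes g: "majorized N a \<rho> g K" and h: "majorized N a \<rho> h M"
  shows "majorized N a \<rho> (\<lambda>t x. g t x + h t x) (K + M)"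
proof -
  from g obtain c C where cm: "majorant N a \<rho> g K c C"
    unfolding majorized_def by blast
  note * = majorantD[OF cm]
  from h obtain d D where dm: "majorant N a \<rho> h M d D"
    unfolding majorized_def by blast
  note ** = majorantD[OF dm]
  show ?thesis
  proof (rule majorizedI[of "\<lambda>\<alpha> t. c \<alpha> t + d \<alpha> t" "\<lambda>\<alpha>. C \<alpha> + D \<alpha>"])
    show "(\<lambda>t. c \<alpha> t + d \<alpha> t) \<in> borel_measurable borel" for \<alpha> using * ** by simp
    show "0 \<le> C \<alpha> + D \<alpha>" for \<alpha> using * ** by simp
    show "\<bar>c \<alpha> t + d \<alpha> t\<bar> \<le> C \<alpha> + D \<alpha>" if "t \<in> N" for \<alpha> t
      using *(3)[OF that, of \<alpha>] **(3)[OF that, of \<alpha>] by linarith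
    show "(\<lambda>\<alpha>. (C \<alpha> + D \<alpha>) * \<rho> ^ deg \<alpha>) summable_on UNIV"
      using summable_on_add[OF *(4) **(4)] by (simp add: algebra_simps)
    show "(\<Sum>\<^sub>\<infinity>\<alpha>. (C \<alpha> + D \<alpha>) * \<rho> ^ deg \<alpha>) \<le> K + M"
      using infsum_add[OF *(4) **(4)] *(5) **(5) by (simp add: algebra_simps)
    show "((\<lambda>\<alpha>. mon (x - a) \<alpha> * (c \<alpha> t + d \<alpha> t)) has_sum g t x + h t x) UNIV"
      if "t \<in> N" "x \<in> box_at a \<rho>" for t x
      using has_sum_add[OF *(6)[OF that] **(6)[OF that]] by (simp add: algebra_simps)
  qed
qed

lemma mon_0: "mon v (\<lambda>_. 0) = 1" by (simp add: mon_def)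
lemma deg_0: "deg (\<lambda>_. 0) = 0" by (simp add: deg_def)

lemma mon_single: "mon v ((\<lambda>_. 0)(i := Suc 0)) = v $ i"
proof -
  have "mon v ((\<lambda>_. 0)(i := Suc 0)) = (\<Prod>j\<in>UNIV. if j = i then v $ j else 1)"
    unfolding mon_def by (intro prod.cong) auto
  then show ?thesis by simp
qed

lemma deg_single: "deg ((\<lambda>_. 0)(i := Suc 0)) = Suc 0"
proof -
  have "deg ((\<lambda>_. 0)(i := Suc 0)) = (\<Sum>j\<in>UNIV. if j = i then Suc 0 else 0)"
    unfolding deg_def by (intro sum.cong) auto
  then show ?thesis by simp
qed

lemma majorized_param:
  assumes "b \<in> borel_measurable borel" "\<And>t. t \<in> N \<Longrightarrow> \<bar>b t\<bar> \<le> B" "0 \<le> B"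
  shows "majorized N a \<rho> (\<lambda>t x. b t) B"
proof (rule majorizedI[of "\<lambda>\<alpha> t. if \<alpha> = (\<lambda>_. 0) then b t else 0" "\<lambda>\<alpha>. if \<alpha> = (\<lambda>_. 0) then B else 0"])
  have s: "((\<lambda>\<alpha>. (if \<alpha> = (\<lambda>_. 0) then B else 0) * \<rho> ^ deg \<alpha>) has_sum B) UNIV"
    by (rule has_sum_finite_neutralI[of "{\<lambda>_. 0}"]) (auto simp: deg_0)
  then show "(\<lambda>\<alpha>. (if \<alpha> = (\<lambda>_. 0) then B else 0) * \<rho> ^ deg \<alpha>) summable_on UNIV"
    by (rule has_sum_imp_summable)
  show "(\<Sum>\<^sub>\<infinity>\<alpha>. (if \<alpha> = (\<lambda>_. 0) then B else 0) * \<rho> ^ deg \<alpha>) \<le> B" using infsumI[OF s] by (rule eq_refl)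
  show "((\<lambda>\<alpha>. mon (x - a) \<alpha> * (if \<alpha> = (\<lambda>_. 0) then b t else 0)) has_sum b t) UNIV" for t x
    by (rule has_sum_finite_neutralI[of "{\<lambda>_. 0}"]) (auto simp: mon_0)
qed (use assms in auto)

lemma majorized_const: "majorized N a \<rho> (\<lambda>t x. k) \<bar>k\<bar>"
  by (rule majorized_param) auto

lemma majorized_coord:
  assumes "0 < \<rho>"
  shows "majorized N a \<rho> (\<lambda>t x. x $ i) (\<bar>a $ i\<bar> + \<rho>)"
proof -
  have "majorized N a \<rho> (\<lambda>t x. mon (x - a) ((\<lambda>_. 0)(i := Suc 0)) * 1 * 1) (1 * \<rho> ^ deg ((\<lambda>_. 0)(i := Suc 0)) * 1)"
    by (rule majorized_mon_mult) (use assms majorized_const[of N a \<rho> 1] in auto)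
  then have "majorized N a \<rho> (\<lambda>t x. x $ i - a $ i) \<rho>"
    by (simp add: mon_single deg_single)
  from majorized_add[OF majorized_const[of N a \<rho> "a $ i"] this] show ?thesis by simp
qed

lemma majorized_cmult:
  assumes "majorized N a \<rho> h M" "0 < \<rho>"
  shows "majorized N a \<rho> (\<lambda>t x. k * h t x) (\<bar>k\<bar> * M)"
  by (rule majorized_mult[OF majorized_const assms])

lemma majorized_prod:
  assumes "finite F" "\<And>j. j \<in> F \<Longrightarrow> majorized N a \<rho> (h j) (K j)" "0 < \<rho>"
  shows "majorized N a \<rho> (\<lambda>t x. \<Prod>j\<in>F. h j t x) (\<Prod>j\<in>F. K j)"
  using assms(1,2)
proof (induction F rule: finite_induct)
  case empty
  show ?case using majorized_const[of N a \<rho> 1] by simp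
next
  case (insert j F)
  have "majorized N a \<rho> (\<lambda>t x. h j t x * (\<Prod>j\<in>F. h j t x)) (K j * (\<Prod>j\<in>F. K j))"
    by (rule majorized_mult[OF _ _ assms(3)]) (use insert in auto)
  then show ?case using insert(1,2) by simp
qed

lemma majorized_power:
  assumes "majorized N a \<rho> h K" "0 < \<rho>"
  shows "majorized N a \<rho> (\<lambda>t x. h t x ^ m) (K ^ m)"
  using majorized_prod[of "{..<m}" N a \<rho> "\<lambda>_. h" "\<lambda>_. K"] assms by simp

lemma deg_pos: "\<alpha> \<noteq> (\<lambda>_. 0) \<Longrightarrow> 1 \<le> deg \<alpha>"
  by (auto simp: deg_def fun_eq_iff Suc_le_eq sum_pos2 intro!: gr0I)

lemma mon_zero_vec: "\<alpha> \<noteq> (\<lambda>_. 0) \<Longrightarrow> mon 0 \<alpha> = 0"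
  by (auto simp: mon_def fun_eq_iff)

text \<open>Without the constant term all degrees are at least 1, so each term gains a factor
  \<open>\<rho>' / \<rho>\<close> on the smaller box. This makes increments small enough to be
  substituted into another series.\<close>

lemma majorized_centred:
  assumes h: "majorized N a \<rho> h M" and \<rho>: "0 < \<rho>'" "\<rho>' \<le> \<rho>"
  shows "majorized N a \<rho>' (\<lambda>t x. h t x - h t a) (\<rho>' / \<rho> * M)"
proof -
  from h obtain c C where cm: "majorant N a \<rho> h M c C"
    unfolding majorized_def by blast
  note * = majorantD[OF cm]
  let ?z = "\<lambda>_::'b. 0::nat"
  have le: "(if \<alpha> = ?z then 0 else C \<alpha>) * \<rho>' ^ deg \<alpha> \<le> \<rho>' / \<rho> * (C \<alpha> * \<rho> ^ deg \<alpha>)" for \<alpha>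
  proof (cases "\<alpha> = ?z")
    case True
    then show ?thesis using *(2)[of ?z] \<rho> by (simp add: deg_0)
  next
    case False
    then obtain k where k: "deg \<alpha> = Suc k" using deg_pos by (metis Suc_le_D One_nat_def)
    have "\<rho>' * \<rho>' ^ k \<le> \<rho>' * \<rho> ^ k" using \<rho> by (intro mult_left_mono power_mono) auto
    then have "C \<alpha> * (\<rho>' * \<rho>' ^ k) \<le> C \<alpha> * (\<rho>' * \<rho> ^ k)" using *(2) by (rule mult_left_mono)
    then show ?thesis using False \<rho> k by (simp add: field_simps)
  qed
  have sm: "(\<lambda>\<alpha>. \<rho>' / \<rho> * (C \<alpha> * \<rho> ^ deg \<alpha>)) summable_on UNIV"
    by (intro summable_on_cmult_right *)
  have s: "(\<lambda>\<alpha>. (if \<alpha> = ?z then 0 else C \<alpha>) * \<rho>' ^ deg \<alpha>) summable_on UNIV"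
    by (rule summable_on_comparison_test[OF sm]) (use le *(2) \<rho> in auto)
  have h0: "h t a = c ?z t" if "t \<in> N" for t
  proof -
    have "((\<lambda>\<alpha>. mon (a - a) \<alpha> * c \<alpha> t) has_sum h t a) UNIV"
      using * that \<rho> by (intro *) (auto simp: box_at_def)
    moreover have "((\<lambda>\<alpha>. mon (a - a) \<alpha> * c \<alpha> t) has_sum c ?z t) UNIV"
      by (rule has_sum_finite_neutralI[of "{?z}"]) (auto simp: mon_0 mon_zero_vec)
    ultimately show ?thesis using has_sum_unique by blast
  qed
  show ?thesis
  proof (rule majorizedI[of "\<lambda>\<alpha> t. if \<alpha> = ?z then 0 else c \<alpha> t" "\<lambda>\<alpha>. if \<alpha> = ?z then 0 else C \<alpha>", OF _ _ _ s])
    show "(\<Sum>\<^sub>\<infinity>\<alpha>. (if \<alpha> = ?z then 0 else C \<alpha>) * \<rho>' ^ deg \<alpha>) \<le> \<rho>' / \<rho> * M"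
    proof -
      have "(\<Sum>\<^sub>\<infinity>\<alpha>. (if \<alpha> = ?z then 0 else C \<alpha>) * \<rho>' ^ deg \<alpha>) \<le> (\<Sum>\<^sub>\<infinity>\<alpha>. \<rho>' / \<rho> * (C \<alpha> * \<rho> ^ deg \<alpha>))"
        by (rule infsum_mono[OF s sm le])
      also have "\<dots> = \<rho>' / \<rho> * (\<Sum>\<^sub>\<infinity>\<alpha>. C \<alpha> * \<rho> ^ deg \<alpha>)" by (rule infsum_cmult_right')
      also have "\<dots> \<le> \<rho>' / \<rho> * M" using *(5) \<rho> by (intro mult_left_mono) auto
      finally show ?thesis .
    qed
    show "(\<lambda>t. if \<alpha> = ?z then 0 else c \<alpha> t) \<in> borel_measurable borel" for \<alpha> using *(1) by simp
    show "((\<lambda>\<alpha>. mon (x - a) \<alpha> * (if \<alpha> = ?z then 0 else c \<alpha> t)) has_sum h t x - h t a) UNIV"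
      if "t \<in> N" "x \<in> box_at a \<rho>'" for t x
    proof -
      have "((\<lambda>\<alpha>. mon (x - a) \<alpha> * c \<alpha> t) has_sum h t x) UNIV"
        using that box_at_mono[OF \<rho>(2)] by (intro *) auto
      moreover have "((\<lambda>\<alpha>. if \<alpha> = ?z then - c \<alpha> t else 0) has_sum - h t a) UNIV"
        using that(1) by (intro has_sum_finite_neutralI[of "{?z}"]) (auto simp: h0)
      ultimately have "((\<lambda>\<alpha>. mon (x - a) \<alpha> * c \<alpha> t + (if \<alpha> = ?z then - c \<alpha> t else 0)) has_sum h t x + - h t a) UNIV"
        by (rule has_sum_add)
      moreover have "(\<lambda>\<alpha>. mon (x - a) \<alpha> * c \<alpha> t + (if \<alpha> = ?z then - c \<alpha> t else 0))
          = (\<lambda>\<alpha>. mon (x - a) \<alpha> * (if \<alpha> = ?z then 0 else c \<alpha> t))"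
        by (auto simp: mon_0)
      ultimately show ?thesis by simp
    qed
  qed (use * in auto)
qed

text \<open>Each centred component has norm at most \<open>r\<close>, so by submultiplicativity the
  term of index \<beta> has norm at most
  \<open>\<bar>d \<beta>\<bar> * r ^ deg \<beta>\<close>.\<close>

lemma majorized_compose:
  fixes f :: "real^'m \<Rightarrow> real" and \<Phi> :: "'p::topological_space \<Rightarrow> real^'n \<Rightarrow> real^'m"
  assumes f: "\<And>y. y \<in> box_at b r \<Longrightarrow> ((\<lambda>\<beta>. mon (y - b) \<beta> * d \<beta>) has_sum f y) UNIV"
    and d: "(\<lambda>\<beta>. \<bar>d \<beta>\<bar> * r ^ deg \<beta>) summable_on UNIV"
    and \<Phi>: "\<And>i. majorized N a \<rho> (\<lambda>t x. \<Phi> t x $ i - b $ i) r" and \<rho>: "0 < \<rho>"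
  shows "majorized N a \<rho> (\<lambda>t x. f (\<Phi> t x)) (\<Sum>\<^sub>\<infinity>\<beta>. \<bar>d \<beta>\<bar> * r ^ deg \<beta>)"
proof (rule majorized_infsum[OF _ has_sum_infsum[OF d] \<rho>])
  show "majorized N a \<rho> (\<lambda>t x. d \<beta> * (\<Prod>i\<in>UNIV. (\<Phi> t x $ i - b $ i) ^ \<beta> i)) (\<bar>d \<beta>\<bar> * r ^ deg \<beta>)" for \<beta>
    unfolding deg_def power_sum
    by (intro majorized_cmult majorized_prod majorized_power \<Phi> \<rho>) auto
  show "((\<lambda>\<beta>. d \<beta> * (\<Prod>i\<in>UNIV. (\<Phi> t x $ i - b $ i) ^ \<beta> i)) has_sum f (\<Phi> t x)) UNIV"
    if "t \<in> N" "x \<in> box_at a \<rho>" for t x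
  proof -
    have "\<Phi> t x \<in> box_at b r"
      using majorized_abs_le[OF \<Phi> that] by (simp add: box_at_def)
    from f[OF this] show ?thesis by (simp add: mon_def mult.commute)
  qed
qed

lemma majorized_compose_real:
  assumes f: "\<And>y. \<bar>y - b\<bar> \<le> r \<Longrightarrow> ((\<lambda>k. d k * (y - b) ^ k) has_sum f y) UNIV"
    and d: "(\<lambda>k. \<bar>d k\<bar> * r ^ k) summable_on UNIV"
    and h: "majorized N a \<rho> (\<lambda>t x. h t x - b) r" and \<rho>: "0 < \<rho>"
  shows "majorized N a \<rho> (\<lambda>t x. f (h t x)) (\<Sum>\<^sub>\<infinity>k. \<bar>d k\<bar> * r ^ k)"
proof (rule majorized_infsum[OF _ has_sum_infsum[OF d] \<rho>])
  show "majorized N a \<rho> (\<lambda>t x. d k * (h t x - b) ^ k) (\<bar>d k\<bar> * r ^ k)" for k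
    by (intro majorized_cmult majorized_power h \<rho>)
  show "((\<lambda>k. d k * (h t x - b) ^ k) has_sum f (h t x)) UNIV"
    if "t \<in> N" "x \<in> box_at a \<rho>" for t x
    by (rule f) (rule majorized_abs_le[OF h that])
qed

text \<open>The coefficients are switched along the Borel set \<open>N1\<close>. As they need only
  be measurable in the parameter, nothing has to match across its boundary.\<close>

lemma majorized_Un:
  assumes "majorized N1 a \<rho> h M1" "majorized N2 a \<rho> h M2" "N1 \<in> sets borel" "0 < \<rho>"
  shows "majorized (N1 \<union> N2) a \<rho> h (M1 + M2)"
proof -
  from assms(1) obtain c C where cm: "majorant N1 a \<rho> h M1 c C"
    unfolding majorized_def by blast
  note * = majorantD[OF cm]
  from assms(2) obtain d D where dm: "majorant N2 a \<rho> h M2 d D"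
    unfolding majorized_def by blast
  note ** = majorantD[OF dm]
  show ?thesis
  proof (rule majorizedI[of "\<lambda>\<alpha> t. if t \<in> N1 then c \<alpha> t else d \<alpha> t" "\<lambda>\<alpha>. C \<alpha> + D \<alpha>"])
    show "(\<lambda>t. if t \<in> N1 then c \<alpha> t else d \<alpha> t) \<in> borel_measurable borel" for \<alpha>
      using * ** assms(3) by (intro measurable_If_set) auto
    show "0 \<le> C \<alpha> + D \<alpha>" for \<alpha> using *(2) **(2) by simp
    show "\<bar>if t \<in> N1 then c \<alpha> t else d \<alpha> t\<bar> \<le> C \<alpha> + D \<alpha>" if "t \<in> N1 \<union> N2" for \<alpha> t
      using *(3)[of t \<alpha>] **(3)[of t \<alpha>] that *(2)[of \<alpha>] **(2)[of \<alpha>] by auto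
    show "(\<lambda>\<alpha>. (C \<alpha> + D \<alpha>) * \<rho> ^ deg \<alpha>) summable_on UNIV"
      using summable_on_add[OF *(4) **(4)] by (simp add: algebra_simps)
    show "(\<Sum>\<^sub>\<infinity>\<alpha>. (C \<alpha> + D \<alpha>) * \<rho> ^ deg \<alpha>) \<le> M1 + M2"
      using infsum_add[OF *(4) **(4)] *(5) **(5) by (simp add: algebra_simps)
    show "((\<lambda>\<alpha>. mon (x - a) \<alpha> * (if t \<in> N1 then c \<alpha> t else d \<alpha> t)) has_sum h t x) UNIV"
      if "t \<in> N1 \<union> N2" "x \<in> box_at a \<rho>" for t x
      using *(6)[of t x] **(6)[of t x] that by (cases "t \<in> N1") auto
  qed
qed

text \<open>The coefficients are integrated one by one; their bounds survive because they are
  uniform on \<open>K\<close>. The map \<open>g\<close> turns points of the measure space into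
  parameters, which covers random angles without a formula for their law.\<close>

lemma majorized_integral:
  fixes h :: "'p::topological_space \<Rightarrow> real^'n \<Rightarrow> real"
  assumes h: "majorized K a \<rho> h M" and P: "finite_measure P"
    and g: "g \<in> measurable P borel" "\<And>y. y \<in> space P \<Longrightarrow> g y \<in> K"
    and w: "w \<in> borel_measurable P" "\<And>y. y \<in> space P \<Longrightarrow> \<bar>w y\<bar> \<le> W" "0 \<le> W" and \<rho>: "0 < \<rho>"
  shows "majorized N a \<rho> (\<lambda>_ x. \<integral>y. w y * h (g y) x \<partial>P) (W * measure P (space P) * M)"
proof -
  interpret finite_measure P by fact
  from h obtain c C where cm: "majorant K a \<rho> h M c C"
    unfolding majorized_def by blast
  note * = majorantD[OF cm]
  have meas: "(\<lambda>y. w y * c \<alpha> (g y)) \<in> borel_measurable P" for \<alpha>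
    using *(1)[of \<alpha>] w(1) g(1) by measurable
  have wc: "\<bar>w y * c \<alpha> (g y)\<bar> \<le> W * C \<alpha>" if "y \<in> space P" for y \<alpha>
    unfolding abs_mult using w(2)[OF that] *(3)[OF g(2)[OF that]] w(3) by (intro mult_mono) auto
  have int: "integrable P (\<lambda>y. w y * c \<alpha> (g y))" for \<alpha>
    by (rule integrable_const_bound[where B="W * C \<alpha>"]) (use wc meas in auto)
  define e where "e \<alpha> = (\<integral>y. w y * c \<alpha> (g y) \<partial>P)" for \<alpha>
  have e: "\<bar>e \<alpha>\<bar> \<le> W * measure P (space P) * C \<alpha>" for \<alpha>
  proof -
    have "norm (e \<alpha>) \<le> (\<integral>y. norm (w y * c \<alpha> (g y)) \<partial>P)"
      unfolding e_def by (rule integral_norm_bound)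
    also have "\<dots> \<le> (\<integral>y. W * C \<alpha> \<partial>P)"
      by (rule integral_mono) (use integrable_norm[OF int[of \<alpha>]] wc in auto)
    finally have "norm (e \<alpha>) \<le> (\<integral>y. W * C \<alpha> \<partial>P)" .
    then show ?thesis by (simp add: mult_ac)
  qed
  show ?thesis
  proof (rule majorizedI[of "\<lambda>\<alpha> t. e \<alpha>" "\<lambda>\<alpha>. W * measure P (space P) * C \<alpha>"])
    have s: "((\<lambda>\<alpha>. W * measure P (space P) * (C \<alpha> * \<rho> ^ deg \<alpha>)) has_sum
        W * measure P (space P) * (\<Sum>\<^sub>\<infinity>\<alpha>. C \<alpha> * \<rho> ^ deg \<alpha>)) UNIV"
      by (intro has_sum_cmult_right has_sum_infsum *)
    then have s': "((\<lambda>\<alpha>. W * measure P (space P) * C \<alpha> * \<rho> ^ deg \<alpha>) has_sum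
        W * measure P (space P) * (\<Sum>\<^sub>\<infinity>\<alpha>. C \<alpha> * \<rho> ^ deg \<alpha>)) UNIV"
      by (simp add: mult_ac)
    show S: "(\<lambda>\<alpha>. W * measure P (space P) * C \<alpha> * \<rho> ^ deg \<alpha>) summable_on UNIV"
      using s' by (rule has_sum_imp_summable)
    show "(\<Sum>\<^sub>\<infinity>\<alpha>. W * measure P (space P) * C \<alpha> * \<rho> ^ deg \<alpha>) \<le> W * measure P (space P) * M"
      unfolding infsumI[OF s'] using *(5) w(3) by (intro mult_left_mono) auto
    show "((\<lambda>\<alpha>. mon (x - a) \<alpha> * e \<alpha>) has_sum (\<integral>y. w y * h (g y) x \<partial>P)) UNIV"
      if "t \<in> N" and x: "x \<in> box_at a \<rho>" for t x
    proof -
      let ?R = "range (to_nat :: ('n \<Rightarrow> nat) \<Rightarrow> nat)"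
      define F where "F k y = (if k \<in> ?R then mon (x - a) (from_nat k) * (w y * c (from_nat k) (g y)) else 0)" for k y
      define B where "B k = (if k \<in> ?R then W * C (from_nat k) * \<rho> ^ deg (from_nat k :: 'n \<Rightarrow> nat) else 0)" for k
      have "((\<lambda>\<alpha>. W * (C \<alpha> * \<rho> ^ deg \<alpha>)) has_sum W * (\<Sum>\<^sub>\<infinity>\<alpha>. C \<alpha> * \<rho> ^ deg \<alpha>)) UNIV"
        by (intro has_sum_cmult_right has_sum_infsum *)
      from has_sum_imp_sums_to_nat[OF this] have B: "summable B"
        unfolding B_def by (simp add: sums_iff mult.assoc cong: if_cong)
      have FB: "norm (F k y) \<le> B k" if "y \<in> space P" for k y
      proof (cases "k \<in> ?R")
        case True
        have "\<bar>mon (x - a) (from_nat k) * (w y * c (from_nat k) (g y))\<bar>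
            \<le> W * C (from_nat k) * \<rho> ^ deg (from_nat k :: 'n \<Rightarrow> nat)"
        proof -
          have "\<bar>mon (x - a) (from_nat k)\<bar> \<le> \<rho> ^ deg (from_nat k :: 'n \<Rightarrow> nat)"
            by (rule abs_mon_le) (use x in \<open>auto simp: box_at_def\<close>)
          then have "\<bar>mon (x - a) (from_nat k)\<bar> * \<bar>w y * c (from_nat k) (g y)\<bar>
            \<le> \<rho> ^ deg (from_nat k :: 'n \<Rightarrow> nat) * (W * C (from_nat k))"
            using wc[OF that] \<rho> by (intro mult_mono) auto
          then show ?thesis by (simp add: abs_mult mult_ac)
        qed
        then show ?thesis using True by (simp add: F_def B_def)
      qed (simp add: F_def B_def)
      have intF: "integrable P (F k)" for k
        unfolding F_def using int[of "from_nat k"] by (cases "k \<in> ?R") simp_all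
      \<comment> \<open>Termwise integration is justified by the summable bounds \<open>B k\<close>,
        uniform in \<open>y\<close>, and the finiteness of \<open>P\<close>.\<close>
      have sF: "(\<lambda>k. integral\<^sup>L P (F k)) sums (\<integral>y. (\<Sum>k. F k y) \<partial>P)"
      proof (rule sums_integral[OF intF])
        show "AE y in P. summable (\<lambda>k. norm (F k y))"
          using FB by (intro AE_I2 summable_comparison_test'[OF B, of 0]) auto
        show "summable (\<lambda>k. \<integral>y. norm (F k y) \<partial>P)"
        proof (rule summable_comparison_test'[of "\<lambda>k. B k * measure P (space P)" 0])
          show "summable (\<lambda>k. B k * measure P (space P))" using B by (rule summable_mult2)
          have "(\<integral>y. norm (F k y) \<partial>P) \<le> (\<integral>y. B k \<partial>P)" for k
            by (rule integral_mono) (use FB intF in \<open>auto intro: integrable_norm\<close>)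
          then show "norm (\<integral>y. norm (F k y) \<partial>P) \<le> B k * measure P (space P)" for k
            by (simp add: mult.commute)
        qed
      qed
      have "(\<Sum>k. F k y) = w y * h (g y) x" if "y \<in> space P" for y
      proof -
        have "((\<lambda>\<alpha>. w y * (mon (x - a) \<alpha> * c \<alpha> (g y))) has_sum w y * h (g y) x) UNIV"
          by (intro has_sum_cmult_right *(6) g that x)
        from has_sum_imp_sums_to_nat[OF this] show ?thesis
          unfolding F_def by (simp add: sums_iff mult_ac cong: if_cong)
      qed
      then have E1: "(\<integral>y. (\<Sum>k. F k y) \<partial>P) = (\<integral>y. w y * h (g y) x \<partial>P)"
        by (intro Bochner_Integration.integral_cong) auto
      have E2: "integral\<^sup>L P (F k) = (if k \<in> ?R then mon (x - a) (from_nat k) * e (from_nat k) else 0)" for k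
        unfolding F_def[abs_def] e_def by simp
      have "(\<lambda>\<alpha>. mon (x - a) \<alpha> * e \<alpha>) summable_on UNIV"
        by (rule abs_summable_mon[OF _ e x S]) (use *(2) w(3) in auto)
      then obtain s where hs: "((\<lambda>\<alpha>. mon (x - a) \<alpha> * e \<alpha>) has_sum s) UNIV"
        unfolding summable_on_def by blast
      from has_sum_imp_sums_to_nat[OF this] sF[unfolded E1 E2] have "s = (\<integral>y. w y * h (g y) x \<partial>P)"
        by (rule sums_unique2)
      with hs show ?thesis by simp
    qed
  qed (use e *(2) w(3) in auto)
qed

text \<open>A germ at \<open>(t, a)\<close> of functions of a parameter and a point: measurable in the parameter and
  analytic in the point, with a majorant which is uniform in the parameter.\<close>

definition panalytic :: "'p::topological_space \<Rightarrow> real^'n \<Rightarrow> ('p \<Rightarrow> real^'n \<Rightarrow> real) \<Rightarrow> bool" where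
  "panalytic t a h \<longleftrightarrow> (\<exists>N \<rho> M. open N \<and> t \<in> N \<and> 0 < \<rho> \<and> majorized N a \<rho> h M)"

section \<open>Calculus of parametrised germs\<close>

lemma panalyticE2:
  assumes "panalytic t a g" "panalytic t a h"
  obtains N \<rho> K M where "open N" "t \<in> N" "0 < \<rho>" "majorized N a \<rho> g K" "majorized N a \<rho> h M"
proof -
  from assms obtain N1 \<rho>1 M1 N2 \<rho>2 M2 where *: "open N1" "t \<in> N1" "0 < \<rho>1" "majorized N1 a \<rho>1 g M1"
    "open N2" "t \<in> N2" "0 < \<rho>2" "majorized N2 a \<rho>2 h M2" unfolding panalytic_def by blast
  show ?thesis
  proof (rule that[of "N1 \<inter> N2" "min \<rho>1 \<rho>2"])
    show "majorized (N1 \<inter> N2) a (min \<rho>1 \<rho>2) g M1" by (rule majorized_mono[OF *(4)]) (use * in auto)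
    show "majorized (N1 \<inter> N2) a (min \<rho>1 \<rho>2) h M2" by (rule majorized_mono[OF *(8)]) (use * in auto)
  qed (use * in auto)
qed

lemma panalytic_add:
  assumes "panalytic t a g" "panalytic t a h"
  shows "panalytic t a (\<lambda>t x. g t x + h t x)"
proof -
  obtain N \<rho> K M where *: "open N" "t \<in> N" "0 < \<rho>" "majorized N a \<rho> g K" "majorized N a \<rho> h M"
    using panalyticE2[OF assms] .
  then show ?thesis unfolding panalytic_def
    using majorized_add[OF *(4,5)] by blast
qed

lemma panalytic_mult:
  assumes "panalytic t a g" "panalytic t a h"
  shows "panalytic t a (\<lambda>t x. g t x * h t x)"
proof -
  obtain N \<rho> K M where *: "open N" "t \<in> N" "0 < \<rho>" "majorized N a \<rho> g K" "majorized N a \<rho> h M"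
    using panalyticE2[OF assms] .
  then show ?thesis unfolding panalytic_def
    using majorized_mult[OF *(4,5) *(3)] by blast
qed

lemma panalytic_const: "panalytic t a (\<lambda>t x. k)"
  unfolding panalytic_def using majorized_const zero_less_one open_UNIV by blast

lemma panalytic_coord: "panalytic t a (\<lambda>t x. x $ i)"
  unfolding panalytic_def using majorized_coord[OF zero_less_one] zero_less_one open_UNIV by blast

lemma panalytic_diff:
  assumes "panalytic t a g" "panalytic t a h"
  shows "panalytic t a (\<lambda>t x. g t x - h t x)"
  using panalytic_add[OF assms(1) panalytic_mult[OF panalytic_const[of t a "-1"] assms(2)]] by simp

lemma panalytic_sum:
  assumes "finite F" "\<And>j. j \<in> F \<Longrightarrow> panalytic t a (h j)"
  shows "panalytic t a (\<lambda>t x. \<Sum>j\<in>F. h j t x)"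
  using assms
proof (induction F rule: finite_induct)
  case (insert j F)
  then have "panalytic t a (\<lambda>t x. h j t x + (\<Sum>j\<in>F. h j t x))" by (intro panalytic_add) auto
  then show ?case using insert by simp
qed (simp add: panalytic_const)

lemma panalytic_power:
  assumes "panalytic t a h" shows "panalytic t a (\<lambda>t x. h t x ^ m)"
  using assms unfolding panalytic_def by (blast intro: majorized_power)

lemma panalytic_param:
  assumes "continuous_on UNIV b" shows "panalytic t a (\<lambda>t x. b t)"
proof -
  define N where "N = {s. \<bar>b s\<bar> < \<bar>b t\<bar> + 1}"
  have "open N" unfolding N_def
    by (intro open_Collect_less continuous_intros assms)
  moreover have "majorized N a 1 (\<lambda>t x. b t) (\<bar>b t\<bar> + 1)"
    by (rule majorized_param) (use assms in \<open>auto simp: N_def intro: borel_measurable_continuous_onI\<close>)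
  ultimately show ?thesis unfolding panalytic_def
    by (intro exI[of _ N] exI[of _ 1] exI[of _ "\<bar>b t\<bar> + 1"]) (auto simp: N_def)
qed

text \<open>The increment splits into a change of the point, made small by shrinking the box, and a
  change of the parameter, made small by continuity. Continuity is a separate hypothesis because a
  germ is only measurable in its parameter.\<close>

lemma panalytic_recentre:
  assumes h: "panalytic t a h" and cont: "continuous_on UNIV (\<lambda>s. h s a)" and r: "0 < r"
  shows "\<exists>N \<rho>. open N \<and> t \<in> N \<and> 0 < \<rho> \<and> majorized N a \<rho> (\<lambda>s x. h s x - h t a) r"
proof -
  from h obtain N \<rho> M where *: "open N" "t \<in> N" "0 < \<rho>" "majorized N a \<rho> h M"
    unfolding panalytic_def by blast
  have M: "0 \<le> M" using majorized_nonneg[OF *(4)] *(3) by simp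
  \<comment> \<open>This choice brings the change of the point below \<open>r / 2\<close>;
    \<open>M + 1\<close> keeps the denominator positive.\<close>
  define \<rho>' where "\<rho>' = min \<rho> (\<rho> * r / (2 * (M + 1)))"
  have \<rho>': "0 < \<rho>'" "\<rho>' \<le> \<rho>" using * r M by (auto simp: \<rho>'_def)
  have "\<rho>' / \<rho> * M \<le> r / 2"
  proof -
    have "\<rho>' / \<rho> \<le> \<rho> * r / (2 * (M + 1)) / \<rho>"
      unfolding \<rho>'_def using *(3) by (intro divide_right_mono) auto
    then have "\<rho>' / \<rho> \<le> r / (2 * (M + 1))" using *(3) by simp
    then have "\<rho>' / \<rho> * M \<le> r / (2 * (M + 1)) * M" using M by (rule mult_right_mono)
    also have "\<dots> \<le> r / 2" using M r by (simp add: field_simps)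
    finally show ?thesis .
  qed
  then have 1: "majorized N a \<rho>' (\<lambda>s x. h s x - h s a) (r / 2)"
    by (intro majorized_mono[OF majorized_centred[OF *(4) \<rho>']]) (use \<rho>' in auto)
  define N' where "N' = {s. \<bar>h s a - h t a\<bar> < r / 2}"
  have N': "open N'" unfolding N'_def by (intro open_Collect_less continuous_intros cont)
  have "continuous_on UNIV (\<lambda>s. h s a - h t a)" by (intro continuous_intros cont)
  then have 2: "majorized N' a \<rho>' (\<lambda>s x. h s a - h t a) (r / 2)"
    by (intro majorized_param borel_measurable_continuous_onI) (use r in \<open>auto simp: N'_def\<close>)
  have "majorized (N \<inter> N') a \<rho>' (\<lambda>s x. (h s x - h s a) + (h s a - h t a)) (r / 2 + r / 2)"
    by (rule majorized_add; rule majorized_mono[OF 1] majorized_mono[OF 2]) (use \<rho>' in auto)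
  then show ?thesis using * N' \<rho>' r
    by (intro exI[of _ "N \<inter> N'"] exI[of _ \<rho>']) (auto simp: N'_def)
qed

lemma component_bound_box: "norm (x - a) \<le> \<rho> \<Longrightarrow> x \<in> box_at a \<rho>"
  using component_le_norm_cart[of "x - a"] by (auto simp: box_at_def intro: order_trans)

lemma norm_le_box:
  fixes a :: "real^'n"
  assumes "x \<in> box_at a \<rho>" shows "norm (x - a) \<le> real CARD('n) * \<rho>"
proof -
  have "norm (x - a) \<le> (\<Sum>i\<in>UNIV. \<bar>(x - a) $ i\<bar>)" by (rule norm_le_l1_cart)
  also have "\<dots> \<le> (\<Sum>i\<in>(UNIV::'n set). \<rho>)"
    by (rule sum_mono) (use assms in \<open>auto simp: box_at_def\<close>)
  finally show ?thesis by simp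
qed

text \<open>The box is so small that its corner still lies in the ball of convergence. Unconditional
  convergence of a real series is absolute, and at the corner the monomials equal
  \<open>r ^ deg \<beta>\<close>.\<close>

lemma real_analytic_on_series:
  fixes f :: "real^'n \<Rightarrow> real"
  assumes "real_analytic_on f S" "b \<in> S"
  obtains r d where "0 < r" "\<And>y. y \<in> box_at b r \<Longrightarrow> ((\<lambda>\<beta>. mon (y - b) \<beta> * d \<beta>) has_sum f y) UNIV"
    "(\<lambda>\<beta>. \<bar>d \<beta>\<bar> * r ^ deg \<beta>) summable_on UNIV"
proof -
  from assms(1)[unfolded real_analytic_on_def, rule_format, OF assms(2)] obtain R d where R: "R > 0"
    and "\<forall>x\<in>ball b R. ((\<lambda>\<alpha>. (\<Prod>i\<in>UNIV. (x$i - b$i) ^ \<alpha> i) *\<^sub>R d \<alpha>) has_sum f x) UNIV"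
    by (elim exE conjE)
  then have d: "\<And>x. x \<in> ball b R \<Longrightarrow> ((\<lambda>\<alpha>. (\<Prod>i\<in>UNIV. (x$i - b$i) ^ \<alpha> i) *\<^sub>R d \<alpha>) has_sum f x) UNIV"
    by blast
  define r where "r = R / (2 * CARD('n))"
  have r: "0 < r" using R by (simp add: r_def)
  have sub: "box_at b r \<subseteq> ball b R"
  proof
    fix x assume "x \<in> box_at b r"
    then have "norm (x - b) \<le> real CARD('n) * r" by (rule norm_le_box)
    also have "\<dots> < R" using R by (simp add: r_def)
    finally show "x \<in> ball b R" by (simp add: dist_norm norm_minus_commute)
  qed
  have s: "((\<lambda>\<beta>. mon (y - b) \<beta> * d \<beta>) has_sum f y) UNIV" if "y \<in> box_at b r" for y
    using d[of y] that sub by (auto simp: mon_def)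
  let ?y = "b + (\<chi> i. r)"
  have "((\<lambda>\<beta>. mon (?y - b) \<beta> * d \<beta>) has_sum f ?y) UNIV"
    by (rule s) (use r in \<open>auto simp: box_at_def\<close>)
  then have "(\<lambda>\<beta>. mon (?y - b) \<beta> * d \<beta>) summable_on UNIV" by (rule has_sum_imp_summable)
  then have "(\<lambda>\<beta>. norm (mon (?y - b) \<beta> * d \<beta>)) summable_on UNIV"
    by (rule summable_on_iff_abs_summable_on_real[THEN iffD1])
  moreover have "mon (?y - b) \<beta> = r ^ deg \<beta>" for \<beta>
    by (simp add: mon_def deg_def power_sum)
  ultimately have "(\<lambda>\<beta>. \<bar>d \<beta>\<bar> * r ^ deg \<beta>) summable_on UNIV"
    using r by (simp add: abs_mult mult.commute)
  with r s that show ?thesis by blast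
qed

lemma panalytic_compose:
  fixes f :: "real^'n \<Rightarrow> real" and \<Phi> :: "'p::topological_space \<Rightarrow> real^'n \<Rightarrow> real^'n"
  assumes f: "real_analytic_on f S" "\<Phi> t a \<in> S"
    and \<Phi>: "\<And>i. panalytic t a (\<lambda>s x. \<Phi> s x $ i)" and cont: "continuous_on UNIV (\<lambda>s. \<Phi> s a)"
  shows "panalytic t a (\<lambda>s x. f (\<Phi> s x))"
proof -
  obtain r d where r: "0 < r" "\<And>y. y \<in> box_at (\<Phi> t a) r \<Longrightarrow> ((\<lambda>\<beta>. mon (y - \<Phi> t a) \<beta> * d \<beta>) has_sum f y) UNIV"
    "(\<lambda>\<beta>. \<bar>d \<beta>\<bar> * r ^ deg \<beta>) summable_on UNIV"
    using real_analytic_on_series[OF f] by blast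
  have "\<exists>N \<rho>. open N \<and> t \<in> N \<and> 0 < \<rho> \<and> majorized N a \<rho> (\<lambda>s x. \<Phi> s x $ i - \<Phi> t a $ i) r" for i
    by (rule panalytic_recentre[OF \<Phi> _ r(1)]) (intro continuous_intros cont)
  then obtain N \<rho> where *: "\<And>i. open (N i)" "\<And>i. t \<in> N i" "\<And>i. 0 < \<rho> i"
    "\<And>i. majorized (N i) a (\<rho> i) (\<lambda>s x. \<Phi> s x $ i - \<Phi> t a $ i) r" by metis
  define N' \<rho>' where "N' = (\<Inter>i. N i)" "\<rho>' = Min (range \<rho>)"
  have \<rho>': "0 < \<rho>'" "\<And>i. \<rho>' \<le> \<rho> i" unfolding N'_\<rho>'_def using *(3) by auto
  have "open N'" "t \<in> N'" unfolding N'_\<rho>'_def using * by (auto intro: open_INT)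
  moreover have "majorized N' a \<rho>' (\<lambda>s x. f (\<Phi> s x)) (\<Sum>\<^sub>\<infinity>\<beta>. \<bar>d \<beta>\<bar> * r ^ deg \<beta>)"
  proof (rule majorized_compose[OF r(2,3) _ \<rho>'(1)])
    show "majorized N' a \<rho>' (\<lambda>s x. \<Phi> s x $ i - \<Phi> t a $ i) r" for i
      by (rule majorized_mono[OF *(4)[of i]]) (use \<rho>' in \<open>auto simp: N'_\<rho>'_def less_imp_le\<close>)
  qed
  ultimately show ?thesis unfolding panalytic_def using \<rho>' by blast
qed

text \<open>Binomial series around the positive value \<open>b = h t a\<close>, valid for
  \<open>\<bar>y - b\<bar> < b\<close>.\<close>

lemma panalytic_powr:
  assumes h: "panalytic t a h" and cont: "continuous_on UNIV (\<lambda>s. h s a)" and pos: "0 < h t a"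
  shows "panalytic t a (\<lambda>s x. h s x powr e)"
proof -
  define b r where "b = h t a" "r = b / 2"
  have b: "0 < b" "0 < r" "r < b" using pos by (auto simp: b_r_def)
  define d where "d k = (e gchoose k) * b powr (e - real k)" for k
  have ser: "(\<lambda>k. d k * (y - b) ^ k) sums y powr e" if "\<bar>y - b\<bar> < b" for y
    using gen_binomial_real''[OF that, of e] by (simp add: d_def)
  \<comment> \<open>Any radius strictly between \<open>r = b / 2\<close> and \<open>b\<close> would
    do: convergence there gives absolute convergence at \<open>r\<close>.\<close>
  have "summable (\<lambda>k. d k * (3 * b / 4) ^ k)"
    using ser[of "b + 3 * b / 4"] b by (simp add: sums_iff)
  then have sd: "summable (\<lambda>k. norm (d k * r ^ k))"
    by (rule powser_insidea) (use b in \<open>auto simp: b_r_def\<close>)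
  have "(\<lambda>k. norm (d k * r ^ k)) summable_on UNIV"
    by (rule norm_summable_imp_summable_on) (use sd in simp)
  then have d: "(\<lambda>k. \<bar>d k\<bar> * r ^ k) summable_on UNIV" using b by (simp add: abs_mult power_abs)
  have f: "((\<lambda>k. d k * (y - b) ^ k) has_sum y powr e) UNIV" if "\<bar>y - b\<bar> \<le> r" for y
  proof (rule norm_summable_imp_has_sum)
    show "(\<lambda>k. d k * (y - b) ^ k) sums y powr e" by (rule ser) (use that b in auto)
    show "summable (\<lambda>k. norm (d k * (y - b) ^ k))"
      by (rule summable_comparison_test'[OF sd, of 0])
         (use that b in \<open>auto simp: abs_mult power_abs intro!: mult_left_mono power_mono\<close>)
  qed
  obtain N \<rho> where *: "open N" "t \<in> N" "0 < \<rho>" "majorized N a \<rho> (\<lambda>s x. h s x - b) r"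
    using panalytic_recentre[OF h cont b(2)] unfolding b_r_def(1) by blast
  from majorized_compose_real[OF f d *(4,3)] show ?thesis unfolding panalytic_def using * by blast
qed

text \<open>Finitely many neighbourhoods cover \<open>K\<close>; the least radius and the sum of the
  bounds serve for their union.\<close>

lemma panalytic_compact:
  fixes h :: "'p::t2_space \<Rightarrow> real^'n \<Rightarrow> real"
  assumes "compact K" and h: "\<And>t. t \<in> K \<Longrightarrow> panalytic t a h"
  shows "\<exists>\<rho> M. 0 < \<rho> \<and> majorized K a \<rho> h M"
proof -
  from h obtain N where N: "\<And>t. t \<in> K \<Longrightarrow> open (N t) \<and> t \<in> N t \<and> (\<exists>\<rho> M. 0 < \<rho> \<and> majorized (N t) a \<rho> h M)"
    unfolding panalytic_def by metis
  obtain D where D: "D \<subseteq> K" "finite D" "K \<subseteq> (\<Union>t\<in>D. N t)"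
    using compactE_image[OF assms(1), of K N] N by (metis UN_I subsetI)
  have "\<exists>\<rho> M. 0 < \<rho> \<and> majorized (\<Union>t\<in>D. N t) a \<rho> h M"
    using D(2,1)
  proof (induction D rule: finite_induct)
    case empty
    have "majorized {} a 1 h 0" by (rule majorizedI[of "\<lambda>_ _. 0" "\<lambda>_. 0"]) auto
    then show ?case by (intro exI[of _ 1] exI[of _ 0]) auto
  next
    case (insert s D)
    then obtain \<rho> M where 1: "0 < \<rho>" "majorized (\<Union>t\<in>D. N t) a \<rho> h M" by auto
    from insert N[of s] obtain \<rho>' M' where 2: "0 < \<rho>'" "majorized (N s) a \<rho>' h M'" "open (N s)" by auto
    have "majorized (N s \<union> (\<Union>t\<in>D. N t)) a (min \<rho> \<rho>') h (M' + M)"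
      by (rule majorized_Un; (rule majorized_mono[OF 1(2)] majorized_mono[OF 2(2)])?) (use 1 2 in auto)
    then show ?case using 1 2 by (intro exI[of _ "min \<rho> \<rho>'"] exI[of _ "M' + M"]) auto
  qed
  then obtain \<rho> M where *: "0 < \<rho>" "majorized (\<Union>t\<in>D. N t) a \<rho> h M" by blast
  have "majorized K a \<rho> h M" by (rule majorized_mono[OF *(2)]) (use * D in auto)
  with * show ?thesis by blast
qed

text \<open>Compactness of the parameter range provides the common radius on which the integral is
  again a power series.\<close>

lemma panalytic_integral:
  fixes h :: "'p::t2_space \<Rightarrow> real^'n \<Rightarrow> real"
  assumes "compact K" "\<And>t. t \<in> K \<Longrightarrow> panalytic t a h" "finite_measure P"
    and "g \<in> measurable P borel" "\<And>y. y \<in> space P \<Longrightarrow> g y \<in> K"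
    and "w \<in> borel_measurable P" "\<And>y. y \<in> space P \<Longrightarrow> \<bar>w y\<bar> \<le> W" "0 \<le> W"
  shows "panalytic s a (\<lambda>_ x. \<integral>y. w y * h (g y) x \<partial>P)"
proof -
  obtain \<rho> M where *: "0 < \<rho>" "majorized K a \<rho> h M"
    using panalytic_compact[OF assms(1,2)] by blast
  from majorized_integral[OF *(2) assms(3-8) *(1), of UNIV] show ?thesis
    unfolding panalytic_def using * by blast
qed

section \<open>Germs and real analytic functions\<close>

lemma panalytic_imp_real_analytic_on:
  fixes f :: "real^'n \<Rightarrow> real"
  assumes "open S" "\<And>a. a \<in> S \<Longrightarrow> panalytic (t::'p::topological_space) a (\<lambda>_. f)"
  shows "real_analytic_on f S"
  unfolding real_analytic_on_def
proof
  fix a assume a: "a \<in> S"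
  from assms(2)[OF this] obtain N \<rho> M where *: "t \<in> N" "0 < \<rho>" "majorized N a \<rho> (\<lambda>_. f) M"
    unfolding panalytic_def by blast
  from *(3) obtain c C where cm: "majorant N a \<rho> (\<lambda>_. f) M c C"
    unfolding majorized_def by blast
  from assms(1) a obtain e where e: "e > 0" "ball a e \<subseteq> S" using open_contains_ball by blast
  have "((\<lambda>\<alpha>. (\<Prod>i\<in>UNIV. (x$i - a$i) ^ \<alpha> i) *\<^sub>R c \<alpha> t) has_sum f x) UNIV" if "x \<in> ball a (min e \<rho>)" for x
    using majorantD(6)[OF cm *(1), of x] that component_bound_box[of x a \<rho>]
    by (auto simp: mon_def dist_norm norm_minus_commute)
  then show "\<exists>r>0. ball a r \<subseteq> S \<and>
        (\<exists>c. \<forall>x\<in>ball a r. ((\<lambda>\<alpha>. (\<Prod>i\<in>UNIV. (x$i - a$i) ^ \<alpha> i) *\<^sub>R c \<alpha>) has_sum f x) UNIV)"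
    using e *(2) by (intro exI[of _ "min e \<rho>"] conjI exI[of _ "\<lambda>\<alpha>. c \<alpha> t"]) auto
qed

lemma real_analytic_on_imp_panalytic:
  fixes f :: "real^'n \<Rightarrow> real"
  assumes "real_analytic_on f S" "a \<in> S"
  shows "panalytic (t::'p::topological_space) a (\<lambda>_. f)"
  using panalytic_compose[of f S "\<lambda>_ x. x" t a] assms by (simp add: panalytic_coord)

lemma real_analytic_on_vec:
  fixes V :: "real^'n \<Rightarrow> real^'m"
  assumes "open S" "\<And>i. real_analytic_on (\<lambda>x. V x $ i) S"
  shows "real_analytic_on V S"
  unfolding real_analytic_on_def
proof
  fix a assume a: "a \<in> S"
  define P where "P x c s \<longleftrightarrow> ((\<lambda>\<alpha>. (\<Prod>i\<in>UNIV. (x$i - a$i) ^ \<alpha> i) *\<^sub>R c \<alpha>) has_sum s) UNIV"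
    for x :: "real^'n" and c :: "('n \<Rightarrow> nat) \<Rightarrow> real" and s
  have "\<exists>r>0. ball a r \<subseteq> S \<and> (\<exists>c. \<forall>x\<in>ball a r. P x c (V x $ i))" for i
    using bspec[OF assms(2)[of i, unfolded real_analytic_on_def] a] unfolding P_def .
  then obtain r c where r: "\<And>i. r i > 0" "\<And>i. ball a (r i) \<subseteq> S"
    and P: "\<And>i x. x \<in> ball a (r i) \<Longrightarrow> P x (c i) (V x $ i)"
    by metis
  note c = P[unfolded P_def]
  define \<rho> where "\<rho> = Min (range r)"
  have \<rho>: "\<rho> > 0" "\<And>i. \<rho> \<le> r i" unfolding \<rho>_def using r by auto
  have "((\<lambda>\<alpha>. (\<Prod>i\<in>UNIV. (x$i - a$i) ^ \<alpha> i) *\<^sub>R (\<chi> i. c i \<alpha>)) has_sum V x) UNIV" if "x \<in> ball a \<rho>" for x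
    unfolding has_sum_def
  proof (rule vec_tendstoI)
    fix i
    have "((\<lambda>\<alpha>. (\<Prod>i\<in>UNIV. (x$i - a$i) ^ \<alpha> i) *\<^sub>R c i \<alpha>) has_sum V x $ i) UNIV"
      by (rule c) (use that \<rho>(2)[of i] in auto)
    then show "((\<lambda>F. sum (\<lambda>\<alpha>. (\<Prod>i\<in>UNIV. (x$i - a$i) ^ \<alpha> i) *\<^sub>R (\<chi> i. c i \<alpha>)) F $ i) \<longlongrightarrow> V x $ i)
        (finite_subsets_at_top UNIV)"
      by (simp add: has_sum_def)
  qed
  moreover have "ball a \<rho> \<subseteq> S"
  proof -
    \<comment> \<open>\<open>undefined\<close> is merely some index: every one of the balls lies in
      \<open>S\<close>.\<close>
    have "ball a \<rho> \<subseteq> ball a (r undefined)" using \<rho>(2)[of undefined] by auto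
    then show ?thesis using r(2) by blast
  qed
  ultimately show "\<exists>r>0. ball a r \<subseteq> S \<and> (\<exists>c. \<forall>x\<in>ball a r. ((\<lambda>\<alpha>. (\<Prod>i\<in>UNIV. (x$i - a$i) ^ \<alpha> i) *\<^sub>R c \<alpha>) has_sum V x) UNIV)"
    using \<rho>(1) by (intro exI[of _ \<rho>] conjI exI[of _ "\<lambda>\<alpha>. \<chi> i. c i \<alpha>"] ballI) simp_all
qed

lemma deg_ge_2:
  assumes "\<alpha> \<noteq> (\<lambda>_. 0)" "\<And>i. \<alpha> \<noteq> (\<lambda>_. 0)(i := Suc 0)"
  shows "2 \<le> deg \<alpha>"
proof -
  from assms(1) obtain i where i: "\<alpha> i \<noteq> 0" by auto
  from assms(2)[of i] obtain j where j: "\<alpha> j \<noteq> ((\<lambda>_. 0)(i := Suc 0)) j" by blast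
  show ?thesis
  proof (cases "j = i")
    case True
    have "\<alpha> i \<le> deg \<alpha>" unfolding deg_def by (rule member_le_sum) auto
    then show ?thesis using True j i by auto
  next
    case False
    have "sum \<alpha> {i,j} \<le> deg \<alpha>" unfolding deg_def by (rule sum_mono2) auto
    then show ?thesis using False i j by auto
  qed
qed

text \<open>After removing the terms of degree 0 and 1, every remaining term gains a factor
  \<open>(norm (x - a) / r)\<^sup>2\<close>, so the linear part \<open>L\<close> is the derivative
  with a quadratic error.\<close>

lemma real_analytic_on_differentiable:
  fixes f :: "real^'n \<Rightarrow> real"
  assumes "real_analytic_on f S" "a \<in> S"
  shows "f differentiable (at a)"
proof -
  obtain r d where r: "0 < r" and hs: "\<And>y. y \<in> box_at a r \<Longrightarrow> ((\<lambda>\<beta>. mon (y - a) \<beta> * d \<beta>) has_sum f y) UNIV"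
    and sm: "(\<lambda>\<beta>. \<bar>d \<beta>\<bar> * r ^ deg \<beta>) summable_on UNIV"
    using real_analytic_on_series[OF assms] by blast
  let ?z = "\<lambda>_::'n. 0::nat" and ?e = "\<lambda>i::'n. (\<lambda>_. 0)(i := Suc 0)"
  define L where "L v = (\<Sum>i\<in>UNIV. v $ i * d (?e i))" for v :: "real^'n"
  define M where "M = (\<Sum>\<^sub>\<infinity>\<beta>. \<bar>d \<beta>\<bar> * r ^ deg \<beta>)"
  define F where "F = insert ?z (range ?e)"
  have inj: "inj ?e"
    by (rule injI) (metis fun_upd_apply nat.distinct(1))
  have zF: "?z \<notin> range ?e"
    by (metis (no_types, lifting) fun_upd_apply imageE nat.distinct(1))
  have bl: "bounded_linear L" unfolding L_def
    by (intro bounded_linear_sum bounded_linear_mult_const bounded_linear_vec_nth)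
  have fin: "finite F" by (simp add: F_def)
  have hF: "(\<Sum>\<beta>\<in>F. mon v \<beta> * d \<beta>) = d ?z + L v" for v
    unfolding F_def using zF by (simp add: sum.reindex[OF inj] mon_0 mon_single L_def)
  have fa: "f a = d ?z"
  proof -
    have "((\<lambda>\<beta>. mon (a - a) \<beta> * d \<beta>) has_sum f a) UNIV" by (rule hs) (use r in \<open>auto simp: box_at_def\<close>)
    moreover have "((\<lambda>\<beta>. mon (a - a) \<beta> * d \<beta>) has_sum d ?z) UNIV"
      by (rule has_sum_finite_neutralI[of "{?z}"]) (auto simp: mon_0 mon_zero_vec)
    ultimately show ?thesis using has_sum_unique by blast
  qed
  have bound: "\<bar>f x - f a - L (x - a)\<bar> \<le> (norm (x - a) / r)\<^sup>2 * M" if x: "norm (x - a) \<le> r" for x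
  proof -
    let ?\<sigma> = "norm (x - a)"
    have xb: "x \<in> box_at a ?\<sigma>" by (rule component_bound_box) simp
    have "x \<in> box_at a r" using component_bound_box[OF x] .
    from hs[OF this] have "((\<lambda>\<beta>. mon (x - a) \<beta> * d \<beta>) has_sum f x) UNIV" .
    then have "((\<lambda>\<beta>. mon (x - a) \<beta> * d \<beta>) has_sum f x - (\<Sum>\<beta>\<in>F. mon (x - a) \<beta> * d \<beta>)) (UNIV - F)"
      by (rule has_sum_Diff) (use fin in \<open>auto intro: has_sum_finite\<close>)
    then have 1: "((\<lambda>\<beta>. mon (x - a) \<beta> * d \<beta>) has_sum f x - f a - L (x - a)) (UNIV - F)"
      unfolding hF fa by (simp add: diff_diff_eq)
    have sm': "(\<lambda>\<beta>. (?\<sigma> / r)\<^sup>2 * (\<bar>d \<beta>\<bar> * r ^ deg \<beta>)) summable_on UNIV"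
      by (rule summable_on_cmult_right[OF sm])
    then have sm'': "(\<lambda>\<beta>. (?\<sigma> / r)\<^sup>2 * (\<bar>d \<beta>\<bar> * r ^ deg \<beta>)) summable_on (UNIV - F)"
      by (rule summable_on_subset_banach) auto
    have le: "norm (mon (x - a) \<beta> * d \<beta>) \<le> (?\<sigma> / r)\<^sup>2 * (\<bar>d \<beta>\<bar> * r ^ deg \<beta>)" if "\<beta> \<in> UNIV - F" for \<beta>
    proof -
      from that have "2 \<le> deg \<beta>" by (intro deg_ge_2) (auto simp: F_def)
      then obtain k where k: "deg \<beta> = k + 2" using le_iff_add by (metis add.commute)
      have "\<bar>mon (x - a) \<beta>\<bar> \<le> ?\<sigma> ^ deg \<beta>"
        by (rule abs_mon_le) (use xb in \<open>auto simp: box_at_def\<close>)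
      also have "\<dots> = ?\<sigma>\<^sup>2 * ?\<sigma> ^ k" by (simp add: k power_add power2_eq_square mult.commute)
      also have "\<dots> \<le> ?\<sigma>\<^sup>2 * r ^ k" using x by (intro mult_left_mono power_mono) auto
      also have "\<dots> = (?\<sigma> / r)\<^sup>2 * r ^ deg \<beta>" using r by (simp add: k power_add power_divide power2_eq_square)
      finally have "\<bar>mon (x - a) \<beta>\<bar> * \<bar>d \<beta>\<bar> \<le> (?\<sigma> / r)\<^sup>2 * r ^ deg \<beta> * \<bar>d \<beta>\<bar>"
        by (rule mult_right_mono) auto
      then show ?thesis by (simp add: abs_mult mult_ac)
    qed
    have "\<bar>f x - f a - L (x - a)\<bar> \<le> infsum (\<lambda>\<beta>. (?\<sigma> / r)\<^sup>2 * (\<bar>d \<beta>\<bar> * r ^ deg \<beta>)) (UNIV - F)"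
      using norm_infsum_le[OF 1 has_sum_infsum[OF sm''] le] by simp
    also have "\<dots> \<le> infsum (\<lambda>\<beta>. (?\<sigma> / r)\<^sup>2 * (\<bar>d \<beta>\<bar> * r ^ deg \<beta>)) UNIV"
      by (rule infsum_mono2[OF sm'' sm']) (use r in auto)
    also have "\<dots> = (?\<sigma> / r)\<^sup>2 * M" unfolding M_def by (rule infsum_cmult_right')
    finally show ?thesis .
  qed
  have "(f has_derivative L) (at a)"
    unfolding has_derivative_at'
  proof (intro conjI bl allI impI)
    fix e :: real assume e: "0 < e"
    have M: "0 \<le> M" unfolding M_def by (rule infsum_nonneg) (use r in auto)
    \<comment> \<open>Chosen so that the quadratic error divided by the distance stays below
      \<open>e\<close>; \<open>M + 1\<close> also covers \<open>M = 0\<close>.\<close>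
    define \<delta> where "\<delta> = min r (e * r\<^sup>2 / (M + 1))"
    have \<delta>: "0 < \<delta>" using r e M by (simp add: \<delta>_def)
    show "\<exists>\<delta>>0. \<forall>x. 0 < norm (x - a) \<and> norm (x - a) < \<delta> \<longrightarrow>
        norm (f x - f a - L (x - a)) / norm (x - a) < e"
    proof (intro exI[of _ \<delta>] conjI allI impI \<delta>)
      fix x assume x: "0 < norm (x - a) \<and> norm (x - a) < \<delta>"
      let ?\<sigma> = "norm (x - a)"
      have s: "?\<sigma> * (M + 1) < e * r\<^sup>2" using x M by (simp add: \<delta>_def pos_less_divide_eq)
      have "\<bar>f x - f a - L (x - a)\<bar> \<le> (?\<sigma> / r)\<^sup>2 * M"
        by (rule bound) (use x in \<open>simp add: \<delta>_def\<close>)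
      then have "norm (f x - f a - L (x - a)) / ?\<sigma> \<le> (?\<sigma> / r)\<^sup>2 * M / ?\<sigma>"
        using x by (simp add: divide_right_mono)
      also have "\<dots> = ?\<sigma> * M / r\<^sup>2" using x r by (simp add: power2_eq_square field_simps)
      also have "\<dots> < e"
      proof -
        have "?\<sigma> * M \<le> ?\<sigma> * (M + 1)" by (intro mult_left_mono) auto
        with s have "?\<sigma> * M < e * r\<^sup>2" by linarith
        then show ?thesis using r by (simp add: pos_divide_less_eq)
      qed
      finally show "norm (f x - f a - L (x - a)) / ?\<sigma> < e" .
    qed
  qed
  then show ?thesis by (rule differentiableI)
qed

lemma real_analytic_on_continuous_on:
  fixes f :: "real^'n \<Rightarrow> real"
  assumes "real_analytic_on f S" shows "continuous_on S f"
  using real_analytic_on_differentiable[OF assms]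
  by (intro continuous_at_imp_continuous_on ballI differentiable_imp_continuous_within)

section \<open>Rotations and averages over angles\<close>

lemma borel_measurable_indicator_compose:
  assumes "S \<in> sets N" "f \<in> measurable M N"
  shows "(\<lambda>z. indicator S (f z) :: ennreal) \<in> borel_measurable M"
  by (rule measurable_compose[OF assms(2)]) (use assms(1) in simp)

text \<open>Uniqueness of translation invariant measures, by Fubini: the image measure is translation
  invariant and agrees with Lebesgue measure on the unit ball.\<close>

lemma lborel_distr_orthogonal:
  fixes T :: "'a::euclidean_space \<Rightarrow> 'a"
  assumes T: "orthogonal_transformation T"
  shows "distr lborel borel T = lborel"
proof -
  have lin: "linear T" using T by (rule orthogonal_transformation_linear)
  then have Tm[measurable]: "T \<in> borel_measurable borel"
    by (intro borel_measurable_continuous_onI linear_continuous_on linear_conv_bounded_linear[THEN iffD1])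
  have surj: "surj T" using T by (rule orthogonal_transformation_surj)
  define \<mu> where "\<mu> = distr lborel borel T"
  have sets_\<mu>[simp, measurable_cong]: "sets \<mu> = sets borel" by (simp add: \<mu>_def)
  have space_\<mu>[simp]: "space \<mu> = UNIV" by (simp add: \<mu>_def)
  have vimage: "T -` ball 0 r = ball 0 r" for r
    using orthogonal_transformation_norm[OF T] by auto
  have ball: "emeasure \<mu> (ball 0 r) = emeasure lborel (ball (0::'a) r)" for r
    unfolding \<mu>_def by (subst emeasure_distr) (auto simp: vimage)
  have "sigma_finite_measure \<mu>"
  proof
    show "\<exists>A. countable A \<and> A \<subseteq> sets \<mu> \<and> \<Union> A = space \<mu> \<and> (\<forall>a\<in>A. emeasure \<mu> a \<noteq> \<infinity>)"
    proof (intro exI[of _ "range (\<lambda>n::nat. ball 0 (real n))"] conjI ballI)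
      show "\<Union> (range (\<lambda>n::nat. ball 0 (real n))) = space \<mu>"
        using reals_Archimedean2 by (auto simp: dist_norm)
      show "emeasure \<mu> A \<noteq> \<infinity>" if "A \<in> range (\<lambda>n::nat. ball 0 (real n))" for A
      proof -
        from that obtain n where A: "A = ball 0 (real n)" by blast
        show ?thesis
          using emeasure_bounded_finite[OF bounded_ball[of "0::'a" "real n"]] by (simp add: A ball)
      qed
    qed auto
  qed
  then interpret \<mu>: sigma_finite_measure \<mu> .
  interpret pr: pair_sigma_finite lborel \<mu> ..
  have shift_lborel: "(\<integral>\<^sup>+x. f (c + x) \<partial>lborel) = (\<integral>\<^sup>+x. f x \<partial>lborel)" if [measurable]: "f \<in> borel_measurable borel"
    for f :: "'a \<Rightarrow> ennreal" and c
    using nn_integral_distr[of "(+) c" lborel borel f] by (simp add: lborel_distr_plus)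
  have shift: "(\<integral>\<^sup>+y. f (c + y) \<partial>\<mu>) = (\<integral>\<^sup>+y. f y \<partial>\<mu>)" if [measurable]: "f \<in> borel_measurable borel"
    for f :: "'a \<Rightarrow> ennreal" and c
  proof -
    \<comment> \<open>A shift by \<open>c = T c'\<close> after \<open>T\<close> is a shift by
      \<open>c'\<close> before \<open>T\<close>, and Lebesgue measure does not notice the
      latter.\<close>
    obtain c' where c': "c = T c'" using surj by (metis surjD)
    have "(\<integral>\<^sup>+y. f (c + y) \<partial>\<mu>) = (\<integral>\<^sup>+z. f (T (c' + z)) \<partial>lborel)"
      unfolding \<mu>_def by (subst nn_integral_distr) (auto simp: c' linear_add[OF lin])
    also have "\<dots> = (\<integral>\<^sup>+z. f (T z) \<partial>lborel)"
      by (rule shift_lborel[where f="\<lambda>z. f (T z)"]) measurable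
    also have "\<dots> = (\<integral>\<^sup>+y. f y \<partial>\<mu>)"
      unfolding \<mu>_def by (subst nn_integral_distr) auto
    finally show ?thesis .
  qed
  let ?B = "ball (0::'a) 1"
  have Bm: "(indicator ?B :: 'a \<Rightarrow> ennreal) \<in> borel_measurable borel"
    by (rule borel_measurable_indicator) simp
  have "emeasure \<mu> A = emeasure lborel A" if [measurable]: "A \<in> sets borel" for A
  proof -
    \<comment> \<open>The integral of \<open>indicator ?B x * indicator A (x + y)\<close> is
      evaluated in both orders. Here the inner integral over \<mu> is freed of \<open>x\<close> by
      translation invariance.\<close>
    have 1: "(\<integral>\<^sup>+x. (\<integral>\<^sup>+y. indicator ?B x * indicator A (x + y) \<partial>\<mu>) \<partial>lborel) = emeasure \<mu> A * emeasure lborel ?B"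
    proof -
      have "(\<integral>\<^sup>+y. indicator ?B x * indicator A (x + y) \<partial>\<mu>) = emeasure \<mu> A * indicator ?B x" for x
        by (subst nn_integral_cmult) (auto simp: shift[of "indicator A"] mult.commute)
      then show ?thesis by (simp add: nn_integral_cmult_indicator)
    qed
    have "(\<integral>\<^sup>+x. (\<integral>\<^sup>+y. indicator ?B x * indicator A (x + y) \<partial>\<mu>) \<partial>lborel)
        = (\<integral>\<^sup>+y. (\<integral>\<^sup>+x. indicator ?B x * indicator A (x + y) \<partial>lborel) \<partial>\<mu>)"
      by (rule pr.Fubini'[symmetric]) (unfold case_prod_beta', intro borel_measurable_times_ennreal borel_measurable_indicator_compose[where N=borel]; measurable)
    \<comment> \<open>Shifting \<open>x\<close> by \<open>y\<close> moves the dependence on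
      \<open>y\<close> into the ball; after the exchange the inner integral is the \<mu>-measure of
      a translated unit ball, which is known.\<close>
    also have "\<dots> = (\<integral>\<^sup>+y. (\<integral>\<^sup>+x. indicator ?B (x - y) * indicator A x \<partial>lborel) \<partial>\<mu>)"
    proof (rule nn_integral_cong)
      fix y
      have "(\<lambda>x. indicator ?B (x - y) * indicator A x :: ennreal) \<in> borel_measurable borel"
        by (intro borel_measurable_times_ennreal borel_measurable_indicator_compose[where N=borel]) auto
      from shift_lborel[OF this, of y]
      show "(\<integral>\<^sup>+x. indicator ?B x * indicator A (x + y) \<partial>lborel) = (\<integral>\<^sup>+x. indicator ?B (x - y) * indicator A x \<partial>lborel)"
        by (simp add: add.commute)
    qed
    also have "\<dots> = (\<integral>\<^sup>+x. (\<integral>\<^sup>+y. indicator ?B (x - y) * indicator A x \<partial>\<mu>) \<partial>lborel)"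
      by (rule pr.Fubini') (unfold case_prod_beta', intro borel_measurable_times_ennreal borel_measurable_indicator_compose[where N=borel]; measurable)
    also have "\<dots> = (\<integral>\<^sup>+x. emeasure lborel ?B * indicator A x \<partial>lborel)"
    proof (rule nn_integral_cong)
      fix x
      have "(\<integral>\<^sup>+y. indicator ?B (x - y) * indicator A x \<partial>\<mu>) = (\<integral>\<^sup>+y. indicator ?B (- x + y) \<partial>\<mu>) * indicator A x"
        by (subst nn_integral_multc[symmetric])
           (auto intro!: nn_integral_cong simp: indicator_def dist_norm norm_minus_commute)
      also have "\<dots> = emeasure lborel ?B * indicator A x"
        by (subst shift[OF Bm]) (simp add: ball)
      finally show "(\<integral>\<^sup>+y. indicator ?B (x - y) * indicator A x \<partial>\<mu>) = emeasure lborel ?B * indicator A x" .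
    qed
    also have "\<dots> = emeasure lborel A * emeasure lborel ?B" by (subst nn_integral_cmult_indicator) (simp_all add: mult.commute)
    finally have "emeasure \<mu> A * emeasure lborel ?B = emeasure lborel A * emeasure lborel ?B"
      using 1 by simp
    moreover have "emeasure lborel ?B \<noteq> 0" "emeasure lborel ?B \<noteq> \<infinity>"
      using content_ball_pos[of 1 "0::'a"] emeasure_bounded_finite[OF bounded_ball[of "0::'a" 1]]
      by (auto simp: measure_def less_top[symmetric] simp del: content_ball_gt_0_iff)
    ultimately show ?thesis by (simp add: mult.commute[of _ "emeasure lborel ?B"] ennreal_mult_cancel_left)
  qed
  then show ?thesis unfolding \<mu>_def[symmetric] by (intro measure_eqI) auto
qed

section \<open>Coordinate rotations\<close>

definition rot :: "'n \<Rightarrow> 'n \<Rightarrow> real \<Rightarrow> real^'n \<Rightarrow> real^'n" where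
  "rot p q t x = (\<chi> i. if i = p then cos t * x$p - sin t * x$q
                        else if i = q then sin t * x$p + cos t * x$q else x$i)"

text \<open>The velocity field of \<open>rot p q\<close> for distinct axes. It vanishes for
  \<open>p = q\<close>, so sums may run over all pairs.\<close>

definition rot_gen :: "'n \<Rightarrow> 'n \<Rightarrow> real^'n \<Rightarrow> real^'n" where
  "rot_gen p q x = x$p *\<^sub>R axis q 1 - x$q *\<^sub>R axis p 1"

definition snorm :: "'n set \<Rightarrow> real^'n \<Rightarrow> real" where
  "snorm J x = sqrt (\<Sum>i\<in>J. (x$i)\<^sup>2)"

lemma snorm_UNIV: "snorm UNIV x = norm x"
  by (simp add: snorm_def norm_vec_def L2_set_def)

lemma snorm_nonneg: "0 \<le> snorm J x"
  by (simp add: snorm_def sum_nonneg)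

lemma snorm_sq: "(snorm J x)\<^sup>2 = (\<Sum>i\<in>J. (x$i)\<^sup>2)"
  by (simp add: snorm_def sum_nonneg)

lemma rot_0: "rot p q 0 x = x"
  by (simp add: rot_def vec_eq_iff)

lemma rot_add: "p \<noteq> q \<Longrightarrow> rot p q s (rot p q t x) = rot p q (s + t) x"
  by (simp add: rot_def vec_eq_iff sin_add cos_add algebra_simps)

lemma snorm_rot:
  assumes "p \<noteq> q" "p \<in> J" "q \<in> J"
  shows "snorm J (rot p q t x) = snorm J x"
proof -
  have fin: "finite J" by simp
  have split: "(\<Sum>i\<in>J. f i) = f p + f q + (\<Sum>i\<in>J - {p} - {q}. f i)" for f :: "'a \<Rightarrow> real"
    using assms fin by (simp add: sum.remove[of J p] sum.remove[of "J - {p}" q])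
  have "(\<Sum>i\<in>J - {p} - {q}. (rot p q t x $ i)\<^sup>2) = (\<Sum>i\<in>J - {p} - {q}. (x$i)\<^sup>2)"
    by (intro sum.cong) (auto simp: rot_def)
  moreover have "(rot p q t x $ p)\<^sup>2 + (rot p q t x $ q)\<^sup>2 = (x$p)\<^sup>2 + (x$q)\<^sup>2"
  proof -
    have "(cos t * a - sin t * b)\<^sup>2 + (sin t * a + cos t * b)\<^sup>2 = ((sin t)\<^sup>2 + (cos t)\<^sup>2) * (a\<^sup>2 + b\<^sup>2)" for a b
      by algebra
    then show ?thesis using assms by (simp add: rot_def)
  qed
  ultimately show ?thesis
    unfolding snorm_def split[of "\<lambda>i. (_ $ i)\<^sup>2"] by simp
qed

lemma norm_rot: "p \<noteq> q \<Longrightarrow> norm (rot p q t x) = norm x"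
  using snorm_rot[of p q UNIV] by (simp add: snorm_UNIV)

lemma linear_rot: "linear (rot p q t)"
  by (rule linearI) (auto simp: rot_def vec_eq_iff algebra_simps)

lemma orthogonal_rot: "p \<noteq> q \<Longrightarrow> orthogonal_transformation (rot p q t)"
  unfolding orthogonal_transformation using linear_rot norm_rot by blast

lemma continuous_rot: "continuous_on UNIV (\<lambda>(t, x). rot p q t x)"
  unfolding rot_def case_prod_beta
proof (rule continuous_on_vec_lambda)
  fix i
  show "continuous_on UNIV (\<lambda>z :: real \<times> (real^'a). if i = p then cos (fst z) * snd z $ p - sin (fst z) * snd z $ q
      else if i = q then sin (fst z) * snd z $ p + cos (fst z) * snd z $ q else snd z $ i)"
    by (cases "i = p"; cases "i = q") (auto intro!: continuous_intros)
qed

lemma continuous_rot_angle: "continuous_on UNIV (\<lambda>t. rot p q t x)"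
  using continuous_on_compose2[OF continuous_rot, of UNIV "\<lambda>t. (t, x)" p q]
  by (simp add: continuous_on_Pair continuous_on_id continuous_on_const)

lemma measurable_rot[measurable (raw)]:
  assumes [measurable]: "f \<in> borel_measurable M" "g \<in> borel_measurable M"
  shows "(\<lambda>x. rot p q (f x) (g x)) \<in> borel_measurable M"
proof -
  have "(\<lambda>x. (\<lambda>(t, x). rot p q t x) (f x, g x)) \<in> borel_measurable M"
    by (rule borel_measurable_continuous_on[OF continuous_rot]) measurable
  then show ?thesis by simp
qed

lemma has_vector_derivative_rot:
  assumes "p \<noteq> q"
  shows "((\<lambda>t. rot p q t x) has_vector_derivative rot_gen p q x) (at 0)"
proof -
  have "rot p q t x = x + ((cos t - 1) * x$p - sin t * x$q) *\<^sub>R axis p 1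
      + (sin t * x$p + (cos t - 1) * x$q) *\<^sub>R axis q 1" for t
    using assms by (auto simp: rot_def vec_eq_iff axis_def algebra_simps)
  then show ?thesis
    by (auto simp: rot_gen_def intro!: derivative_eq_intros)
qed

text \<open>Stands in for the uniform measure on the sphere: only the directions of its points are
  used later, and its rotation invariance comes from Lebesgue measure.\<close>

definition ball_unif :: "(real^'n) measure" where
  "ball_unif = uniform_measure lborel (ball 0 1)"

lemma emeasure_unit_ball: "emeasure lborel (ball (0::real^'n) 1) \<noteq> 0" "emeasure lborel (ball (0::real^'n) 1) \<noteq> \<infinity>"
  using content_ball_pos[of 1 "0::real^'n"] emeasure_bounded_finite[OF bounded_ball[of "0::real^'n" 1]]
  by (auto simp: measure_def less_top[symmetric] simp del: content_ball_gt_0_iff)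

lemma sets_ball_unif[simp, measurable_cong]: "sets ball_unif = sets borel"
  and space_ball_unif[simp]: "space ball_unif = UNIV"
  by (simp_all add: ball_unif_def)

lemma emeasure_ball_unif_space: "emeasure (ball_unif :: (real^'n) measure) UNIV = 1"
proof -
  have "emeasure (ball_unif :: (real^'n) measure) UNIV = emeasure lborel (ball (0::real^'n) 1) / emeasure lborel (ball (0::real^'n) 1)"
    unfolding ball_unif_def by (subst emeasure_uniform_measure) auto
  then show ?thesis using emeasure_unit_ball[where 'n='n] by (simp add: ennreal_divide_self less_top)
qed

lemma measure_ball_unif_space[simp]: "measure (ball_unif :: (real^'n) measure) UNIV = 1"
  by (simp add: measure_def emeasure_ball_unif_space)

interpretation ball_unif: finite_measure "ball_unif :: (real^'n) measure"
  by standard (simp add: emeasure_ball_unif_space)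

text \<open>Almost surely excludes the zero denominators in \<open>resample\<close> and in the
  formulas for random angles.\<close>

lemma AE_ball_unif_nonzero: "AE y in (ball_unif :: (real^'n) measure). \<forall>i. y $ i \<noteq> 0"
  unfolding ball_unif_def
proof (rule AE_uniform_measureI)
  have "AE y in lborel. (y :: real^'n) $ i \<noteq> 0" for i
  proof -
    have "negligible {y :: real^'n. y $ i = 0}" by (rule negligible_standard_hyperplane_cart)
    then have "{y :: real^'n. y $ i = 0} \<in> null_sets lebesgue" by (simp add: negligible_iff_null_sets)
    moreover have "{y :: real^'n. y $ i = 0} \<in> sets borel" by measurable
    ultimately have "{y :: real^'n. y $ i = 0} \<in> null_sets lborel"
      by (simp add: null_sets_def)
    then show ?thesis by (rule AE_I') auto
  qed
  then have "AE y in lborel. \<forall>i. (y :: real^'n) $ i \<noteq> 0" by (simp add: AE_all_countable)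
  then show "AE y in lborel. (y :: real^'n) \<in> ball 0 1 \<longrightarrow> (\<forall>i. y $ i \<noteq> 0)" by eventually_elim auto
qed simp

lemma distr_ball_unif_orthogonal:
  fixes T :: "real^'n \<Rightarrow> real^'n"
  assumes T: "orthogonal_transformation T"
  shows "distr ball_unif borel T = ball_unif"
proof (rule measure_eqI)
  have lin: "linear T" using T by (rule orthogonal_transformation_linear)
  then have Tm[measurable]: "T \<in> borel_measurable borel"
    by (intro borel_measurable_continuous_onI linear_continuous_on linear_conv_bounded_linear[THEN iffD1])
  fix A assume "A \<in> sets (distr ball_unif borel T)"
  then have [measurable]: "A \<in> sets borel" by simp
  have [measurable]: "T -` A \<in> sets borel" using measurable_sets[OF Tm, of A] by simp
  have eq: "ball 0 1 \<inter> T -` A = T -` (ball 0 1 \<inter> A)"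
    using orthogonal_transformation_norm[OF T] by auto
  have "emeasure lborel (T -` (ball 0 1 \<inter> A)) = emeasure (distr lborel borel T) (ball 0 1 \<inter> A)"
    by (subst emeasure_distr) auto
  then have "emeasure lborel (ball 0 1 \<inter> T -` A) = emeasure lborel (ball 0 1 \<inter> A)"
    by (simp add: eq lborel_distr_orthogonal[OF T])
  then show "emeasure (distr ball_unif borel T) A = emeasure ball_unif A"
    unfolding ball_unif_def by (subst emeasure_distr) auto
qed simp

section \<open>Averaged rotations and their potentials\<close>

lemma open_annulus: "open (annulus a b)"
  unfolding annulus_def by (intro open_Collect_conj open_Collect_less continuous_intros)

text \<open>Vanishing outside the annulus makes these functions Borel measurable everywhere.\<close>

definition admissible :: "real \<Rightarrow> real \<Rightarrow> (real^'n \<Rightarrow> real) \<Rightarrow> bool" where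
  "admissible a b h \<longleftrightarrow> real_analytic_on h (annulus a b) \<and> (\<forall>x. x \<notin> annulus a b \<longrightarrow> h x = 0)"

lemma admissible_measurable[measurable_dest]:
  assumes "admissible a b h" shows "h \<in> borel_measurable borel"
proof -
  have "(\<lambda>x. indicator (annulus a b) x *\<^sub>R h x) \<in> borel_measurable borel"
    using assms open_annulus[of a b] unfolding admissible_def
    by (intro borel_measurable_continuous_on_indicator real_analytic_on_continuous_on borel_open) auto
  also have "(\<lambda>x. indicator (annulus a b) x *\<^sub>R h x) = h"
    using assms by (auto simp: admissible_def fun_eq_iff indicator_def)
  finally show ?thesis .
qed

lemma admissible_bounded_shell:
  fixes h :: "real^'n \<Rightarrow> real"
  assumes "admissible a b h" "a < r1" "r2 < b"
  obtains B where "0 \<le> B" "\<And>x. r1 \<le> norm x \<Longrightarrow> norm x \<le> r2 \<Longrightarrow> \<bar>h x\<bar> \<le> B"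
proof -
  let ?S = "{x :: real^'n. r1 \<le> norm x \<and> norm x \<le> r2}"
  have "closed ?S" by (intro closed_Collect_conj closed_Collect_le continuous_intros)
  moreover have "bounded ?S" by (rule boundedI[of _ r2]) auto
  ultimately have "compact ?S" using compact_eq_bounded_closed by blast
  moreover have "continuous_on ?S h"
    using assms real_analytic_on_continuous_on[of h "annulus a b"]
    by (auto simp: admissible_def annulus_def elim!: continuous_on_subset)
  ultimately have "bounded (h ` ?S)" by (intro compact_imp_bounded compact_continuous_image)
  then obtain B where "\<And>x. x \<in> ?S \<Longrightarrow> norm (h x) \<le> B" unfolding bounded_iff by auto
  then have "\<bar>h x\<bar> \<le> max 0 B" if "r1 \<le> norm x" "norm x \<le> r2" for x
    using that by (force simp: le_max_iff_disj)
  then show ?thesis by (intro that[of "max 0 B"]) auto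
qed

lemma admissible_bounded_sphere:
  assumes "admissible a b h"
  obtains B where "0 \<le> B" "\<And>x. norm x = r \<Longrightarrow> \<bar>h x\<bar> \<le> B"
proof (cases "a < r \<and> r < b")
  case True
  then obtain B where "0 \<le> B" "\<And>x. r \<le> norm x \<Longrightarrow> norm x \<le> r \<Longrightarrow> \<bar>h x\<bar> \<le> B"
    using admissible_bounded_shell[OF assms, of r r] by blast
  then show ?thesis by (intro that[of B]) auto
next
  case False
  then show ?thesis using assms by (intro that[of 0]) (auto simp: admissible_def annulus_def)
qed

text \<open>The coordinates of \<open>rot p q t x\<close> are linear in \<open>x\<close> with
  continuous functions of \<open>t\<close> as coefficients, and the orbit of \<open>x\<close> stays
  in the annulus.\<close>

lemma panalytic_rot:
  assumes "real_analytic_on h (annulus a b)" "x \<in> annulus a b" "p \<noteq> q"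
  shows "panalytic t x (\<lambda>t x. h (rot p q t x))"
proof (rule panalytic_compose[OF assms(1)])
  show "rot p q t x \<in> annulus a b" using assms by (simp add: annulus_def norm_rot)
  show "panalytic t x (\<lambda>s y. rot p q s y $ i)" for i
    unfolding rot_def vec_lambda_beta
    by (cases "i = p"; cases "i = q")
       (auto intro!: panalytic_diff panalytic_add panalytic_mult panalytic_coord panalytic_param continuous_intros)
  show "continuous_on UNIV (\<lambda>s. rot p q s x)" by (rule continuous_rot_angle)
qed

text \<open>The bound 7 stands for any number above \<open>2 pi\<close>. Random angles are functions of a
  uniformly distributed point of the unit ball, so that no density of their law is needed.\<close>

definition angle_fun :: "(real^'n \<Rightarrow> real) \<Rightarrow> bool" where
  "angle_fun \<beta> \<longleftrightarrow> \<beta> \<in> borel_measurable borel \<and> (\<forall>y. \<bar>\<beta> y\<bar> \<le> 7)"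

definition rot_avg :: "'n \<Rightarrow> 'n \<Rightarrow> (real^'n \<Rightarrow> real) \<Rightarrow> (real^'n \<Rightarrow> real) \<Rightarrow> real^'n \<Rightarrow> real" where
  "rot_avg p q \<beta> h x = (\<integral>y. h (rot p q (\<beta> y) x) \<partial>ball_unif)"

lemma admissible_rot_avg:
  assumes h: "admissible a b h" and \<beta>: "angle_fun \<beta>" and pq: "p \<noteq> q"
  shows "admissible a b (rot_avg p q \<beta> h)"
  unfolding admissible_def
proof (intro conjI allI impI)
  show "real_analytic_on (rot_avg p q \<beta> h) (annulus a b)"
  proof (rule panalytic_imp_real_analytic_on[OF open_annulus, where t="0::real"])
    fix x :: "real^'a" assume x: "x \<in> annulus a b"
    have "panalytic (0::real) x (\<lambda>_ x. \<integral>y. 1 * h (rot p q (\<beta> y) x) \<partial>ball_unif)"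
      by (rule panalytic_integral[where K="{-7..7}" and W=1])
         (use h \<beta> pq x in \<open>auto simp: angle_fun_def admissible_def abs_le_iff minus_le_iff
            intro!: panalytic_rot ball_unif.finite_measure_axioms\<close>)
    then show "panalytic (0::real) x (\<lambda>_. rot_avg p q \<beta> h)"
      by (simp add: rot_avg_def[abs_def])
  qed
  fix x :: "real^'a" assume "x \<notin> annulus a b"
  then have "h (rot p q t x) = 0" for t
    using h pq by (auto simp: admissible_def annulus_def norm_rot)
  then show "rot_avg p q \<beta> h x = 0" by (simp add: rot_avg_def)
qed

text \<open>The integral over \<open>t\<close> from 0 to \<open>\<beta> y\<close> is rescaled by
  \<open>t = \<beta> y * s\<close>. The domain then depends neither on \<open>y\<close> nor on the
  sign of the angle, at the price of the factor \<beta>.\<close>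

definition rot_potential :: "'n \<Rightarrow> 'n \<Rightarrow> (real^'n \<Rightarrow> real) \<Rightarrow> (real^'n \<Rightarrow> real) \<Rightarrow> real^'n \<Rightarrow> real" where
  "rot_potential p q \<beta> h x =
     (\<integral>z. - \<beta> (fst z) * h (rot p q (\<beta> (fst z) * snd z) x) \<partial>(ball_unif \<Otimes>\<^sub>M restrict_space lborel {0..1}))"

lemma finite_measure_interval: "finite_measure (restrict_space lborel {u..v::real})"
  by standard (simp add: emeasure_restrict_space space_restrict_space emeasure_lborel_Icc_eq)

lemma finite_measure_pair_interval:
  "finite_measure (ball_unif \<Otimes>\<^sub>M restrict_space lborel {0..1::real} :: ((real^'n) \<times> real) measure)"
proof -
  interpret finite_measure "restrict_space lborel {0..1::real}" by (rule finite_measure_interval)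
  interpret P: pair_sigma_finite "ball_unif :: (real^'n) measure" "restrict_space lborel {0..1::real}" ..
  show ?thesis by (rule finite_measure_pair_measure) (unfold_locales)
qed

lemma real_analytic_rot_potential:
  assumes h: "admissible a b h" and \<beta>: "angle_fun \<beta>" and pq: "p \<noteq> q"
  shows "real_analytic_on (rot_potential p q \<beta> h) (annulus a b)"
proof (rule panalytic_imp_real_analytic_on[OF open_annulus, where t="0::real"])
  fix x :: "real^'a" assume x: "x \<in> annulus a b"
  have [measurable]: "\<beta> \<in> borel_measurable borel" using \<beta> by (simp add: angle_fun_def)
  have b: "\<bar>\<beta> y\<bar> \<le> 7" for y using \<beta> by (simp add: angle_fun_def)
  have snd: "snd \<in> borel_measurable (ball_unif \<Otimes>\<^sub>M restrict_space lborel {0..1::real})"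
    by (rule measurable_compose[OF measurable_snd]) (auto intro: measurable_restrict_space1)
  have "panalytic (0::real) x (\<lambda>_ x. \<integral>z. - \<beta> (fst z) * h (rot p q (\<beta> (fst z) * snd z) x)
      \<partial>(ball_unif \<Otimes>\<^sub>M restrict_space lborel {0..1}))"
  proof (rule panalytic_integral[where K="{-7..7}" and W=7])
    show "panalytic t x (\<lambda>t x. h (rot p q t x))" for t
      by (rule panalytic_rot) (use h x pq in \<open>auto simp: admissible_def\<close>)
    show "(\<lambda>z. \<beta> (fst z) * snd z) \<in> borel_measurable (ball_unif \<Otimes>\<^sub>M restrict_space lborel {0..1::real})"
      by (intro borel_measurable_times snd) measurable
    show "\<beta> (fst z) * snd z \<in> {-7..7}" if "z \<in> space (ball_unif \<Otimes>\<^sub>M restrict_space lborel {0..1::real})" for z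
    proof -
      have "\<bar>\<beta> (fst z)\<bar> * \<bar>snd z\<bar> \<le> 7 * 1"
        using that b by (intro mult_mono) (auto simp: space_pair_measure space_restrict_space)
      then show ?thesis unfolding abs_mult[symmetric] by (auto simp: abs_le_iff)
    qed
  qed (auto simp: b finite_measure_pair_interval)
  then show "panalytic (0::real) x (\<lambda>_. rot_potential p q \<beta> h)"
    by (simp add: rot_potential_def[abs_def])
qed

text \<open>With \<open>K\<close> an antiderivative of \<open>h\<close> along the orbit of
  \<open>x\<close>, the potential at \<open>rot p q \<epsilon> x\<close> is the average of
  \<open>K \<epsilon> - K (\<beta> y + \<epsilon>)\<close>. Its derivative at 0 is
  \<open>k 0\<close> minus the average of \<open>k (\<beta> y)\<close>.\<close>

lemma rot_potential_derivative:
  assumes h: "admissible a b h" and \<beta>: "angle_fun \<beta>" and pq: "p \<noteq> q" and x: "x \<in> annulus a b"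
  shows "frechet_derivative (rot_potential p q \<beta> h) (at x) (rot_gen p q x) = h x - rot_avg p q \<beta> h x"
proof -
  let ?P = "rot_potential p q \<beta> h"
  have [measurable]: "\<beta> \<in> borel_measurable borel" using \<beta> by (simp add: angle_fun_def)
  have b: "\<bar>\<beta> y\<bar> \<le> 7" for y using \<beta> by (simp add: angle_fun_def)
  \<comment> \<open>The orbit stays on one sphere, so this bound controls \<open>k\<close> and is a
    Lipschitz constant for \<open>K\<close>.\<close>
  obtain B where B: "0 \<le> B" "\<And>z. norm z = norm x \<Longrightarrow> \<bar>h z\<bar> \<le> B"
    using admissible_bounded_sphere[OF h] by blast
  define k where "k s = h (rot p q s x)" for s
  have kB: "\<bar>k s\<bar> \<le> B" for s unfolding k_def by (rule B) (simp add: norm_rot pq)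
  have contk: "continuous_on UNIV k"
  proof -
    have "continuous_on UNIV (h \<circ> (\<lambda>s. rot p q s x))"
    proof (rule continuous_on_compose)
      show "continuous_on UNIV (\<lambda>s. rot p q s x)" by (rule continuous_rot_angle)
      have "range (\<lambda>s. rot p q s x) \<subseteq> annulus a b" using x pq by (auto simp: annulus_def norm_rot)
      then show "continuous_on (range (\<lambda>s. rot p q s x)) h"
        using h real_analytic_on_continuous_on continuous_on_subset unfolding admissible_def by blast
    qed
    then show ?thesis by (simp add: k_def[abs_def] o_def)
  qed
  then have km[measurable]: "k \<in> borel_measurable borel" by (rule borel_measurable_continuous_onI)
  have isk: "isCont k s" for s using contk by (simp add: continuous_on_eq_continuous_at)
  obtain K where K: "\<And>s. (K has_vector_derivative k s) (at s)"
    using einterval_antiderivative[of "-\<infinity>" \<infinity> k] isk by auto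
  then have DK: "(K has_real_derivative k s) (at s)" for s
    by (simp add: has_real_derivative_iff_has_vector_derivative)
  then have "continuous_on UNIV K"
    by (meson DERIV_isCont continuous_at_imp_continuous_on)
  then have Km[measurable]: "K \<in> borel_measurable borel" by (rule borel_measurable_continuous_onI)
  have KL: "\<bar>K u - K v\<bar> \<le> B * \<bar>u - v\<bar>" for u v
    using field_differentiable_bound[of UNIV K k B u v] DK kB by auto
  let ?U = "restrict_space lborel {0..1::real}"
  interpret U: finite_measure ?U by (rule finite_measure_interval)
  interpret P: pair_sigma_finite "ball_unif :: (real^'a) measure" ?U ..
  interpret PP: finite_measure "ball_unif \<Otimes>\<^sub>M ?U :: ((real^'a) \<times> real) measure" by (rule finite_measure_pair_interval)
  have snd: "snd \<in> borel_measurable (ball_unif \<Otimes>\<^sub>M ?U)"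
    by (rule measurable_compose[OF measurable_snd]) (auto intro: measurable_restrict_space1)
  have pot: "?P (rot p q \<epsilon> x) = (\<integral>y. K \<epsilon> - K (\<beta> y + \<epsilon>) \<partial>ball_unif)" for \<epsilon>
  proof -
    have int: "integrable (ball_unif \<Otimes>\<^sub>M ?U) (case_prod (\<lambda>y s. - \<beta> y * k (\<beta> y * s + \<epsilon>)))"
    proof (rule PP.integrable_const_bound[where B="7 * B"])
      have "(\<lambda>z. - \<beta> (fst z) * k (\<beta> (fst z) * snd z + \<epsilon>)) \<in> borel_measurable (ball_unif \<Otimes>\<^sub>M ?U)"
        using snd by measurable
      then show "case_prod (\<lambda>y s. - \<beta> y * k (\<beta> y * s + \<epsilon>)) \<in> borel_measurable (ball_unif \<Otimes>\<^sub>M ?U)"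
        by (simp add: case_prod_beta')
      show "AE z in ball_unif \<Otimes>\<^sub>M ?U. norm (case z of (y, s) \<Rightarrow> - \<beta> y * k (\<beta> y * s + \<epsilon>)) \<le> 7 * B"
        using b kB by (auto simp: abs_mult intro!: AE_I2 mult_mono)
    qed
    have "?P (rot p q \<epsilon> x) =
        (\<integral>z. (case z of (y, s) \<Rightarrow> - \<beta> y * k (\<beta> y * s + \<epsilon>)) \<partial>(ball_unif \<Otimes>\<^sub>M ?U))"
      by (simp add: rot_potential_def k_def rot_add[OF pq] case_prod_beta')
    also have "\<dots> = (\<integral>y. (\<integral>s. - \<beta> y * k (\<beta> y * s + \<epsilon>) \<partial>?U) \<partial>ball_unif)"
      using P.integral_fst[OF int] by simp
    also have "\<dots> = (\<integral>y. K \<epsilon> - K (\<beta> y + \<epsilon>) \<partial>ball_unif)"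
    proof (rule Bochner_Integration.integral_cong[OF refl])
      fix y
      have "(\<integral>s. - \<beta> y * k (\<beta> y * s + \<epsilon>) \<partial>?U) = (\<integral>s. (- \<beta> y * k (\<beta> y * s + \<epsilon>)) * indicator {0..1} s \<partial>lborel)"
        by (subst integral_restrict_space) (auto simp: mult.commute)
      also have "\<dots> = (- K (\<beta> y * 1 + \<epsilon>)) - (- K (\<beta> y * 0 + \<epsilon>))"
      proof (rule integral_FTC_Icc_real)
        show "((\<lambda>s. - K (\<beta> y * s + \<epsilon>)) has_real_derivative - \<beta> y * k (\<beta> y * s + \<epsilon>)) (at s)" for s
          by (auto intro!: derivative_eq_intros DERIV_chain2[OF DK])
        show "isCont (\<lambda>s. - \<beta> y * k (\<beta> y * s + \<epsilon>)) s" for s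
          by (intro continuous_intros isCont_o2[OF _ isk])
      qed simp
      finally show "(\<integral>s. - \<beta> y * k (\<beta> y * s + \<epsilon>) \<partial>?U) = K \<epsilon> - K (\<beta> y + \<epsilon>)" by simp
    qed
    finally show ?thesis .
  qed
  define D where "D = frechet_derivative (?P) (at x) (rot_gen p q x)"
  \<comment> \<open>Total differentiability, known from analyticity, turns the derivative in
    direction \<open>rot_gen p q x\<close> into one along the rotation curve.\<close>
  have dif: "(?P has_derivative frechet_derivative (?P) (at x)) (at x)"
    using real_analytic_on_differentiable[OF real_analytic_rot_potential[OF h \<beta> pq] x] frechet_derivative_works by blast
  have "((\<lambda>t. rot p q t x) has_derivative (\<lambda>t. t *\<^sub>R rot_gen p q x)) (at 0)"
    using has_vector_derivative_rot[OF pq] by (simp add: has_vector_derivative_def)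
  then have "((\<lambda>t. ?P (rot p q t x)) has_derivative
      (\<lambda>t. frechet_derivative (?P) (at x) (t *\<^sub>R rot_gen p q x))) (at 0)"
    by (rule has_derivative_compose) (use dif in \<open>simp add: rot_0\<close>)
  then have "((\<lambda>t. ?P (rot p q t x)) has_real_derivative D) (at 0)"
    unfolding has_field_derivative_def D_def
    using linear_scale[OF has_derivative_linear[OF dif]] by (simp add: mult.commute[of _ "frechet_derivative _ _ _"])
  then have lim: "((\<lambda>t. (?P (rot p q (0 + t) x) - ?P (rot p q 0 x)) / t) \<longlongrightarrow> D) (at 0)"
    by (simp add: DERIV_def)
  \<comment> \<open>The limit exists already, so one sequence suffices to evaluate it, and for
    sequences dominated convergence applies with the constant \<open>2 * B\<close>.\<close>
  define e where "e n = inverse (real (Suc n))" for n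
  have en: "e n > 0" for n by (simp add: e_def)
  have "e \<longlonglongrightarrow> 0" unfolding e_def by (rule LIMSEQ_inverse_real_of_nat)
  then have e: "filterlim e (at 0) sequentially"
    using en by (auto simp: filterlim_at intro!: always_eventually dest: less_imp_neq[THEN not_sym])
  have lim1: "(\<lambda>n. (?P (rot p q (e n) x) - ?P (rot p q 0 x)) / e n) \<longlonglongrightarrow> D"
    using filterlim_compose[OF lim e] by simp
  have quot: "(\<lambda>n. (K (u + e n) - K u) / e n) \<longlonglongrightarrow> k u" for u
  proof -
    have "((\<lambda>t. (K (u + t) - K u) / t) \<longlongrightarrow> k u) (at 0)" using DK[of u] by (simp add: DERIV_def)
    from filterlim_compose[OF this e] show ?thesis .
  qed
  have intK: "integrable ball_unif (\<lambda>y. K s - K (\<beta> y + s))" for s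
  proof (rule ball_unif.integrable_const_bound[where B="B * 7"])
    have "\<bar>K s - K (\<beta> y + s)\<bar> \<le> B * 7" for y
      using KL[of s "\<beta> y + s"] mult_left_mono[OF b[of y] B(1)] by (simp add: abs_minus_commute)
    then show "AE y in ball_unif. norm (K s - K (\<beta> y + s)) \<le> B * 7" by simp
  qed measurable
  have "(\<lambda>n. \<integral>y. (K (e n) - K 0) / e n - (K (\<beta> y + e n) - K (\<beta> y)) / e n \<partial>ball_unif)
      \<longlonglongrightarrow> (\<integral>y. k 0 - k (\<beta> y) \<partial>ball_unif)"
  proof (rule integral_dominated_convergence[where w="\<lambda>_. 2 * B"])
    show "AE y in ball_unif. (\<lambda>n. (K (e n) - K 0) / e n - (K (\<beta> y + e n) - K (\<beta> y)) / e n) \<longlonglongrightarrow> k 0 - k (\<beta> y)"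
      using quot[of 0] by (intro AE_I2 tendsto_diff quot) simp
    have q: "\<bar>(K (u + e n) - K u) / e n\<bar> \<le> B" for u n
      using KL[of "u + e n" u] en[of n] by (simp add: divide_le_eq)
    show "AE y in ball_unif. norm ((K (e n) - K 0) / e n - (K (\<beta> y + e n) - K (\<beta> y)) / e n) \<le> 2 * B" for n
    proof (rule AE_I2)
      fix y
      show "norm ((K (e n) - K 0) / e n - (K (\<beta> y + e n) - K (\<beta> y)) / e n) \<le> 2 * B"
        using q[of 0 n] q[of "\<beta> y" n] by (simp only: real_norm_def add_0)
    qed
  qed auto
  also have "(\<lambda>n. \<integral>y. (K (e n) - K 0) / e n - (K (\<beta> y + e n) - K (\<beta> y)) / e n \<partial>ball_unif) =
     (\<lambda>n. (?P (rot p q (e n) x) - ?P (rot p q 0 x)) / e n)"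
  proof
    fix n
    have "(?P (rot p q (e n) x) - ?P (rot p q 0 x)) / e n
      = (\<integral>y. ((K (e n) - K (\<beta> y + e n)) - (K 0 - K (\<beta> y + 0))) / e n \<partial>ball_unif)"
      unfolding pot using Bochner_Integration.integral_diff[OF intK intK, of "e n" 0] by simp
    then show "(\<integral>y. (K (e n) - K 0) / e n - (K (\<beta> y + e n) - K (\<beta> y)) / e n \<partial>ball_unif) =
       (?P (rot p q (e n) x) - ?P (rot p q 0 x)) / e n"
      by (simp add: diff_divide_distrib add_divide_distrib algebra_simps)
  qed
  finally have "D = (\<integral>y. k 0 - k (\<beta> y) \<partial>ball_unif)"
    using lim1 LIMSEQ_unique by blast
  also have "\<dots> = k 0 - (\<integral>y. k (\<beta> y) \<partial>ball_unif)"
  proof -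
    have "integrable ball_unif (\<lambda>y. k (\<beta> y))"
      by (rule ball_unif.integrable_const_bound[where B=B]) (use kB in auto)
    then show ?thesis by (subst Bochner_Integration.integral_diff) auto
  qed
  finally show ?thesis by (simp add: D_def k_def rot_0 rot_avg_def)
qed

section \<open>Averaging over spheres of coordinate subspaces\<close>

definition rot_step :: "'n set \<Rightarrow> (real^'n \<Rightarrow> real) \<Rightarrow> (real^'n \<Rightarrow> real) \<Rightarrow> bool" where
  "rot_step J g h \<longleftrightarrow> (\<exists>p q \<beta>. p \<in> J \<and> q \<in> J \<and> p \<noteq> q \<and> angle_fun \<beta> \<and> h = rot_avg p q \<beta> g)"

abbreviation rot_reach :: "'n set \<Rightarrow> (real^'n \<Rightarrow> real) \<Rightarrow> (real^'n \<Rightarrow> real) \<Rightarrow> bool" where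
  "rot_reach J \<equiv> (rot_step J)\<^sup>*\<^sup>*"

lemma rot_reach_mono: "rot_reach I g h \<Longrightarrow> I \<subseteq> J \<Longrightarrow> rot_reach J g h"
  by (erule rtranclp_mono[THEN predicate2D, rotated]) (unfold rot_step_def, blast)

lemma admissible_rot_reach: "rot_reach J g h \<Longrightarrow> admissible a b g \<Longrightarrow> admissible a b h"
  by (induction rule: rtranclp_induct) (auto simp: rot_step_def intro: admissible_rot_avg)

text \<open>Telescoping: each averaged rotation in the chain accounts for its own difference by one
  potential.\<close>

lemma rot_reach_potential:
  assumes "rot_reach J g h" "admissible a b g"
  shows "\<exists>H. (\<forall>p q. real_analytic_on (H p q) (annulus a b)) \<and>
     (\<forall>x\<in>annulus a b. g x - h x =
        (\<Sum>p\<in>UNIV. \<Sum>q\<in>UNIV. frechet_derivative (H p q) (at x) (rot_gen p q x)))"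
  using assms(1)
proof (induction rule: rtranclp_induct)
  case base
  have "real_analytic_on (\<lambda>x::real^'a. 0::real) (annulus a b)"
    by (rule panalytic_imp_real_analytic_on[OF open_annulus, where t="0::real"]) (rule panalytic_const)
  moreover have "frechet_derivative (\<lambda>x::real^'a. 0::real) (at x) = (\<lambda>_. 0)" for x
    by (rule frechet_derivative_at[symmetric]) (rule has_derivative_const)
  ultimately show ?case by (intro exI[of _ "\<lambda>_ _ _. 0"]) auto
next
  case (step h k)
  then obtain H where H: "\<And>p q. real_analytic_on (H p q) (annulus a b)"
     "\<And>x. x\<in>annulus a b \<Longrightarrow> g x - h x =
        (\<Sum>p\<in>UNIV. \<Sum>q\<in>UNIV. frechet_derivative (H p q) (at x) (rot_gen p q x))" by blast
  from step(2) obtain p q \<beta> where pq: "p \<noteq> q" and \<beta>: "angle_fun \<beta>" and k: "k = rot_avg p q \<beta> h"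
    unfolding rot_step_def by blast
  have h: "admissible a b h" using step(1) assms(2) by (rule admissible_rot_reach)
  let ?P = "rot_potential p q \<beta> h"
  \<comment> \<open>The new potential is added to its slot instead of replacing it, because the same
    plane may occur repeatedly.\<close>
  define H' where "H' i j x = (if i = p \<and> j = q then H i j x + ?P x else H i j x)" for i j x
  have "real_analytic_on (H' i j) (annulus a b)" for i j
  proof (cases "i = p \<and> j = q")
    case True
    have "real_analytic_on (\<lambda>x. H i j x + ?P x) (annulus a b)"
      by (rule panalytic_imp_real_analytic_on[OF open_annulus, where t="0::real"])
         (intro panalytic_add real_analytic_on_imp_panalytic[OF H(1)]
            real_analytic_on_imp_panalytic[OF real_analytic_rot_potential[OF h \<beta> pq]])
    then show ?thesis using True by (simp add: H'_def[abs_def])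
  next
    case False
    then have "H' i j = H i j" by (auto simp: H'_def fun_eq_iff)
    then show ?thesis using H(1) by simp
  qed
  moreover have "g x - k x = (\<Sum>i\<in>UNIV. \<Sum>j\<in>UNIV. frechet_derivative (H' i j) (at x) (rot_gen i j x))"
    if x: "x \<in> annulus a b" for x
  proof -
    have d: "frechet_derivative (H' i j) (at x) (rot_gen i j x) = frechet_derivative (H i j) (at x) (rot_gen i j x)
        + (if j = q then if i = p then frechet_derivative ?P (at x) (rot_gen p q x) else 0 else 0)" for i j
    proof (cases "i = p \<and> j = q")
      case True
      have 1: "(H i j has_derivative frechet_derivative (H i j) (at x)) (at x)"
        using real_analytic_on_differentiable[OF H(1) x] frechet_derivative_works by blast
      have 2: "(?P has_derivative frechet_derivative ?P (at x)) (at x)"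
        using real_analytic_on_differentiable[OF real_analytic_rot_potential[OF h \<beta> pq] x] frechet_derivative_works by blast
      have "frechet_derivative (\<lambda>x. H i j x + ?P x) (at x) = (\<lambda>v. frechet_derivative (H i j) (at x) v + frechet_derivative ?P (at x) v)"
        by (rule frechet_derivative_at[symmetric]) (rule has_derivative_add[OF 1 2])
      then show ?thesis using True by (simp add: H'_def[abs_def])
    next
      case False
      then have "H' i j = H i j" by (auto simp: H'_def fun_eq_iff)
      then show ?thesis using False by auto
    qed
    have "(\<Sum>i\<in>UNIV. \<Sum>j\<in>UNIV. frechet_derivative (H' i j) (at x) (rot_gen i j x)) =
       (g x - h x) + frechet_derivative ?P (at x) (rot_gen p q x)"
      unfolding d H(2)[OF x] by (simp add: sum.distrib)
    also have "frechet_derivative ?P (at x) (rot_gen p q x) = h x - k x"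
      unfolding k by (rule rot_potential_derivative[OF h \<beta> pq x])
    finally show ?thesis by simp
  qed
  ultimately show ?case by blast
qed

text \<open>Fubini exchanges points and angles, and for each fixed angle \<open>m\<close> is
  invariant; the shell inside the annulus supplies the bound for integrability. The general
  \<open>m\<close> covers both the shell measure and the law of a random point on a
  lower-dimensional sphere.\<close>

lemma integral_rot_avg_invariant:
  fixes m :: "(real^'n) measure"
  assumes h: "admissible a b h" and \<beta>: "angle_fun \<beta>" and pq: "p \<noteq> q"
    and m: "finite_measure m" "sets m = sets borel" "\<And>t. distr m borel (rot p q t) = m"
    and shell: "AE x in m. lo \<le> norm x \<and> norm x \<le> hi" "a < lo" "hi < b"
  shows "(\<integral>x. rot_avg p q \<beta> h x \<partial>m) = (\<integral>x. h x \<partial>m)"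
proof -
  interpret m: finite_measure m by fact
  interpret P: pair_sigma_finite m "ball_unif :: (real^'n) measure" ..
  interpret PF: finite_measure "m \<Otimes>\<^sub>M (ball_unif :: (real^'n) measure)"
    by (rule finite_measure_pair_measure) unfold_locales
  have [measurable_cong]: "sets m = sets borel" by fact
  have hm[measurable]: "h \<in> borel_measurable borel" using h by (rule admissible_measurable)
  have [measurable]: "\<beta> \<in> borel_measurable borel" using \<beta> by (simp add: angle_fun_def)
  obtain B where B: "\<And>x. lo \<le> norm x \<Longrightarrow> norm x \<le> hi \<Longrightarrow> \<bar>h x\<bar> \<le> B"
    using admissible_bounded_shell[OF h shell(2,3)] by blast
  have int: "integrable (m \<Otimes>\<^sub>M ball_unif) (case_prod (\<lambda>x y. h (rot p q (\<beta> y) x)))"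
  proof (rule PF.integrable_const_bound[where B=B])
    have "AE z in m \<Otimes>\<^sub>M (ball_unif :: (real^'n) measure). lo \<le> norm (fst z) \<and> norm (fst z) \<le> hi"
    proof (rule P.AE_pair_measure)
      show "{z \<in> space (m \<Otimes>\<^sub>M ball_unif). lo \<le> norm (fst z) \<and> norm (fst z) \<le> hi} \<in> sets (m \<Otimes>\<^sub>M ball_unif)"
        by measurable
      show "AE x in m. AE y in ball_unif. lo \<le> norm (fst (x, y)) \<and> norm (fst (x, y)) \<le> hi"
        using shell(1) by eventually_elim auto
    qed
    then show "AE z in m \<Otimes>\<^sub>M ball_unif. norm (case z of (x, y) \<Rightarrow> h (rot p q (\<beta> y) x)) \<le> B"
      by eventually_elim (auto simp: case_prod_beta norm_rot[OF pq] intro!: B)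
  qed measurable
  have "(\<integral>x. rot_avg p q \<beta> h x \<partial>m) = (\<integral>y. (\<integral>x. h (rot p q (\<beta> y) x) \<partial>m) \<partial>ball_unif)"
    unfolding rot_avg_def by (rule P.Fubini_integral[OF int, symmetric])
  also have "\<dots> = (\<integral>y. (\<integral>x. h x \<partial>m) \<partial>(ball_unif :: (real^'n) measure))"
  proof (rule Bochner_Integration.integral_cong[OF refl])
    fix y
    have "(\<integral>x. h x \<partial>m) = (\<integral>x. h x \<partial>(distr m borel (rot p q (\<beta> y))))" by (simp add: m(3))
    also have "\<dots> = (\<integral>x. h (rot p q (\<beta> y) x) \<partial>m)" by (rule integral_distr) measurable
    finally show "(\<integral>x. h (rot p q (\<beta> y) x) \<partial>m) = (\<integral>x. h x \<partial>m)" by simp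
  qed
  also have "\<dots> = (\<integral>x. h x \<partial>m)" by simp
  finally show ?thesis .
qed

lemma integral_rot_reach_invariant:
  fixes m :: "(real^'n) measure"
  assumes "rot_reach J g h" "admissible a b g"
    and m: "finite_measure m" "sets m = sets borel"
      "\<And>p q t. p \<in> J \<Longrightarrow> q \<in> J \<Longrightarrow> p \<noteq> q \<Longrightarrow> distr m borel (rot p q t) = m"
    and shell: "AE x in m. lo \<le> norm x \<and> norm x \<le> hi" "a < lo" "hi < b"
  shows "(\<integral>x. h x \<partial>m) = (\<integral>x. g x \<partial>m)"
  using assms(1)
proof (induction rule: rtranclp_induct)
  case (step h k)
  from step(2) obtain p q \<beta> where pq: "p \<in> J" "q \<in> J" "p \<noteq> q" "angle_fun \<beta>" and k: "k = rot_avg p q \<beta> h"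
    unfolding rot_step_def by blast
  have "(\<integral>x. k x \<partial>m) = (\<integral>x. h x \<partial>m)"
    unfolding k by (rule integral_rot_avg_invariant[OF admissible_rot_reach[OF step(1) assms(2)] pq(4,3) m(1,2) m(3)[OF pq(1-3)] shell])
  then show ?case using step.IH by simp
qed simp

text \<open>The point with the coordinates outside \<open>J\<close> of \<open>x\<close>, and with \<open>J\<close>-part of the length of that of
  \<open>x\<close> and the direction of that of \<open>y\<close>; junk if the \<open>J\<close>-part of \<open>y\<close> vanishes, a null event.\<close>

definition resample :: "'n set \<Rightarrow> real^'n \<Rightarrow> real^'n \<Rightarrow> real^'n" where
  "resample J x y = (\<chi> i. if i \<in> J then snorm J x * y$i / snorm J y else x$i)"

text \<open>Invariance under the orthogonal maps of the \<open>J\<close>-coordinates, expressed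
  through their orbits instead of the group.\<close>

definition inv_on :: "'n set \<Rightarrow> (real^'n \<Rightarrow> real) \<Rightarrow> bool" where
  "inv_on J h \<longleftrightarrow> (\<forall>x x'. (\<forall>i. i \<notin> J \<longrightarrow> x$i = x'$i) \<and> snorm J x = snorm J x' \<longrightarrow> h x = h x')"

lemma snorm_pos: "J \<noteq> {} \<Longrightarrow> (\<And>i. y $ i \<noteq> 0) \<Longrightarrow> 0 < snorm J y"
  unfolding snorm_def by (auto intro!: sum_pos)

lemma snorm_insert: "p \<notin> I \<Longrightarrow> (snorm (insert p I) x)\<^sup>2 = (x$p)\<^sup>2 + (snorm I x)\<^sup>2"
  by (simp add: snorm_sq)

lemma snorm_cong_superset:
  assumes "\<And>i. i \<notin> I \<Longrightarrow> x$i = x'$i" "snorm I x = snorm I x'" "I \<subseteq> J"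
  shows "snorm J x = snorm J x'"
proof -
  have "(\<Sum>i\<in>J. (z$i)\<^sup>2) = (snorm I z)\<^sup>2 + (\<Sum>i\<in>J - I. (z$i)\<^sup>2)" for z :: "real^'a"
    using assms(3) sum.subset_diff[of I J "\<lambda>i. (z$i)\<^sup>2"] by (simp add: snorm_sq)
  moreover have "(\<Sum>i\<in>J - I. (x$i)\<^sup>2) = (\<Sum>i\<in>J - I. (x'$i)\<^sup>2)"
    using assms(1) by (intro sum.cong) auto
  ultimately show ?thesis unfolding snorm_def[of J] using assms(2) by simp
qed

lemma norm_cong_superset:
  assumes "\<And>i. i \<notin> I \<Longrightarrow> x$i = x'$i" "snorm I x = snorm I x'"
  shows "norm x = norm x'"
  using snorm_cong_superset[OF assms subset_UNIV] by (simp add: snorm_UNIV)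

lemma snorm_resample: "snorm J y \<noteq> 0 \<Longrightarrow> snorm J (resample J x y) = snorm J x"
proof -
  assume y: "snorm J y \<noteq> 0"
  have "(snorm J (resample J x y))\<^sup>2 = (\<Sum>i\<in>J. (snorm J x / snorm J y)\<^sup>2 * (y$i)\<^sup>2)"
    unfolding snorm_sq by (intro sum.cong) (auto simp: resample_def power_mult_distrib power_divide)
  also have "\<dots> = (snorm J x / snorm J y)\<^sup>2 * (snorm J y)\<^sup>2" by (simp add: sum_distrib_left snorm_sq)
  also have "\<dots> = (snorm J x)\<^sup>2" using y by (simp add: power_divide)
  finally show ?thesis using snorm_nonneg power2_eq_iff_nonneg by blast
qed

lemma norm_resample: "snorm J y \<noteq> 0 \<Longrightarrow> norm (resample J x y) = norm x"
  by (rule norm_cong_superset[of J]) (auto simp: snorm_resample, simp add: resample_def)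

text \<open>Transfers the rotation invariance of \<open>ball_unif\<close> to the law of the point
  \<open>resample J x y\<close>.\<close>

lemma rot_resample:
  assumes "p \<in> J" "q \<in> J" "p \<noteq> q"
  shows "resample J x (rot p q t y) = rot p q t (resample J x y)"
proof -
  have "snorm J (rot p q t y) = snorm J y" using assms by (intro snorm_rot)
  then show ?thesis
    using assms by (auto simp: resample_def vec_eq_iff)
      (auto simp: rot_def diff_divide_distrib add_divide_distrib algebra_simps)
qed

lemma measurable_vec_nth_compose[measurable (raw)]:
  fixes f :: "'a \<Rightarrow> real^'n"
  assumes "f \<in> borel_measurable M" shows "(\<lambda>z. f z $ i) \<in> borel_measurable M"
  by (rule borel_measurable_continuous_on[OF _ assms]) (intro continuous_intros)

lemma measurable_snorm[measurable (raw)]: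
  assumes [measurable]: "f \<in> borel_measurable M"
  shows "(\<lambda>z. snorm J (f z)) \<in> borel_measurable M"
  unfolding snorm_def by measurable

lemma measurable_resample2[measurable (raw)]:
  assumes [measurable]: "f \<in> borel_measurable M" "g \<in> borel_measurable M"
  shows "(\<lambda>z. resample J (f z) (g z)) \<in> borel_measurable M"
proof -
  have "resample J (f z) (g z) =
     (\<Sum>i\<in>UNIV. (if i \<in> J then snorm J (f z) * g z $ i / snorm J (g z) else f z $ i) *\<^sub>R axis i 1)" for z
    using basis_expansion[of "resample J (f z) (g z)"]
    by (simp add: resample_def scalar_mult_eq_scaleR)
  moreover have "(\<lambda>z. if i \<in> J then snorm J (f z) * g z $ i / snorm J (g z) else f z $ i) \<in> borel_measurable M" for i
    by (cases "i \<in> J"; simp; measurable)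
  ultimately show ?thesis by simp
qed

lemma AE_snorm_pos:
  fixes J :: "'n::finite set"
  assumes "J \<noteq> {}" shows "AE y in (ball_unif :: (real^'n) measure). 0 < snorm J y"
  using AE_ball_unif_nonzero by eventually_elim (use assms in \<open>auto intro: snorm_pos\<close>)

lemma integral_resample_rot:
  fixes h :: "real^'n \<Rightarrow> real"
  assumes pq: "p \<in> J" "q \<in> J" "p \<noteq> q" and [measurable]: "h \<in> borel_measurable borel"
  shows "(\<integral>y. h (rot p q t (resample J x y)) \<partial>ball_unif) = (\<integral>y. h (resample J x y) \<partial>ball_unif)"
proof -
  have "(\<integral>y. h (resample J x y) \<partial>ball_unif) = (\<integral>y. h (resample J x y) \<partial>(distr ball_unif borel (rot p q t)))"
    by (simp add: distr_ball_unif_orthogonal orthogonal_rot pq)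
  also have "\<dots> = (\<integral>y. h (resample J x (rot p q t y)) \<partial>ball_unif)" by (rule integral_distr) measurable
  finally show ?thesis by (simp add: rot_resample[OF pq])
qed

text \<open>The law of \<open>resample J x\<close> is invariant under rotations in \<open>J\<close>
  and lives on the sphere of radius \<open>norm x\<close>, so the chain preserves integrals against
  it. Together with \<open>integral_resample_inv_on\<close> this shows that a chain ending in an
  invariant function has computed a mean over spheres.\<close>

lemma integral_resample_reach:
  fixes g :: "real^'n \<Rightarrow> real"
  assumes gh: "rot_reach J g h" "admissible a b g" and J: "J \<noteq> {}" and x: "x \<in> annulus a b"
  shows "(\<integral>y. h (resample J x y) \<partial>ball_unif) = (\<integral>y. g (resample J x y) \<partial>ball_unif)"
proof -
  have [measurable]: "g \<in> borel_measurable borel" "h \<in> borel_measurable borel"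
    using admissible_measurable[OF gh(2)] admissible_measurable[OF admissible_rot_reach[OF gh]] .
  have [measurable]: "resample J x \<in> borel_measurable borel" by measurable
  let ?m = "distr ball_unif borel (resample J x)"
  have "(\<integral>z. h z \<partial>?m) = (\<integral>z. g z \<partial>?m)"
  proof (rule integral_rot_reach_invariant[OF gh, where lo="norm x" and hi="norm x"])
    show "finite_measure ?m" by (rule ball_unif.finite_measure_distr) measurable
    show "distr ?m borel (rot p q t) = ?m" if "p \<in> J" "q \<in> J" "p \<noteq> q" for p q t
    proof -
      have [measurable]: "rot p q t \<in> borel_measurable borel" by measurable
      have "distr ?m borel (rot p q t) = distr ball_unif borel (rot p q t \<circ> resample J x)"
        by (rule distr_distr) measurable
      also have "rot p q t \<circ> resample J x = resample J x \<circ> rot p q t"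
        by (simp add: fun_eq_iff rot_resample[OF that])
      also have "distr ball_unif borel (resample J x \<circ> rot p q t) = distr (distr ball_unif borel (rot p q t)) borel (resample J x)"
        by (rule distr_distr[symmetric]) measurable
      also have "\<dots> = ?m" by (simp add: distr_ball_unif_orthogonal orthogonal_rot that)
      finally show ?thesis .
    qed
    show "AE z in ?m. norm x \<le> norm z \<and> norm z \<le> norm x"
    proof (subst AE_distr_iff)
      show "AE y in ball_unif. norm x \<le> norm (resample J x y) \<and> norm (resample J x y) \<le> norm x"
        using AE_snorm_pos[OF J] by eventually_elim (simp add: norm_resample)
    qed measurable
  qed (use x in \<open>auto simp: annulus_def\<close>)
  then show ?thesis by (simp add: integral_distr)
qed

lemma integral_resample_inv_on:
  fixes h :: "real^'n \<Rightarrow> real"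
  assumes "inv_on J h" "J \<noteq> {}" "h \<in> borel_measurable borel"
  shows "(\<integral>y. h (resample J x y) \<partial>ball_unif) = h x"
proof -
  have "(\<integral>y. h (resample J x y) \<partial>ball_unif) = (\<integral>y. h x \<partial>(ball_unif :: (real^'n) measure))"
  proof (rule integral_cong_AE)
    show "AE y in ball_unif. h (resample J x y) = h x"
      using AE_snorm_pos[OF assms(2)]
    proof eventually_elim
      case (elim y)
      show ?case by (rule assms(1)[unfolded inv_on_def, rule_format])
        (use elim in \<open>auto simp: snorm_resample\<close>, simp add: resample_def)
    qed
  qed (use assms(3) in measurable)
  then show ?thesis by simp
qed

lemma resample_cong:
  assumes "\<And>i. i \<notin> J \<Longrightarrow> x$i = x'$i" "snorm J x = snorm J x'"
  shows "resample J x y = resample J x' y"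
  using assms by (simp add: resample_def vec_eq_iff)

section \<open>Random angles and the averaging recursion\<close>

lemma polar_angle:
  fixes u v :: real
  assumes "u\<^sup>2 + v\<^sup>2 = r\<^sup>2"
  obtains \<theta> where "u = r * cos \<theta>" "v = r * sin \<theta>" "\<bar>\<theta>\<bar> \<le> 7"
proof (cases "r = 0")
  case True
  then show ?thesis using assms that[of 0] by simp
next
  case False
  have "(u / r)\<^sup>2 + (v / r)\<^sup>2 = 1"
    using assms False by (simp add: power_divide add_divide_distrib[symmetric])
  then obtain t where t: "0 \<le> t" "t < 2 * pi" "u / r = cos t" "v / r = sin t"
    by (rule sincos_total_2pi)
  show ?thesis using t False pi_less_4 pi_approx by (intro that[of t]) (auto simp: field_simps)
qed

text \<open>\<open>pi / 2 - arctan (u / v)\<close> is the polar angle of \<open>(u, v)\<close> in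
  the upper half plane, in a form whose measurability is evident.\<close>

lemma arctan_angle:
  fixes u v :: real
  assumes "0 < v"
  shows "cos (pi / 2 - arctan (u / v)) = u / sqrt (u\<^sup>2 + v\<^sup>2)"
    and "sin (pi / 2 - arctan (u / v)) = v / sqrt (u\<^sup>2 + v\<^sup>2)"
proof -
  have "sqrt (1 + (u / v)\<^sup>2) = sqrt ((u\<^sup>2 + v\<^sup>2) / v\<^sup>2)"
    using assms by (simp add: power_divide field_simps)
  also have "\<dots> = sqrt (u\<^sup>2 + v\<^sup>2) / v" using assms by (simp add: real_sqrt_divide)
  finally have s: "sqrt (1 + (u / v)\<^sup>2) = sqrt (u\<^sup>2 + v\<^sup>2) / v" .
  show "cos (pi / 2 - arctan (u / v)) = u / sqrt (u\<^sup>2 + v\<^sup>2)"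
    using assms by (simp add: cos_diff sin_arctan s)
  show "sin (pi / 2 - arctan (u / v)) = v / sqrt (u\<^sup>2 + v\<^sup>2)"
    using assms by (simp add: sin_diff cos_arctan s)
qed

text \<open>Rotating \<open>x\<close> by the polar angle of a random \<open>(y$p, y$q)\<close> gives
  the sampled point rotated by the fixed polar angle \<theta> of \<open>x\<close>, as plane
  rotations commute. The fixed rotation disappears in the average.\<close>

lemma rot_average_pair:
  fixes h :: "real^'n \<Rightarrow> real"
  assumes pq: "p \<noteq> q" and h: "admissible a b h"
  shows "\<exists>g. rot_reach {p, q} h g \<and> inv_on {p, q} g"
proof -
  let ?J = "{p, q}"
  have [measurable]: "h \<in> borel_measurable borel" using h by (rule admissible_measurable)
  \<comment> \<open>For \<open>y$q < 0\<close> the arctangent formula yields the angle of the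
    opposite vector, which the added \<open>pi\<close> corrects.\<close>
  define \<beta> where "\<beta> y = pi / 2 - arctan (y$p / y$q) + (if y$q < 0 then pi else 0)" for y :: "real^'n"
  have [measurable]: "\<beta> \<in> borel_measurable borel" unfolding \<beta>_def[abs_def] by measurable
  have "\<bar>\<beta> y\<bar> \<le> 7" for y
    using arctan_bounded[of "y$p / y$q"] pi_less_4 pi_approx by (auto simp: \<beta>_def abs_le_iff)
  then have \<beta>: "angle_fun \<beta>" by (simp add: angle_fun_def)
  have sq: "snorm ?J z = sqrt ((z$p)\<^sup>2 + (z$q)\<^sup>2)" for z :: "real^'n"
    using pq by (simp add: snorm_def)
  have cs: "cos (\<beta> y) = y$p / snorm ?J y \<and> sin (\<beta> y) = y$q / snorm ?J y" if "y$q \<noteq> 0" for y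
  proof (cases "y$q < 0")
    case True
    have "cos (\<beta> y) = - cos (pi / 2 - arctan (y$p / y$q))" "sin (\<beta> y) = - sin (pi / 2 - arctan (y$p / y$q))"
      using True by (simp_all only: \<beta>_def if_True cos_periodic_pi sin_periodic_pi)
    then show ?thesis using arctan_angle[of "- y$q" "- y$p"] True by (simp add: sq)
  next
    case False
    with that have "0 < y$q" by simp
    then show ?thesis using arctan_angle[of "y$q" "y$p"] by (simp add: \<beta>_def sq)
  qed
  have avg: "rot_avg p q \<beta> h x = (\<integral>y. h (resample ?J x y) \<partial>ball_unif)" for x
  proof -
    have "(x$p)\<^sup>2 + (x$q)\<^sup>2 = (snorm ?J x)\<^sup>2" by (simp add: sq)
    then obtain \<theta> where \<theta>: "x$p = snorm ?J x * cos \<theta>" "x$q = snorm ?J x * sin \<theta>" "\<bar>\<theta>\<bar> \<le> 7"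
      by (rule polar_angle)
    have "rot_avg p q \<beta> h x = (\<integral>y. h (rot p q \<theta> (resample ?J x y)) \<partial>ball_unif)"
      unfolding rot_avg_def
    proof (rule integral_cong_AE)
      show "AE y in ball_unif. h (rot p q (\<beta> y) x) = h (rot p q \<theta> (resample ?J x y))"
        using AE_ball_unif_nonzero
      proof eventually_elim
        case (elim y)
        then have cy: "cos (\<beta> y) = y$p / snorm ?J y" "sin (\<beta> y) = y$q / snorm ?J y" using cs by auto
        have "rot p q (\<beta> y) x = rot p q \<theta> (resample ?J x y)"
          unfolding rot_def vec_eq_iff using pq
          by (auto simp: resample_def cy \<theta> algebra_simps)
        then show ?case by simp
      qed
    qed measurable
    also have "\<dots> = (\<integral>y. h (resample ?J x y) \<partial>ball_unif)"
      by (rule integral_resample_rot) (use pq in auto)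
    finally show ?thesis .
  qed
  have "inv_on ?J (rot_avg p q \<beta> h)"
    unfolding inv_on_def
  proof (intro allI impI)
    fix x x' :: "real^'n"
    assume "(\<forall>i. i \<notin> ?J \<longrightarrow> x$i = x'$i) \<and> snorm ?J x = snorm ?J x'"
    then have "resample ?J x y = resample ?J x' y" for y by (intro resample_cong) auto
    then show "rot_avg p q \<beta> h x = rot_avg p q \<beta> h x'" by (simp add: avg)
  qed
  moreover have "rot_reach ?J h (rot_avg p q \<beta> h)"
    using pq \<beta> by (intro r_into_rtranclp) (auto simp: rot_step_def)
  ultimately show ?thesis by blast
qed

text \<open>A function which is invariant under the rotations of \<open>I\<close> is averaged over the sphere of
  \<open>insert p I\<close> by one averaged rotation towards the new axis, followed by averaging over \<open>I\<close> again:
  the angle is distributed like the angle between a random point of the sphere and the new axis.\<close>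

lemma rot_average_insert:
  fixes h :: "real^'n \<Rightarrow> real"
  assumes IH: "\<And>h. admissible a b h \<Longrightarrow> \<exists>g. rot_reach I h g \<and> inv_on I g"
    and p: "p \<notin> I" and I: "I \<noteq> {}" and h: "admissible a b h"
  shows "\<exists>g. rot_reach (insert p I) h g \<and> inv_on (insert p I) g"
proof -
  let ?J = "insert p I"
  obtain q where q: "q \<in> I" using I by blast
  with p have pq: "p \<noteq> q" by blast
  obtain g where g: "rot_reach I h g" "inv_on I g" using IH[OF h] by blast
  have ga: "admissible a b g" using admissible_rot_reach[OF g(1) h] .
  have [measurable]: "g \<in> borel_measurable borel" using ga by (rule admissible_measurable)
  \<comment> \<open>The polar angle of \<open>(y$p, snorm I y)\<close>, that is, the angle between
    the \<open>?J\<close>-part of \<open>y\<close> and the axis \<open>p\<close>.\<close>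
  define \<beta> where "\<beta> y = pi / 2 - arctan (y$p / snorm I y)" for y :: "real^'n"
  have [measurable]: "\<beta> \<in> borel_measurable borel" unfolding \<beta>_def[abs_def] by measurable
  have "\<bar>\<beta> y\<bar> \<le> 7" for y
    using arctan_bounded[of "y$p / snorm I y"] pi_less_4 by (auto simp: \<beta>_def abs_le_iff)
  then have \<beta>: "angle_fun \<beta>" by (simp add: angle_fun_def)
  have sJ: "snorm ?J z = sqrt ((z$p)\<^sup>2 + (snorm I z)\<^sup>2)" for z :: "real^'n"
    using snorm_insert[OF p, of z] snorm_nonneg[of ?J z] by (metis real_sqrt_abs abs_of_nonneg)
  have cs: "cos (\<beta> y) = y$p / snorm ?J y" "sin (\<beta> y) = snorm I y / snorm ?J y" if "0 < snorm I y" for y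
    using arctan_angle[OF that, of "y$p"] by (simp_all add: \<beta>_def sJ)
  define k where "k = rot_avg p q \<beta> g"
  have ka: "admissible a b k" unfolding k_def by (rule admissible_rot_avg[OF ga \<beta> pq])
  \<comment> \<open>The rotation towards the new axis may destroy invariance in \<open>I\<close>; a
    second average over \<open>I\<close> restores it.\<close>
  obtain N where N: "rot_reach I k N" "inv_on I N" using IH[OF ka] by blast
  have Na: "admissible a b N" using admissible_rot_reach[OF N(1) ka] .
  have [measurable]: "k \<in> borel_measurable borel" "N \<in> borel_measurable borel"
    using ka Na by (auto intro: admissible_measurable)
  have "rot_step ?J g k"
    unfolding rot_step_def k_def using pq q \<beta> by blast
  with rot_reach_mono[OF g(1), of ?J] rot_reach_mono[OF N(1), of ?J]
  have reach: "rot_reach ?J h N"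
    by (meson rtranclp.rtrancl_into_rtrancl rtranclp_trans subset_insertI)
  have key: "N x = (\<integral>y. g (resample ?J x y) \<partial>ball_unif)" if x: "x \<in> annulus a b" for x
  proof -
    let ?r = "snorm ?J x"
    have "(x$p)\<^sup>2 + (snorm I x)\<^sup>2 = ?r\<^sup>2" by (simp add: snorm_insert[OF p])
    then obtain \<theta> where \<theta>: "x$p = ?r * cos \<theta>" "snorm I x = ?r * sin \<theta>" "\<bar>\<theta>\<bar> \<le> 7"
      by (rule polar_angle)
    \<comment> \<open>The rotation by the fixed angle \<theta> is written as an average over a
      constant angle, so that it is admissible and the induction hypothesis applies to it.\<close>
    define \<psi> where "\<psi> = rot_avg p q (\<lambda>_. \<theta>) g"
    have \<psi>: "\<psi> z = g (rot p q \<theta> z)" for z by (simp add: \<psi>_def rot_avg_def)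
    have \<psi>a: "admissible a b \<psi>"
      unfolding \<psi>_def by (rule admissible_rot_avg[OF ga _ pq]) (simp add: angle_fun_def \<theta>(3))
    obtain \<psi>' where \<psi>': "rot_reach I \<psi> \<psi>'" "inv_on I \<psi>'" using IH[OF \<psi>a] by blast
    have [measurable]: "\<psi> \<in> borel_measurable borel" "\<psi>' \<in> borel_measurable borel"
      using \<psi>a admissible_rot_reach[OF \<psi>'(1) \<psi>a] by (auto intro: admissible_measurable)
    \<comment> \<open>The angles \<open>\<beta> y\<close> and \<theta> exchange roles: the
      \<open>p\<close>-coordinates of the two points are given by one expression symmetric in them.
      Equal \<open>?J\<close>-lengths then force equal \<open>I\<close>-lengths, and
      \<open>g\<close> sees nothing else that differs.\<close>
    have same: "g (rot p q (\<beta> y) (resample I x u)) = g (rot p q \<theta> (resample I (resample ?J x y) u))"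
      if y: "0 < snorm I y" and u: "0 < snorm I u" for y u
    proof (rule g(2)[unfolded inv_on_def, rule_format])
      have yJ: "0 < snorm ?J y" using y by (simp add: sJ add_nonneg_pos)
      let ?z = "resample ?J x y"
      have zp: "?z $ p = ?r * cos (\<beta> y)" using y by (simp add: resample_def cs)
      have zI: "snorm I ?z = ?r * sin (\<beta> y)"
      proof -
        have "(snorm I ?z)\<^sup>2 = (\<Sum>i\<in>I. (?r / snorm ?J y)\<^sup>2 * (y$i)\<^sup>2)"
          unfolding snorm_sq[of I] by (intro sum.cong) (auto simp: resample_def power_mult_distrib power_divide)
        also have "\<dots> = (?r / snorm ?J y)\<^sup>2 * (snorm I y)\<^sup>2"
          unfolding snorm_sq[of I] by (rule sum_distrib_left[symmetric])
        also have "\<dots> = (?r * sin (\<beta> y))\<^sup>2"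
          using y by (simp add: cs power_mult_distrib power_divide)
        finally show ?thesis
          by (rule power2_eq_imp_eq) (use y in \<open>simp_all add: cs snorm_nonneg\<close>)
      qed
      let ?A = "rot p q (\<beta> y) (resample I x u)" and ?B = "rot p q \<theta> (resample I ?z u)"
      have co: "?A $ i = ?B $ i" if "i \<notin> I" for i
      proof (cases "i = p")
        case True
        have "?A $ p = cos (\<beta> y) * (?r * cos \<theta>) - sin (\<beta> y) * (?r * sin \<theta> * u$q / snorm I u)"
          using p q by (simp add: rot_def resample_def[of I] \<theta>)
        moreover have "?B $ p = cos \<theta> * (?r * cos (\<beta> y)) - sin \<theta> * (?r * sin (\<beta> y) * u$q / snorm I u)"
          using p q by (simp add: rot_def resample_def[of I] zp zI)
        ultimately show ?thesis using True by simp
      next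
        case False
        with that q show ?thesis by (auto simp: rot_def resample_def)
      qed
      moreover have "snorm I ?A = snorm I ?B"
      proof -
        have nJ: "snorm ?J ?A = snorm ?J ?B"
        proof -
          have "snorm ?J ?A = snorm ?J (resample I x u)" using pq q by (intro snorm_rot) auto
          also have "\<dots> = snorm ?J x"
            by (rule snorm_cong_superset[of I]) (use u in \<open>auto simp: snorm_resample\<close>, simp add: resample_def)
          also have "\<dots> = snorm ?J ?z" using yJ by (simp add: snorm_resample)
          also have "\<dots> = snorm ?J (resample I ?z u)"
            by (rule snorm_cong_superset[of I]) (use u in \<open>auto simp: snorm_resample\<close>, simp add: resample_def)
          also have "\<dots> = snorm ?J ?B" using pq q by (intro snorm_rot[symmetric]) auto
          finally show ?thesis .
        qed
        have "(snorm I ?A)\<^sup>2 = (snorm ?J ?A)\<^sup>2 - (?A$p)\<^sup>2" by (simp add: snorm_insert[OF p])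
        also have "\<dots> = (snorm ?J ?B)\<^sup>2 - (?B$p)\<^sup>2" using nJ co[OF p] by simp
        also have "\<dots> = (snorm I ?B)\<^sup>2" by (simp add: snorm_insert[OF p])
        finally show ?thesis using snorm_nonneg power2_eq_iff_nonneg by blast
      qed
      ultimately show "(\<forall>i. i \<notin> I \<longrightarrow> ?A$i = ?B$i) \<and> snorm I ?A = snorm I ?B" by blast
    qed
    interpret BB: pair_sigma_finite "ball_unif :: (real^'n) measure" "ball_unif :: (real^'n) measure" ..
    interpret BF: finite_measure "(ball_unif :: (real^'n) measure) \<Otimes>\<^sub>M (ball_unif :: (real^'n) measure)"
      by (rule finite_measure_pair_measure) unfold_locales
    obtain B where B: "\<And>z. norm z = norm x \<Longrightarrow> \<bar>g z\<bar> \<le> B"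
      using admissible_bounded_sphere[OF ga] by blast
    have int: "integrable (ball_unif \<Otimes>\<^sub>M ball_unif) (case_prod (\<lambda>y u. g (rot p q (\<beta> y) (resample I x u))))"
    proof (rule BF.integrable_const_bound[where B=B])
      have "AE z in (ball_unif :: (real^'n) measure) \<Otimes>\<^sub>M (ball_unif :: (real^'n) measure). 0 < snorm I (snd z)"
        by (rule BB.AE_pair_measure) (measurable, use AE_snorm_pos[OF I] in simp)
      then show "AE z in ball_unif \<Otimes>\<^sub>M ball_unif. norm (case z of (y, u) \<Rightarrow> g (rot p q (\<beta> y) (resample I x u))) \<le> B"
        by eventually_elim (auto simp: case_prod_beta norm_rot[OF pq] norm_resample intro!: B)
    qed measurable
    have "N x = (\<integral>u. N (resample I x u) \<partial>ball_unif)"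
      by (rule integral_resample_inv_on[OF N(2) I, symmetric]) measurable
    also have "\<dots> = (\<integral>u. k (resample I x u) \<partial>ball_unif)"
      by (rule integral_resample_reach[OF N(1) ka I x])
    also have "\<dots> = (\<integral>y. (\<integral>u. g (rot p q (\<beta> y) (resample I x u)) \<partial>ball_unif) \<partial>ball_unif)"
      unfolding k_def rot_avg_def by (rule BB.Fubini_integral[OF int])
    \<comment> \<open>The random rotation of a point over \<open>x\<close> has become the fixed
      rotation by \<theta> at a random point of the \<open>?J\<close>-sphere, averaged over
      \<open>I\<close>.\<close>
    also have "\<dots> = (\<integral>y. \<psi>' (resample ?J x y) \<partial>ball_unif)"
    proof (rule integral_cong_AE)
      show "AE y in ball_unif. (\<integral>u. g (rot p q (\<beta> y) (resample I x u)) \<partial>ball_unif) = \<psi>' (resample ?J x y)"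
        using AE_snorm_pos[OF I]
      proof eventually_elim
        case (elim y)
        let ?z = "resample ?J x y"
        have "0 < snorm ?J y" using elim by (simp add: sJ add_nonneg_pos)
        then have z: "?z \<in> annulus a b" using x by (simp add: annulus_def norm_resample)
        have "(\<integral>u. g (rot p q (\<beta> y) (resample I x u)) \<partial>ball_unif) = (\<integral>u. \<psi> (resample I ?z u) \<partial>ball_unif)"
        proof (rule integral_cong_AE)
          show "AE u in ball_unif. g (rot p q (\<beta> y) (resample I x u)) = \<psi> (resample I ?z u)"
            using AE_snorm_pos[OF I] by eventually_elim (simp add: \<psi> same[OF elim])
        qed measurable
        also have "\<dots> = (\<integral>u. \<psi>' (resample I ?z u) \<partial>ball_unif)"
          by (rule integral_resample_reach[OF \<psi>'(1) \<psi>a I z, symmetric])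
        also have "\<dots> = \<psi>' ?z" by (rule integral_resample_inv_on[OF \<psi>'(2) I]) measurable
        finally show ?case .
      qed
    qed measurable
    \<comment> \<open>The mean over the \<open>?J\<close>-sphere notices neither the average over
      \<open>I\<close> nor, in the next line, the fixed rotation.\<close>
    also have "\<dots> = (\<integral>y. \<psi> (resample ?J x y) \<partial>ball_unif)"
      by (rule integral_resample_reach[OF rot_reach_mono[OF \<psi>'(1)] \<psi>a _ x]) auto
    also have "\<dots> = (\<integral>y. g (resample ?J x y) \<partial>ball_unif)"
      unfolding \<psi> by (rule integral_resample_rot) (use pq q in auto)
    finally show ?thesis .
  qed
  have "inv_on ?J N"
    unfolding inv_on_def
  proof (intro allI impI)
    fix x x' :: "real^'n"
    assume xx: "(\<forall>i. i \<notin> ?J \<longrightarrow> x$i = x'$i) \<and> snorm ?J x = snorm ?J x'"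
    then have n: "norm x = norm x'" by (intro norm_cong_superset[of ?J]) auto
    have "resample ?J x y = resample ?J x' y" for y using xx by (intro resample_cong) auto
    then show "N x = N x'" using Na key[of x] key[of x'] n
      by (cases "x \<in> annulus a b") (auto simp: admissible_def annulus_def)
  qed
  with reach show ?thesis by blast
qed

lemma rot_average_exists:
  fixes J :: "'n::finite set"
  assumes "2 \<le> card J" "admissible a b h"
  shows "\<exists>g. rot_reach J h g \<and> inv_on J g"
proof -
  have "finite J" by simp
  then have "2 \<le> card J \<Longrightarrow> (\<forall>h. admissible a b h \<longrightarrow> (\<exists>g. rot_reach J h g \<and> inv_on J g))"
  proof (induction J rule: finite_induct)
    case (insert p I)
    show ?case
    proof (cases "2 \<le> card I")
      case True
      then show ?thesis using insert rot_average_insert[of a b I p] by fastforce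
    next
      case False
      \<comment> \<open>A single axis admits no rotation, so the recursion really starts with a
        plane.\<close>
      then have "card I = 1" using insert by auto
      then obtain q where "I = {q}" by (rule card_1_singletonE)
      then show ?thesis using insert rot_average_pair[of p q a b] by auto
    qed
  qed simp
  then show ?thesis using assms by blast
qed

section \<open>The spherical mean of the radial moment\<close>

definition shell_measure :: "real \<Rightarrow> real \<Rightarrow> (real^'n) measure" where
  "shell_measure R1 R2 = density lborel (indicator (annulus R1 R2))"

lemma borel_annulus[measurable]: "annulus a b \<in> sets borel"
  by (rule borel_open[OF open_annulus])

lemma sets_shell_measure[simp, measurable_cong]: "sets (shell_measure R1 R2) = sets borel"
  and space_shell_measure[simp]: "space (shell_measure R1 R2) = UNIV"
  by (simp_all add: shell_measure_def)

lemma emeasure_shell_measure: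
  "A \<in> sets borel \<Longrightarrow> emeasure (shell_measure R1 R2) A = emeasure lborel (annulus R1 R2 \<inter> A)"
  unfolding shell_measure_def by (rule emeasure_restricted) auto

lemma finite_shell_measure: "finite_measure (shell_measure R1 R2 :: (real^'n) measure)"
proof
  have "bounded (annulus R1 R2 :: (real^'n) set)"
    by (rule boundedI[of _ R2]) (auto simp: annulus_def)
  from emeasure_bounded_finite[OF this]
  show "emeasure (shell_measure R1 R2 :: (real^'n) measure) (space (shell_measure R1 R2)) \<noteq> \<infinity>"
    by (simp add: emeasure_shell_measure)
qed

lemma distr_shell_measure_rot:
  assumes "p \<noteq> q"
  shows "distr (shell_measure R1 R2) borel (rot p q t) = shell_measure R1 R2"
proof (rule measure_eqI)
  have [measurable]: "rot p q t \<in> borel_measurable borel" by measurable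
  fix A assume "A \<in> sets (distr (shell_measure R1 R2) borel (rot p q t))"
  then have [measurable]: "A \<in> sets borel" by simp
  have [measurable]: "rot p q t -` A \<in> sets borel"
    using measurable_sets[of "rot p q t" borel borel A] by simp
  have "annulus R1 R2 \<inter> rot p q t -` A = rot p q t -` (annulus R1 R2 \<inter> A)"
    using norm_rot[OF assms] by (auto simp: annulus_def)
  moreover have "emeasure lborel (rot p q t -` (annulus R1 R2 \<inter> A)) = emeasure (distr lborel borel (rot p q t)) (annulus R1 R2 \<inter> A)"
    by (subst emeasure_distr) auto
  ultimately have "emeasure lborel (annulus R1 R2 \<inter> rot p q t -` A) = emeasure lborel (annulus R1 R2 \<inter> A)"
    by (simp add: lborel_distr_orthogonal[OF orthogonal_rot[OF assms]])
  then show "emeasure (distr (shell_measure R1 R2) borel (rot p q t)) A = emeasure (shell_measure R1 R2) A"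
    by (subst emeasure_distr) (auto simp: emeasure_shell_measure)
qed simp

lemma AE_shell_measure: "AE x in shell_measure R1 R2. R1 \<le> norm x \<and> norm x \<le> R2"
  unfolding shell_measure_def by (subst AE_density) (auto simp: annulus_def indicator_def)

lemma integral_shell_measure:
  fixes f :: "real^'n \<Rightarrow> real"
  assumes "f \<in> borel_measurable borel"
  shows "(\<integral>x. f x \<partial>shell_measure R1 R2) = (\<integral>x. indicator (annulus R1 R2) x *\<^sub>R f x \<partial>lborel)"
proof -
  have "shell_measure R1 R2 = density lborel (\<lambda>x::real^'n. ennreal (indicator (annulus R1 R2) x))"
    unfolding shell_measure_def by (rule arg_cong[where f="density lborel"]) (auto simp: fun_eq_iff indicator_def)
  then show ?thesis using assms by (simp add: integral_density)
qed

section \<open>Polar coordinates for radial functions\<close>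

lemma emeasure_annulus:
  assumes "0 \<le> u" "u \<le> R"
  shows "emeasure lborel (annulus u R :: (real^'n) set)
    = ennreal (unit_ball_vol CARD('n) * R ^ CARD('n) - unit_ball_vol CARD('n) * u ^ CARD('n))"
proof (cases "u = R")
  case True
  then have "annulus u R = ({} :: (real^'n) set)" by (auto simp: annulus_def)
  then show ?thesis using True by simp
next
  case False
  have "annulus u R = ball (0::real^'n) R - cball 0 u" by (auto simp: annulus_def)
  moreover have "cball 0 u \<subseteq> ball (0::real^'n) R" using False assms by auto
  ultimately have "emeasure lborel (annulus u R :: (real^'n) set)
      = emeasure lborel (ball (0::real^'n) R) - emeasure lborel (cball (0::real^'n) u)"
    using emeasure_bounded_finite[OF bounded_cball[of "0::real^'n" u]]
    by (simp add: emeasure_Diff less_top[symmetric])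
  then show ?thesis using assms
    by (simp add: emeasure_ball emeasure_cball ennreal_minus unit_ball_vol_nonneg)
qed

text \<open>Both measures are compared on half-lines, where each gives the volume of the annulus
  from \<open>max x R1\<close> to \<open>R2\<close>.\<close>

lemma distr_norm_shell_measure:
  assumes R: "0 < R1" "R1 < R2"
  shows "distr (shell_measure R1 R2 :: (real^'n) measure) borel norm =
    density lborel (\<lambda>s. ennreal (unit_ball_vol CARD('n) * (real CARD('n) * s ^ (CARD('n) - 1)) * indicator {R1..R2} s))"
    (is "?L = density lborel (\<lambda>s. ennreal (?w s * _))")
proof (rule measure_eqI_lessThan)
  let ?v = "unit_ball_vol CARD('n)"
  have v: "0 \<le> ?v" by (simp add: unit_ball_vol_nonneg)
  fix x :: real
  have L: "emeasure ?L {x<..} = emeasure lborel (annulus (max x R1) R2 :: (real^'n) set)"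
  proof -
    have "emeasure ?L {x<..} = emeasure (shell_measure R1 R2) {z :: real^'n. x < norm z}"
      by (subst emeasure_distr) (auto simp: vimage_def)
    also have "\<dots> = emeasure lborel (annulus R1 R2 \<inter> {z :: real^'n. x < norm z})"
      by (rule emeasure_shell_measure) measurable
    also have "annulus R1 R2 \<inter> {z :: real^'n. x < norm z} = annulus (max x R1) R2"
      by (auto simp: annulus_def)
    finally show ?thesis .
  qed
  show "emeasure ?L {x<..} < \<infinity>"
    unfolding L by (rule emeasure_bounded_finite) (rule boundedI[of _ R2], auto simp: annulus_def)
  have "emeasure (density lborel (\<lambda>s. ennreal (?w s * indicator {R1..R2} s))) {x<..}
      = (\<integral>\<^sup>+s. ennreal (?w s * indicator {R1..R2} s) * indicator {x<..} s \<partial>lborel)"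
    by (rule emeasure_density) measurable
  also have "\<dots> = emeasure lborel (annulus (max x R1) R2 :: (real^'n) set)"
  proof (cases "max x R1 \<le> R2")
    case True
    have "(\<integral>\<^sup>+s. ennreal (?w s * indicator {R1..R2} s) * indicator {x<..} s \<partial>lborel)
        = (\<integral>\<^sup>+s. ennreal (?w s) * indicator {max x R1..R2} s \<partial>lborel)"
    proof (rule nn_integral_cong_AE)
      show "AE s in lborel. ennreal (?w s * indicator {R1..R2} s) * indicator {x<..} s
          = ennreal (?w s) * indicator {max x R1..R2} s"
        \<comment> \<open>The endpoint \<open>x\<close> may lie in the closed interval but not in
          the open half-line; it is a null set.\<close>
        using AE_lborel_singleton[of x] by eventually_elim (auto simp: indicator_def)
    qed
    also have "\<dots> = ennreal (?v * R2 ^ CARD('n) - ?v * (max x R1) ^ CARD('n))"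
      by (rule nn_integral_FTC_Icc)
         (use True R v in \<open>auto intro!: derivative_eq_intros mult_nonneg_nonneg\<close>)
    finally show ?thesis using True R by (simp add: emeasure_annulus)
  next
    case False
    then have "annulus (max x R1) R2 = ({} :: (real^'n) set)" by (auto simp: annulus_def)
    moreover have "(\<integral>\<^sup>+s. ennreal (?w s * indicator {R1..R2} s) * indicator {x<..} s \<partial>lborel) = (\<integral>\<^sup>+s. 0 \<partial>(lborel::real measure))"
      using False R by (intro nn_integral_cong) (auto simp: indicator_def)
    ultimately show ?thesis by simp
  qed
  finally show "emeasure ?L {x<..} = emeasure (density lborel (\<lambda>s. ennreal (?w s * indicator {R1..R2} s))) {x<..}"
    by (simp add: L)
qed auto

text \<open>Polar coordinates are required only for radial integrands, because the spherical average
  has made \<open>f\<close> radial first.\<close>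

lemma integral_radial:
  fixes \<rho> :: "real \<Rightarrow> real"
  assumes R: "0 < R1" "R1 < R2" and [measurable]: "\<rho> \<in> borel_measurable borel"
  shows "(\<integral>x. \<rho> (norm x) \<partial>(shell_measure R1 R2 :: (real^'n) measure)) =
    unit_ball_vol CARD('n) * real CARD('n) * (\<integral>s. s ^ (CARD('n) - 1) * \<rho> s \<partial>restrict_space lborel {R1..R2})"
proof -
  let ?w = "\<lambda>s. unit_ball_vol CARD('n) * (real CARD('n) * s ^ (CARD('n) - 1)) * indicator {R1..R2} s"
  have "(\<integral>x. \<rho> (norm x) \<partial>(shell_measure R1 R2 :: (real^'n) measure)) = (\<integral>s. \<rho> s \<partial>(distr (shell_measure R1 R2 :: (real^'n) measure) borel norm))"
    by (rule integral_distr[symmetric]) measurable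
  also have "\<dots> = (\<integral>s. ?w s *\<^sub>R \<rho> s \<partial>lborel)"
    unfolding distr_norm_shell_measure[OF R]
    by (rule integral_density) (use R in \<open>auto simp: indicator_def unit_ball_vol_nonneg\<close>)
  also have "\<dots> = (\<integral>s. unit_ball_vol CARD('n) * real CARD('n) * (indicator {R1..R2} s *\<^sub>R (s ^ (CARD('n) - 1) * \<rho> s)) \<partial>lborel)"
    by (rule Bochner_Integration.integral_cong) auto
  also have "\<dots> = unit_ball_vol CARD('n) * real CARD('n) * (\<integral>s. s ^ (CARD('n) - 1) * \<rho> s \<partial>restrict_space lborel {R1..R2})"
    by (simp add: integral_restrict_space)
  finally show ?thesis .
qed

lemma inv_on_UNIV: "inv_on UNIV h \<Longrightarrow> norm x = norm x' \<Longrightarrow> h x = h x'"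
  unfolding inv_on_def snorm_UNIV by blast

lemma resample_UNIV: "resample UNIV x y = (norm x / norm y) *\<^sub>R y"
  by (simp add: resample_def snorm_UNIV vec_eq_iff)

text \<open>Whatever chain led to it, a fully invariant outcome is the explicit spherical
  mean.\<close>

lemma rot_average_value:
  fixes h :: "real^'n \<Rightarrow> real"
  assumes "rot_reach UNIV h g" "inv_on UNIV g" "admissible a b h" "x \<in> annulus a b"
  shows "g x = (\<integral>y. h ((norm x / norm y) *\<^sub>R y) \<partial>ball_unif)"
proof -
  have "g \<in> borel_measurable borel"
    using admissible_rot_reach[OF assms(1,3)] by (rule admissible_measurable)
  then have "g x = (\<integral>y. g (resample UNIV x y) \<partial>ball_unif)"
    by (intro integral_resample_inv_on[symmetric] assms) auto
  also have "\<dots> = (\<integral>y. h (resample UNIV x y) \<partial>ball_unif)"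
    by (rule integral_resample_reach) (use assms in auto)
  finally show ?thesis by (simp add: resample_UNIV)
qed

text \<open>By Fubini the spherical mean \<open>N\<close> of \<open>G\<close> is the radial moment
  of the spherical mean of \<open>f\<close>. Up to a positive constant this is the integral of
  \<open>f\<close> over the shell, hence zero, and the telescoped potentials represent
  \<open>G\<close> itself.\<close>

theorem mean_zero_potential:
  fixes f G :: "real^'n \<Rightarrow> real"
  assumes n: "2 \<le> CARD('n)" and R: "0 < a" "a < R1" "R1 < R2" "R2 < b"
    and f: "admissible a b f" and f0: "(\<integral>x. f x \<partial>shell_measure R1 R2) = 0"
    and G: "admissible a b G"
      "\<And>x. x \<in> annulus a b \<Longrightarrow>
        G x = (\<integral>s. s ^ (CARD('n) - 1) * f ((s / norm x) *\<^sub>R x) \<partial>restrict_space lborel {R1..R2})"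
  shows "\<exists>H. (\<forall>p q. real_analytic_on (H p q) (annulus a b)) \<and>
     (\<forall>x\<in>annulus a b. G x =
        (\<Sum>p\<in>UNIV. \<Sum>q\<in>UNIV. frechet_derivative (H p q) (at x) (rot_gen p q x)))"
proof -
  obtain g where g: "rot_reach UNIV f g" "inv_on UNIV g"
    using rot_average_exists[of UNIV a b f] n f by auto
  obtain N where N: "rot_reach UNIV G N" "inv_on UNIV N"
    using rot_average_exists[of UNIV a b G] n G(1) by auto
  have fm[measurable]: "f \<in> borel_measurable borel" using f by (rule admissible_measurable)
  have gm[measurable]: "g \<in> borel_measurable borel"
    using admissible_rot_reach[OF g(1) f] by (rule admissible_measurable)
  have Gm[measurable]: "G \<in> borel_measurable borel" using G(1) by (rule admissible_measurable)
  \<comment> \<open>Any unit vector would do: along it the radial function \<open>g\<close> is read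
    off as a profile \<open>\<rho>\<close> of one variable.\<close>
  define e :: "real^'n" where "e = axis undefined 1"
  have e: "norm e = 1" by (simp add: e_def)
  define \<rho> where "\<rho> s = g (s *\<^sub>R e)" for s
  have [measurable]: "\<rho> \<in> borel_measurable borel" unfolding \<rho>_def[abs_def] by measurable
  let ?I = "restrict_space lborel {R1..R2}"
  let ?w = "\<lambda>s y. s ^ (CARD('n) - 1) * f ((s / norm y) *\<^sub>R y)"
  have mom: "(\<integral>s. s ^ (CARD('n) - 1) * \<rho> s \<partial>?I) = 0"
  proof -
    have "g x = \<rho> (norm x)" for x unfolding \<rho>_def by (rule inv_on_UNIV[OF g(2)]) (simp add: e)
    then have "(\<integral>x. \<rho> (norm x) \<partial>(shell_measure R1 R2 :: (real^'n) measure)) = (\<integral>x. g x \<partial>shell_measure R1 R2)" by simp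
    also have "\<dots> = (\<integral>x. f x \<partial>shell_measure R1 R2)"
      by (rule integral_rot_reach_invariant[OF g(1) f finite_shell_measure _ _ AE_shell_measure])
         (use R in \<open>auto simp: distr_shell_measure_rot\<close>)
    finally have "(\<integral>x. \<rho> (norm x) \<partial>(shell_measure R1 R2 :: (real^'n) measure)) = 0" using f0 by simp
    moreover have "0 < unit_ball_vol CARD('n)" by (rule unit_ball_vol_pos) simp
    ultimately show ?thesis
      using integral_radial[of R1 R2 \<rho>, where 'n='n] R by simp
  qed
  have "N x = 0" if x: "x \<in> annulus a b" for x
  proof -
    interpret I: finite_measure ?I by (rule finite_measure_interval)
    interpret P: pair_sigma_finite ?I "ball_unif :: (real^'n) measure" ..
    interpret PF: finite_measure "?I \<Otimes>\<^sub>M (ball_unif :: (real^'n) measure)"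
      by (rule finite_measure_pair_measure) unfold_locales
    obtain B where B: "0 \<le> B" "\<And>x. R1 \<le> norm x \<Longrightarrow> norm x \<le> R2 \<Longrightarrow> \<bar>f x\<bar> \<le> B"
      using admissible_bounded_shell[OF f, of R1 R2] R by blast
    have fst: "fst \<in> borel_measurable (?I \<Otimes>\<^sub>M (ball_unif :: (real^'n) measure))"
      by (rule measurable_compose[OF measurable_fst]) (auto intro: measurable_restrict_space1)
    have nz: "AE y in (ball_unif :: (real^'n) measure). 0 < norm y"
      using AE_snorm_pos[of "UNIV :: 'n set"] by (simp add: snorm_UNIV)
    have int: "integrable (?I \<Otimes>\<^sub>M ball_unif) (case_prod (\<lambda>s y. ?w s y))"
    proof (rule PF.integrable_const_bound[where B="R2 ^ (CARD('n) - 1) * B"])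
      have "AE z in ?I \<Otimes>\<^sub>M (ball_unif :: (real^'n) measure). 0 < norm (snd z)"
        by (rule P.AE_pair_measure) (measurable, use nz in simp)
      then show "AE z in ?I \<Otimes>\<^sub>M ball_unif. norm (case z of (s, y) \<Rightarrow> ?w s y) \<le> R2 ^ (CARD('n) - 1) * B"
      proof (rule AE_mp, intro AE_I2 impI)
        fix z assume "z \<in> space (?I \<Otimes>\<^sub>M (ball_unif :: (real^'n) measure))" and y: "0 < norm (snd z)"
        then have s: "R1 \<le> fst z" "fst z \<le> R2" by (auto simp: space_pair_measure space_restrict_space)
        have "\<bar>fst z\<bar> ^ (CARD('n) - 1) * \<bar>f ((fst z / norm (snd z)) *\<^sub>R snd z)\<bar> \<le> R2 ^ (CARD('n) - 1) * B"
          using s R y B by (intro mult_mono power_mono B(2)) auto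
        then show "norm (case z of (s, y) \<Rightarrow> ?w s y) \<le> R2 ^ (CARD('n) - 1) * B"
          by (simp add: case_prod_beta abs_mult power_abs)
      qed
      have "(\<lambda>z. fst z ^ (CARD('n) - 1) * f ((fst z / norm (snd z)) *\<^sub>R snd z)) \<in> borel_measurable (?I \<Otimes>\<^sub>M ball_unif)"
        using fst by measurable
      then show "case_prod (\<lambda>s y. ?w s y) \<in> borel_measurable (?I \<Otimes>\<^sub>M ball_unif)"
        by (simp add: case_prod_beta')
    qed
    have "N x = (\<integral>y. G ((norm x / norm y) *\<^sub>R y) \<partial>ball_unif)"
      by (rule rot_average_value[OF N G(1) x])
    also have "\<dots> = (\<integral>y. (\<integral>s. ?w s y \<partial>?I) \<partial>ball_unif)"
    proof (rule integral_cong_AE)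
      show "AE y in ball_unif. G ((norm x / norm y) *\<^sub>R y) = (\<integral>s. ?w s y \<partial>?I)"
        using nz
      proof eventually_elim
        case (elim y)
        have x0: "0 < norm x" using x R(1) unfolding annulus_def mem_Collect_eq by linarith
        have "(norm x / norm y) *\<^sub>R y \<in> annulus a b" using elim x by (simp add: annulus_def)
        from G(2)[OF this] show ?case using elim x0 by simp
      qed
      show "(\<lambda>y. \<integral>s. ?w s y \<partial>?I) \<in> borel_measurable ball_unif"
      proof (rule I.borel_measurable_lebesgue_integral)
        have "snd \<in> borel_measurable ((ball_unif :: (real^'n) measure) \<Otimes>\<^sub>M ?I)"
          by (rule measurable_compose[OF measurable_snd]) (auto intro: measurable_restrict_space1)
        then have "(\<lambda>z. snd z ^ (CARD('n) - 1) * f ((snd z / norm (fst z)) *\<^sub>R fst z)) \<in> borel_measurable (ball_unif \<Otimes>\<^sub>M ?I)"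
          by measurable
        then show "case_prod (\<lambda>y s. ?w s y) \<in> borel_measurable (ball_unif \<Otimes>\<^sub>M ?I)"
          by (simp add: case_prod_beta')
      qed
    qed measurable
    also have "\<dots> = (\<integral>s. (\<integral>y. ?w s y \<partial>ball_unif) \<partial>?I)"
      by (rule P.Fubini_integral[OF int])
    also have "\<dots> = (\<integral>s. s ^ (CARD('n) - 1) * \<rho> s \<partial>?I)"
    proof (rule Bochner_Integration.integral_cong[OF refl])
      fix s assume "s \<in> space ?I"
      then have s: "R1 \<le> s" "s \<le> R2" by (auto simp: space_restrict_space)
      then have "norm (s *\<^sub>R e) = s" using R by (simp add: e)
      moreover have "s *\<^sub>R e \<in> annulus a b" using s R by (simp add: annulus_def e)
      ultimately have "\<rho> s = (\<integral>y. f ((s / norm y) *\<^sub>R y) \<partial>ball_unif)"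
        unfolding \<rho>_def using rot_average_value[OF g f] by metis
      then show "(\<integral>y. ?w s y \<partial>ball_unif) = s ^ (CARD('n) - 1) * \<rho> s"
        by simp
    qed
    also have "\<dots> = 0" by (rule mom)
    finally show ?thesis .
  qed
  with rot_reach_potential[OF N(1) G(1)] show ?thesis by simp
qed

section \<open>Solving the divergence equation\<close>

lemma frechet_derivative_curve:
  fixes g :: "'a::real_normed_vector \<Rightarrow> real"
  assumes "g differentiable (at (c t))" "(c has_vector_derivative v) (at t)"
  shows "((\<lambda>s. g (c s)) has_real_derivative frechet_derivative g (at (c t)) v) (at t)"
proof -
  have d: "(g has_derivative frechet_derivative g (at (c t))) (at (c t))"
    using assms(1) frechet_derivative_works by blast
  have "((\<lambda>s. g (c s)) has_derivative (\<lambda>s. frechet_derivative g (at (c t)) (s *\<^sub>R v))) (at t)"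
    by (rule has_derivative_compose[OF assms(2)[unfolded has_vector_derivative_def] d])
  then show ?thesis
    unfolding has_field_derivative_def
    using linear_scale[OF has_derivative_linear[OF d]] by (simp add: mult.commute[of _ "frechet_derivative _ _ _"])
qed

lemma sum_linear_axis:
  fixes D :: "real^'n \<Rightarrow> real"
  assumes "linear D" shows "(\<Sum>i\<in>UNIV. D (axis i 1) * v $ i) = D v"
proof -
  have "D v = D (\<Sum>i\<in>UNIV. v $ i *\<^sub>R axis i 1)"
    using basis_expansion[of v] by (simp add: scalar_mult_eq_scaleR)
  also have "\<dots> = (\<Sum>i\<in>UNIV. v $ i * D (axis i 1))"
    by (simp add: linear_sum[OF assms] linear_scale[OF assms])
  finally show ?thesis by (simp add: mult.commute)
qed

lemma linear_rot_gen: "linear (rot_gen p q)"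
  by (rule linearI) (auto simp: rot_gen_def algebra_simps)

lemma rot_gen_trace: "(\<Sum>i\<in>UNIV. rot_gen p q (axis i 1) $ i) = 0"
proof -
  have "rot_gen p q (axis i 1) $ i = 0" for i by (auto simp: rot_gen_def axis_def)
  then show ?thesis by simp
qed

lemma divergence_eq_trace:
  fixes V :: "real^'n \<Rightarrow> real^'n"
  assumes "(V has_derivative V') (at x)"
  shows "divergence V x = (\<Sum>i\<in>UNIV. V' (axis i 1) $ i)"
  unfolding divergence_def
proof (intro sum.cong refl)
  fix i :: 'n
  have c: "((\<lambda>t. x + t *\<^sub>R axis i 1) has_derivative (\<lambda>t. t *\<^sub>R axis i 1)) (at (0::real))"
    by (auto intro!: derivative_eq_intros)
  have "((\<lambda>t. V (x + t *\<^sub>R axis i 1)) has_derivative (\<lambda>t. V' (t *\<^sub>R axis i 1))) (at (0::real))"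
    by (rule has_derivative_compose[OF c]) (use assms in simp)
  then have "((\<lambda>t. V (x + t *\<^sub>R axis i 1) $ i) has_derivative (\<lambda>t. V' (t *\<^sub>R axis i 1) $ i)) (at (0::real))"
    by (rule bounded_linear.has_derivative[OF bounded_linear_vec_nth])
  moreover have "V' (t *\<^sub>R axis i 1) $ i = V' (axis i 1) $ i * t" for t
    using linear_scale[OF has_derivative_linear[OF assms]] by simp
  ultimately have "((\<lambda>t. V (x + t *\<^sub>R axis i 1) $ i) has_real_derivative V' (axis i 1) $ i) (at 0)"
    by (simp add: has_field_derivative_def)
  then show "deriv (\<lambda>t. V (x + t *\<^sub>R axis i 1) $ i) 0 = V' (axis i 1) $ i" by (rule DERIV_imp_deriv)
qed

text \<open>A trace computation: the identity has trace \<open>CARD('n)\<close>, the linear map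
  \<open>rot_gen p q\<close> has trace 0, and the product rule leaves the derivatives of the
  coefficients along the fields.\<close>

lemma divergence_radial_tangential:
  fixes g0 :: "real^'n \<Rightarrow> real" and g :: "'n \<Rightarrow> 'n \<Rightarrow> real^'n \<Rightarrow> real"
  assumes "g0 differentiable (at x)" "\<And>p q. g p q differentiable (at x)"
  shows "divergence (\<lambda>x. g0 x *\<^sub>R x + (\<Sum>p\<in>UNIV. \<Sum>q\<in>UNIV. g p q x *\<^sub>R rot_gen p q x)) x =
    real CARD('n) * g0 x + frechet_derivative g0 (at x) x +
    (\<Sum>p\<in>UNIV. \<Sum>q\<in>UNIV. frechet_derivative (g p q) (at x) (rot_gen p q x))"
proof -
  let ?E = "frechet_derivative g0 (at x)" and ?D = "\<lambda>p q. frechet_derivative (g p q) (at x)"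
  let ?S = "\<lambda>i p q. g p q x * rot_gen p q (axis i 1) $ i + ?D p q (axis i 1) * rot_gen p q x $ i"
  have d0: "(g0 has_derivative ?E) (at x)" using assms(1) frechet_derivative_works by blast
  have d: "(g p q has_derivative ?D p q) (at x)" for p q using assms(2) frechet_derivative_works by blast
  have r: "(rot_gen p q has_derivative rot_gen p q) (at x)" for p q
    by (intro bounded_linear_imp_has_derivative linear_conv_bounded_linear[THEN iffD1] linear_rot_gen)
  have deriv: "((\<lambda>x. g0 x *\<^sub>R x + (\<Sum>p\<in>UNIV. \<Sum>q\<in>UNIV. g p q x *\<^sub>R rot_gen p q x)) has_derivative
     (\<lambda>v. (g0 x *\<^sub>R v + ?E v *\<^sub>R x) +
        (\<Sum>p\<in>UNIV. \<Sum>q\<in>UNIV. g p q x *\<^sub>R rot_gen p q v + ?D p q v *\<^sub>R rot_gen p q x))) (at x)"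
    by (intro has_derivative_add has_derivative_sum has_derivative_scaleR d0 d r has_derivative_ident)
  have swap: "(\<Sum>i\<in>UNIV. \<Sum>p\<in>UNIV. \<Sum>q\<in>UNIV. T i p q) = (\<Sum>p\<in>UNIV. \<Sum>q\<in>UNIV. \<Sum>i\<in>UNIV. T i p q)"
    for T :: "'n \<Rightarrow> 'n \<Rightarrow> 'n \<Rightarrow> real"
  proof -
    have "(\<Sum>i\<in>UNIV. \<Sum>p\<in>UNIV. \<Sum>q\<in>UNIV. T i p q) = (\<Sum>p\<in>UNIV. \<Sum>i\<in>UNIV. \<Sum>q\<in>UNIV. T i p q)"
      by (rule sum.swap)
    also have "\<dots> = (\<Sum>p\<in>UNIV. \<Sum>q\<in>UNIV. \<Sum>i\<in>UNIV. T i p q)"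
      by (intro sum.cong refl sum.swap)
    finally show ?thesis .
  qed
  from divergence_eq_trace[OF deriv]
  have "divergence (\<lambda>x. g0 x *\<^sub>R x + (\<Sum>p\<in>UNIV. \<Sum>q\<in>UNIV. g p q x *\<^sub>R rot_gen p q x)) x =
    (\<Sum>i\<in>UNIV. g0 x + ?E (axis i 1) * x $ i +
       (\<Sum>p\<in>UNIV. \<Sum>q\<in>UNIV. ?S i p q))"
    by (simp add: axis_def)
  also have "\<dots> = (\<Sum>i\<in>(UNIV::'n set). g0 x) + (\<Sum>i\<in>UNIV. ?E (axis i 1) * x $ i) +
       (\<Sum>i\<in>UNIV. \<Sum>p\<in>UNIV. \<Sum>q\<in>UNIV. ?S i p q)"
    by (simp only: sum.distrib)
  also have "(\<Sum>i\<in>(UNIV::'n set). g0 x) = real CARD('n) * g0 x" by simp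
  also have "(\<Sum>i\<in>UNIV. ?E (axis i 1) * x $ i) = ?E x"
    by (rule sum_linear_axis[OF has_derivative_linear[OF d0]])
  also have "(\<Sum>i\<in>UNIV. \<Sum>p\<in>UNIV. \<Sum>q\<in>UNIV. ?S i p q)
     = (\<Sum>p\<in>UNIV. \<Sum>q\<in>UNIV. ?D p q (rot_gen p q x))"
  proof -
    have "(\<Sum>i\<in>UNIV. \<Sum>p\<in>UNIV. \<Sum>q\<in>UNIV. ?S i p q)
      = (\<Sum>p\<in>UNIV. \<Sum>q\<in>UNIV. \<Sum>i\<in>UNIV. ?S i p q)"
      by (rule swap)
    also have "\<dots> = (\<Sum>p\<in>UNIV. \<Sum>q\<in>UNIV. ?D p q (rot_gen p q x))"
    proof (intro sum.cong refl)
      fix p q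
      have "(\<Sum>i\<in>UNIV. ?S i p q)
        = g p q x * (\<Sum>i\<in>UNIV. rot_gen p q (axis i 1) $ i) + (\<Sum>i\<in>UNIV. ?D p q (axis i 1) * rot_gen p q x $ i)"
        by (simp add: sum.distrib sum_distrib_left)
      then show "(\<Sum>i\<in>UNIV. ?S i p q) = ?D p q (rot_gen p q x)"
        by (simp add: rot_gen_trace sum_linear_axis[OF has_derivative_linear[OF d]])
    qed
    finally show ?thesis .
  qed
  finally show ?thesis .
qed

section \<open>Analyticity of radial constructions\<close>

lemma norm_sq_vec: "(norm x)\<^sup>2 = (\<Sum>i\<in>UNIV. (x $ i)\<^sup>2)" for x :: "real^'n"
  using snorm_sq[of UNIV x] by (simp add: snorm_UNIV)

lemma panalytic_norm_sq: "panalytic t x (\<lambda>_ x. (norm x)\<^sup>2)"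
  unfolding norm_sq_vec by (intro panalytic_sum panalytic_power panalytic_coord) simp

lemma panalytic_inverse_norm:
  assumes "x \<noteq> 0" shows "panalytic t x (\<lambda>_ x. inverse (norm x))"
proof -
  have "panalytic t x (\<lambda>_ x. ((norm x)\<^sup>2) powr (-1/2))"
    by (rule panalytic_powr[OF panalytic_norm_sq]) (use assms in auto)
  \<comment> \<open>Also true at \<open>y = 0\<close>, where both sides are 0, so the two functions
    agree everywhere.\<close>
  moreover have "((norm y)\<^sup>2) powr (-1/2) = inverse (norm y)" for y :: "real^'a"
    using powr_minus[of "(norm y)\<^sup>2" "1/2"] by (simp add: powr_half_sqrt)
  ultimately show ?thesis by simp
qed

lemma panalytic_norm:
  assumes "x \<noteq> 0" shows "panalytic t x (\<lambda>_ x. norm x)"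
proof -
  have "panalytic t x (\<lambda>_ x. (norm x)\<^sup>2 * inverse (norm x))"
    by (intro panalytic_mult panalytic_norm_sq panalytic_inverse_norm assms)
  moreover have "(norm y)\<^sup>2 * inverse (norm y) = norm y" for y :: "real^'a"
    by (cases "y = 0") (simp_all add: power2_eq_square)
  ultimately show ?thesis by simp
qed

lemma panalytic_radial_compose:
  fixes f :: "real^'n \<Rightarrow> real"
  assumes f: "real_analytic_on f (annulus a b)" and x: "x \<noteq> 0" and a: "0 \<le> a"
    and \<sigma>: "panalytic t x \<sigma>" "continuous_on UNIV (\<lambda>s. \<sigma> s x)" "a < \<sigma> t x" "\<sigma> t x < b"
  shows "panalytic t x (\<lambda>s y. f ((\<sigma> s y / norm y) *\<^sub>R y))"
proof (rule panalytic_compose[OF f])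
  show "(\<sigma> t x / norm x) *\<^sub>R x \<in> annulus a b" using x a \<sigma>(3,4) by (simp add: annulus_def)
  show "panalytic t x (\<lambda>s y. ((\<sigma> s y / norm y) *\<^sub>R y) $ i)" for i
    unfolding vector_scaleR_component divide_inverse real_scaleR_def
    by (intro panalytic_mult \<sigma> panalytic_inverse_norm x panalytic_coord)
  show "continuous_on UNIV (\<lambda>s. (\<sigma> s x / norm x) *\<^sub>R x)"
    using x by (intro continuous_intros \<sigma>) auto
qed

lemma real_analytic_on_cong:
  assumes "real_analytic_on f S" "\<And>x. x \<in> S \<Longrightarrow> g x = f x"
  shows "real_analytic_on g S"
  unfolding real_analytic_on_def
proof
  fix a assume "a \<in> S"
  from bspec[OF assms(1)[unfolded real_analytic_on_def] this] obtain r c where r: "r > 0" "ball a r \<subseteq> S"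
    and c: "\<forall>x\<in>ball a r. ((\<lambda>\<alpha>. (\<Prod>i\<in>UNIV. (x$i - a$i) ^ \<alpha> i) *\<^sub>R c \<alpha>) has_sum f x) UNIV"
    by (elim exE conjE)
  have "\<forall>x\<in>ball a r. ((\<lambda>\<alpha>. (\<Prod>i\<in>UNIV. (x$i - a$i) ^ \<alpha> i) *\<^sub>R c \<alpha>) has_sum g x) UNIV"
  proof
    fix x assume x: "x \<in> ball a r"
    with r(2) have "g x = f x" by (intro assms(2)) blast
    with bspec[OF c x] show "((\<lambda>\<alpha>. (\<Prod>i\<in>UNIV. (x$i - a$i) ^ \<alpha> i) *\<^sub>R c \<alpha>) has_sum g x) UNIV" by simp
  qed
  with r show "\<exists>r>0. ball a r \<subseteq> S \<and> (\<exists>c. \<forall>x\<in>ball a r. ((\<lambda>\<alpha>. (\<Prod>i\<in>UNIV. (x$i - a$i) ^ \<alpha> i) *\<^sub>R c \<alpha>) has_sum g x) UNIV)"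
    by (intro exI[of _ r] conjI exI[of _ c]) assumption+
qed

text \<open>Depends on the direction of \<open>x\<close> only, hence is constant along rays.\<close>

definition radial_moment :: "real \<Rightarrow> real \<Rightarrow> (real^'n \<Rightarrow> real) \<Rightarrow> real^'n \<Rightarrow> real" where
  "radial_moment R1 R2 f x =
     (\<integral>s. s ^ (CARD('n) - 1) * f ((s / norm x) *\<^sub>R x) \<partial>restrict_space lborel {R1..R2})"

text \<open>The integral of \<open>s\<^sup>n\<^sup>-\<^sup>1 f(s x/|x|)\<close> over \<open>s\<close> from \<open>R\<close> to \<open>|x|\<close>, rescaled to the unit interval.\<close>

definition radial_primitive :: "real \<Rightarrow> (real^'n \<Rightarrow> real) \<Rightarrow> real^'n \<Rightarrow> real" where
  "radial_primitive R f x =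
     (\<integral>\<tau>. 1 * ((norm x - R) * ((R + \<tau> * (norm x - R)) ^ (CARD('n) - 1) *
        f (((R + \<tau> * (norm x - R)) / norm x) *\<^sub>R x))) \<partial>restrict_space lborel {0..1})"

lemma convex_between:
  fixes a b u v \<tau> :: real
  assumes "a < u" "u < b" "a < v" "v < b" "0 \<le> \<tau>" "\<tau> \<le> 1"
  shows "a < u + \<tau> * (v - u)" "u + \<tau> * (v - u) < b"
proof -
  have *: "u + \<tau> * (v - u) = (1 - \<tau>) * u + \<tau> * v" by (simp add: algebra_simps)
  have "u + \<tau> * (v - u) \<in> {a<..<b}"
    unfolding * using convexD[OF convex_real_interval(8)[of a b], of u v "1 - \<tau>" \<tau>] assms by simp
  then show "a < u + \<tau> * (v - u)" "u + \<tau> * (v - u) < b" by auto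
qed

lemma annulus_nonzero: "x \<in> annulus a b \<Longrightarrow> 0 \<le> a \<Longrightarrow> x \<noteq> 0"
  by (auto simp: annulus_def)

lemma real_analytic_radial_moment:
  fixes f :: "real^'n \<Rightarrow> real"
  assumes f: "real_analytic_on f (annulus a b)" and R: "0 < a" "a < R1" "R1 < R2" "R2 < b"
  shows "real_analytic_on (radial_moment R1 R2 f) (annulus a b)"
proof (rule panalytic_imp_real_analytic_on[OF open_annulus, where t="0::real"])
  fix x :: "real^'n" assume x: "x \<in> annulus a b"
  have x0: "x \<noteq> 0" using annulus_nonzero[OF x] R by simp
  have "panalytic (0::real) x (\<lambda>_ x. \<integral>s. s ^ (CARD('n) - 1) * f ((s / norm x) *\<^sub>R x) \<partial>restrict_space lborel {R1..R2})"
  proof (rule panalytic_integral[where K="{R1..R2}" and W="R2 ^ (CARD('n) - 1)"])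
    show "panalytic s x (\<lambda>s x. f ((s / norm x) *\<^sub>R x))" if "s \<in> {R1..R2}" for s
      by (rule panalytic_radial_compose[OF f x0])
         (use R that in \<open>auto intro!: panalytic_param continuous_intros\<close>)
    show "finite_measure (restrict_space lborel {R1..R2})" by (rule finite_measure_interval)
    show "\<bar>s ^ (CARD('n) - 1)\<bar> \<le> R2 ^ (CARD('n) - 1)" if "s \<in> space (restrict_space lborel {R1..R2})" for s
      using that R by (auto simp: space_restrict_space power_abs intro!: power_mono)
  qed (use R in \<open>auto simp: space_restrict_space intro!: measurable_restrict_space1\<close>)
  then show "panalytic (0::real) x (\<lambda>_. radial_moment R1 R2 f)" by (simp add: radial_moment_def[abs_def])
qed

text \<open>The rescaled form pays off here: the variable limit \<open>norm x\<close> has moved into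
  an integrand over a fixed compact parameter interval.\<close>

lemma real_analytic_radial_primitive:
  fixes f :: "real^'n \<Rightarrow> real"
  assumes f: "real_analytic_on f (annulus a b)" and R: "0 < a" "a < R" "R < b"
  shows "real_analytic_on (radial_primitive R f) (annulus a b)"
proof (rule panalytic_imp_real_analytic_on[OF open_annulus, where t="0::real"])
  fix x :: "real^'n" assume x: "x \<in> annulus a b"
  have x0: "x \<noteq> 0" using annulus_nonzero[OF x] R by simp
  let ?\<sigma> = "\<lambda>\<tau> x. R + \<tau> * (norm x - R)"
  have \<sigma>: "panalytic \<tau> x ?\<sigma>" for \<tau>
    by (intro panalytic_add panalytic_mult panalytic_diff panalytic_const panalytic_norm x0 panalytic_param continuous_on_id)
  have "panalytic (0::real) x (\<lambda>_ x. \<integral>\<tau>. 1 * ((norm x - R) * (?\<sigma> \<tau> x ^ (CARD('n) - 1) *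
        f ((?\<sigma> \<tau> x / norm x) *\<^sub>R x))) \<partial>restrict_space lborel {0..1})"
  proof (rule panalytic_integral[where K="{0..1}" and W=1])
    show "panalytic \<tau> x (\<lambda>\<tau> x. (norm x - R) * (?\<sigma> \<tau> x ^ (CARD('n) - 1) * f ((?\<sigma> \<tau> x / norm x) *\<^sub>R x)))"
      if "\<tau> \<in> {0..1}" for \<tau>
    proof (intro panalytic_mult panalytic_power \<sigma>)
      show "panalytic \<tau> x (\<lambda>\<tau> x. norm x - R)" by (intro panalytic_diff panalytic_norm panalytic_const x0)
      show "panalytic \<tau> x (\<lambda>\<tau> x. f ((?\<sigma> \<tau> x / norm x) *\<^sub>R x))"
        by (rule panalytic_radial_compose[OF f x0 _ \<sigma>])
           (use R x that convex_between[of a R b "norm x" \<tau>] in \<open>auto simp: annulus_def intro!: continuous_intros\<close>)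
    qed
    show "finite_measure (restrict_space lborel {0..1::real})" by (rule finite_measure_interval)
  qed (auto simp: space_restrict_space intro!: measurable_restrict_space1)
  then show "panalytic (0::real) x (\<lambda>_. radial_primitive R f)" by (simp add: radial_primitive_def[abs_def])
qed

text \<open>On each ray a single antiderivative \<Phi> describes the primitive at all points of the
  ray as well as the moment, so the two can be compared on the outer sphere and the primitive can be
  differentiated along the ray.\<close>

lemma radial_primitive_eq:
  fixes f :: "real^'n \<Rightarrow> real"
  assumes f: "real_analytic_on f (annulus a b)" and R: "0 < a" "a < R1" "R1 < R2" "R2 < b" and x: "x \<in> annulus a b"
  shows "\<exists>\<Phi>.
    (\<forall>s. a < s \<longrightarrow> s < b \<longrightarrow> (\<Phi> has_real_derivative s ^ (CARD('n) - 1) * f ((s / norm x) *\<^sub>R x)) (at s)) \<and>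
    (\<forall>\<kappa>>0. a < \<kappa> * norm x \<longrightarrow> \<kappa> * norm x < b \<longrightarrow>
       radial_primitive R1 f (\<kappa> *\<^sub>R x) = \<Phi> (\<kappa> * norm x) - \<Phi> R1) \<and>
    radial_moment R1 R2 f x = \<Phi> R2 - \<Phi> R1"
proof -
  have x0: "x \<noteq> 0" using annulus_nonzero[OF x] R by simp
  define \<phi> where "\<phi> s = s ^ (CARD('n) - 1) * f ((s / norm x) *\<^sub>R x)" for s
  have cont: "isCont \<phi> s" if "a < s" "s < b" for s
  proof -
    have "(s / norm x) *\<^sub>R x \<in> annulus a b" using that R x0 by (simp add: annulus_def)
    then have "isCont f ((s / norm x) *\<^sub>R x)"
      using real_analytic_on_differentiable[OF f] differentiable_imp_continuous_within by blast
    moreover have "isCont (\<lambda>s. (s / norm x) *\<^sub>R x) s" using x0 by (intro continuous_intros) auto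
    ultimately have "isCont (\<lambda>s. f ((s / norm x) *\<^sub>R x)) s"
      using isCont_o2[where f="\<lambda>s. (s / norm x) *\<^sub>R x"] by blast
    then show ?thesis unfolding \<phi>_def by (intro continuous_intros)
  qed
  have "ereal a < ereal b" using R by simp
  then obtain \<Phi> where "\<And>s. a < s \<Longrightarrow> s < b \<Longrightarrow> (\<Phi> has_vector_derivative \<phi> s) (at s)"
    using einterval_antiderivative[of "ereal a" "ereal b" \<phi>] cont by auto
  then have \<Phi>: "(\<Phi> has_real_derivative \<phi> s) (at s)" if "a < s" "s < b" for s
    using that by (simp add: has_real_derivative_iff_has_vector_derivative)
  show ?thesis
  proof (intro exI[of _ \<Phi>] conjI allI impI)
    show "(\<Phi> has_real_derivative s ^ (CARD('n) - 1) * f ((s / norm x) *\<^sub>R x)) (at s)" if "a < s" "s < b" for s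
      using \<Phi>[OF that] by (simp add: \<phi>_def)
    show "radial_moment R1 R2 f x = \<Phi> R2 - \<Phi> R1"
    proof -
      have "radial_moment R1 R2 f x = (\<integral>s. \<phi> s * indicator {R1..R2} s \<partial>lborel)"
        unfolding radial_moment_def by (subst integral_restrict_space) (auto simp: \<phi>_def mult.commute)
      also have "\<dots> = \<Phi> R2 - \<Phi> R1"
        by (rule integral_FTC_Icc_real) (use R in \<open>auto intro!: \<Phi> cont\<close>)
      finally show ?thesis .
    qed
    show "radial_primitive R1 f (\<kappa> *\<^sub>R x) = \<Phi> (\<kappa> * norm x) - \<Phi> R1"
      if l: "0 < \<kappa>" "a < \<kappa> * norm x" "\<kappa> * norm x < b" for \<kappa>
    proof -
      let ?r = "\<kappa> * norm x"
      let ?\<sigma> = "\<lambda>\<tau>. R1 + \<tau> * (?r - R1)"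
      have btw: "a < ?\<sigma> \<tau>" "?\<sigma> \<tau> < b" if "0 \<le> \<tau>" "\<tau> \<le> 1" for \<tau>
        using convex_between[of a R1 b ?r \<tau>] R l that by auto
      have "radial_primitive R1 f (\<kappa> *\<^sub>R x) = (\<integral>\<tau>. ((?r - R1) * \<phi> (?\<sigma> \<tau>)) * indicator {0..1} \<tau> \<partial>lborel)"
        unfolding radial_primitive_def using l(1)
        by (subst integral_restrict_space) (auto simp: \<phi>_def mult.commute)
      also have "\<dots> = \<Phi> (?\<sigma> 1) - \<Phi> (?\<sigma> 0)"
      proof (rule integral_FTC_Icc_real)
        fix \<tau> :: real assume t: "0 \<le> \<tau>" "\<tau> \<le> 1"
        have "((\<lambda>\<tau>. \<Phi> (?\<sigma> \<tau>)) has_real_derivative \<phi> (?\<sigma> \<tau>) * (?r - R1)) (at \<tau>)"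
          by (rule DERIV_chain2[where f=\<Phi> and g="?\<sigma>", OF \<Phi>[OF btw[OF t]]]) (auto intro!: derivative_eq_intros)
        then show "((\<lambda>\<tau>. \<Phi> (?\<sigma> \<tau>)) has_real_derivative (?r - R1) * \<phi> (?\<sigma> \<tau>)) (at \<tau>)"
          by (simp only: mult.commute)
        have "isCont ?\<sigma> \<tau>" by (intro continuous_intros)
        then have "isCont (\<lambda>\<tau>. \<phi> (?\<sigma> \<tau>)) \<tau>" by (rule isCont_o2) (rule cont[OF btw[OF t]])
        then show "isCont (\<lambda>\<tau>. (?r - R1) * \<phi> (?\<sigma> \<tau>)) \<tau>" by (intro continuous_intros)
      qed simp
      finally show ?thesis by simp
    qed
  qed
qed

section \<open>Assembling the solution\<close>

lemma compact_cannulus: "compact (cannulus R1 R2 :: (real^'n) set)"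
proof -
  have "closed (cannulus R1 R2 :: (real^'n) set)"
    unfolding cannulus_def by (intro closed_Collect_conj closed_Collect_le continuous_intros)
  moreover have "bounded (cannulus R1 R2 :: (real^'n) set)"
    by (rule boundedI[of _ R2]) (auto simp: cannulus_def)
  ultimately show ?thesis using compact_eq_bounded_closed by blast
qed

lemma DERIV_smoothstep:
  assumes "(w has_real_derivative w') (at t)"
  shows "((\<lambda>s. (w s)\<^sup>2 * (3 - 2 * w s)) has_real_derivative 6 * (w t * (1 - w t)) * w') (at t)"
  using assms by (auto intro!: derivative_eq_intros simp: algebra_simps power2_eq_square)

text \<open>The radial part of \<open>V\<close> has divergence \<open>f x - \<psi> x * G x\<close>.
  The tangential part restores \<open>\<psi> x * G x\<close>, since \<psi> depends on the norm only
  and passes through derivatives along rotations.\<close>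

theorem divergence_solution:
  fixes f :: "real^'n \<Rightarrow> real"
  assumes n: "2 \<le> CARD('n)" and R: "0 < a" "a < R1" "R1 < R2" "R2 < b"
    and f: "admissible a b f" and f0: "(\<integral>x. f x \<partial>shell_measure R1 R2) = 0"
  obtains V :: "real^'n \<Rightarrow> real^'n" where "real_analytic_on V (annulus a b)"
    "\<And>x. x \<in> annulus a b \<Longrightarrow> divergence V x = f x"
    "\<And>x. norm x = R1 \<or> norm x = R2 \<Longrightarrow> V x = 0"
proof -
  let ?\<Omega> = "annulus a b :: (real^'n) set" and ?n = "CARD('n)"
  have fa: "real_analytic_on f ?\<Omega>" using f by (simp add: admissible_def)
  define G where "G = radial_moment R1 R2 f"
  define F where "F = radial_primitive R1 f"
  have Ga: "real_analytic_on G ?\<Omega>" unfolding G_def by (rule real_analytic_radial_moment[OF fa R])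
  have Fa: "real_analytic_on F ?\<Omega>" unfolding F_def by (rule real_analytic_radial_primitive[OF fa]) (use R in auto)
  have "\<exists>H. (\<forall>p q. real_analytic_on (H p q) ?\<Omega>) \<and>
     (\<forall>x\<in>?\<Omega>. (if x \<in> ?\<Omega> then G x else 0) =
        (\<Sum>p\<in>UNIV. \<Sum>q\<in>UNIV. frechet_derivative (H p q) (at x) (rot_gen p q x)))"
  proof (rule mean_zero_potential[OF n R f f0])
    show "admissible a b (\<lambda>x. if x \<in> ?\<Omega> then G x else 0)"
      unfolding admissible_def using real_analytic_on_cong[OF Ga] by simp
  qed (simp add: G_def radial_moment_def)
  then obtain H where Ha: "\<And>p q. real_analytic_on (H p q) ?\<Omega>"
    and H: "\<And>x. x \<in> ?\<Omega> \<Longrightarrow> G x = (\<Sum>p\<in>UNIV. \<Sum>q\<in>UNIV. frechet_derivative (H p q) (at x) (rot_gen p q x))"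
    by auto
  define D where "D = R2\<^sup>2 - R1\<^sup>2"
  have D: "0 < D" using R by (simp add: D_def power_strict_mono)
  \<comment> \<open>Polynomial in the coordinates, with values 0 and 1 on the two spheres.\<close>
  define u where "u x = ((norm x)\<^sup>2 - R1\<^sup>2) / D" for x :: "real^'n"
  define \<eta> where "\<eta> x = (u x)\<^sup>2 * (3 - 2 * u x)" for x
  define g0 where "g0 x = inverse (norm x) ^ ?n * (F x - \<eta> x * G x)" for x
  \<comment> \<open>The bracket is the derivative of \<eta> along \<open>x\<close>: a factor
    \<open>6 * u x * (1 - u x)\<close> from the smoothstep and a factor
    \<open>2 * (norm x)\<^sup>2 / D\<close> from \<open>u\<close>.\<close>
  define \<psi> where "\<psi> x = inverse (norm x) ^ ?n * (12 / D * (norm x)\<^sup>2 * (u x * (1 - u x)))" for x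
  define V where "V x = g0 x *\<^sub>R x + (\<Sum>p\<in>UNIV. \<Sum>q\<in>UNIV. (\<psi> x * H p q x) *\<^sub>R rot_gen p q x)" for x
  have pu: "panalytic t x (\<lambda>_. u)" for t :: real and x
  proof -
    have "panalytic t x (\<lambda>_ x. inverse D * ((norm x)\<^sup>2 - R1\<^sup>2))"
      by (intro panalytic_mult panalytic_diff panalytic_norm_sq panalytic_const)
    then show ?thesis by (simp add: u_def[abs_def] divide_inverse mult.commute)
  qed
  have pg0: "panalytic t x (\<lambda>_. g0)" if x: "x \<in> ?\<Omega>" for t :: real and x
    unfolding g0_def[abs_def] \<eta>_def using annulus_nonzero[OF x] R
    by (intro panalytic_mult panalytic_diff panalytic_power panalytic_inverse_norm panalytic_const pu
        real_analytic_on_imp_panalytic[OF Fa x] real_analytic_on_imp_panalytic[OF Ga x]) auto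
  have ppsi: "panalytic t x (\<lambda>_. \<psi>)" if x: "x \<in> ?\<Omega>" for t :: real and x
    unfolding \<psi>_def[abs_def] using annulus_nonzero[OF x] R
    by (intro panalytic_mult panalytic_diff panalytic_power[of _ _ "\<lambda>_ x. inverse (norm x)"] panalytic_inverse_norm panalytic_const pu panalytic_norm_sq) auto
  have pg: "panalytic t x (\<lambda>_ x. \<psi> x * H p q x)" if x: "x \<in> ?\<Omega>" for t :: real and x p q
    by (intro panalytic_mult ppsi x real_analytic_on_imp_panalytic[OF Ha x])
  have g0a: "real_analytic_on g0 ?\<Omega>"
    by (rule panalytic_imp_real_analytic_on[OF open_annulus, where t="0::real"]) (rule pg0)
  have ga: "real_analytic_on (\<lambda>x. \<psi> x * H p q x) ?\<Omega>" for p q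
    by (rule panalytic_imp_real_analytic_on[OF open_annulus, where t="0::real"]) (rule pg)
  have Va: "real_analytic_on V ?\<Omega>"
  proof (rule real_analytic_on_vec[OF open_annulus])
    fix i
    show "real_analytic_on (\<lambda>x. V x $ i) ?\<Omega>"
    proof (rule panalytic_imp_real_analytic_on[OF open_annulus, where t="0::real"])
      fix x assume x: "x \<in> ?\<Omega>"
      have "panalytic (0::real) x (\<lambda>_ x. g0 x * x $ i + (\<Sum>p\<in>UNIV. \<Sum>q\<in>UNIV. (\<psi> x * H p q x) *
          (x $ p * axis q 1 $ i - x $ q * axis p 1 $ i)))"
        by (intro panalytic_add panalytic_sum panalytic_mult[OF pg[OF x]] panalytic_mult[OF pg0[OF x]]
            panalytic_diff panalytic_mult[OF panalytic_coord] panalytic_coord panalytic_const finite)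
      then show "panalytic (0::real) x (\<lambda>_ x. V x $ i)"
        by (simp add: V_def rot_gen_def)
    qed
  qed
  have div: "divergence V x = f x" if x: "x \<in> ?\<Omega>" for x
  proof -
    let ?r = "norm x"
    have r: "0 < ?r" "a < ?r" "?r < b" using x R(1) by (auto simp: annulus_def)
    have x0: "x \<noteq> 0" using r by auto
    \<comment> \<open>Along the rotation curve \<psi> is constant. The case \<open>p = q\<close> is
      separate because \<open>rot p p\<close> is not a rotation; there the generator
      vanishes.\<close>
    have tang: "frechet_derivative (\<lambda>x. \<psi> x * H p q x) (at x) (rot_gen p q x) =
        \<psi> x * frechet_derivative (H p q) (at x) (rot_gen p q x)" for p q
    proof (cases "p = q")
      case True
      have z: "frechet_derivative g (at x) 0 = 0" if "real_analytic_on g ?\<Omega>" for g :: "real^'n \<Rightarrow> real"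
        using real_analytic_on_differentiable[OF that x] frechet_derivative_works has_derivative_linear linear_0 by blast
      show ?thesis using True by (simp add: rot_gen_def z[OF ga] z[OF Ha])
    next
      case False
      note c = has_vector_derivative_rot[OF False, of x]
      have "((\<lambda>t. H p q (rot p q t x)) has_real_derivative frechet_derivative (H p q) (at x) (rot_gen p q x)) (at 0)"
        using frechet_derivative_curve[OF _ c, of "H p q"] real_analytic_on_differentiable[OF Ha x] by (simp add: rot_0)
      then have "((\<lambda>t. \<psi> x * H p q (rot p q t x)) has_real_derivative \<psi> x * frechet_derivative (H p q) (at x) (rot_gen p q x)) (at 0)"
        by (rule DERIV_cmult)
      moreover have "\<psi> (rot p q t x) = \<psi> x" for t by (simp add: \<psi>_def u_def norm_rot[OF False])
      ultimately have "((\<lambda>t. \<psi> (rot p q t x) * H p q (rot p q t x)) has_real_derivative \<psi> x * frechet_derivative (H p q) (at x) (rot_gen p q x)) (at 0)"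
        by simp
      moreover have "((\<lambda>t. \<psi> (rot p q t x) * H p q (rot p q t x)) has_real_derivative
          frechet_derivative (\<lambda>x. \<psi> x * H p q x) (at x) (rot_gen p q x)) (at 0)"
        using frechet_derivative_curve[OF _ c, of "\<lambda>x. \<psi> x * H p q x"] real_analytic_on_differentiable[OF ga x] by (simp add: rot_0)
      ultimately show ?thesis using DERIV_unique by blast
    qed
    \<comment> \<open>Along the ray through \<open>x\<close> everything is a function of the scaling
      factor \<kappa>. Its derivative at 1 contains \<open>- real ?n * g0 x\<close> from the power
      of the norm, which cancels the first summand.\<close>
    have rad: "real ?n * g0 x + frechet_derivative g0 (at x) x = f x - \<psi> x * G x"
    proof -
      obtain \<Phi> where \<Phi>':
        "\<forall>s. a < s \<longrightarrow> s < b \<longrightarrow> (\<Phi> has_real_derivative s ^ (?n - 1) * f ((s / ?r) *\<^sub>R x)) (at s)"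
        "\<forall>\<kappa>>0. a < \<kappa> * ?r \<longrightarrow> \<kappa> * ?r < b \<longrightarrow> F (\<kappa> *\<^sub>R x) = \<Phi> (\<kappa> * ?r) - \<Phi> R1"
        using radial_primitive_eq[OF fa R x] unfolding F_def[symmetric] by (elim exE conjE)
      note \<Phi> = \<Phi>'[rule_format]
      have D\<Phi>: "(\<Phi> has_real_derivative ?r ^ (?n - 1) * f x) (at ?r)"
        using \<Phi>(1)[OF r(2,3)] x0 by simp
      let ?w = "\<lambda>\<kappa>::real. ((\<kappa> * ?r)\<^sup>2 - R1\<^sup>2) / D"
      let ?k = "\<lambda>\<kappa>::real. inverse (\<kappa> * ?r) ^ ?n * (\<Phi> (\<kappa> * ?r) - \<Phi> R1 - (?w \<kappa>)\<^sup>2 * (3 - 2 * ?w \<kappa>) * G x)"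
      define A where "A = \<Phi> ?r - \<Phi> R1 - \<eta> x * G x"
      have w1: "?w 1 = u x" by (simp add: u_def)
      have Dw: "(?w has_real_derivative 2 * ?r\<^sup>2 / D) (at 1)"
        using D by (auto intro!: derivative_eq_intros simp: power2_eq_square)
      have Dchi: "((\<lambda>\<kappa>. (?w \<kappa>)\<^sup>2 * (3 - 2 * ?w \<kappa>)) has_real_derivative 12 / D * ?r\<^sup>2 * (u x * (1 - u x))) (at 1)"
      proof -
        have "6 * (u x * (1 - u x)) * (2 * ?r\<^sup>2 / D) = 12 / D * ?r\<^sup>2 * (u x * (1 - u x))" by simp
        then show ?thesis using DERIV_smoothstep[OF Dw] unfolding w1 by (simp only:)
      qed
      have Dphi: "((\<lambda>\<kappa>. \<Phi> (\<kappa> * ?r)) has_real_derivative ?r ^ (?n - 1) * f x * ?r) (at 1)"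
        by (rule DERIV_chain2[of \<Phi>]) (use D\<Phi> in \<open>auto intro!: derivative_eq_intros\<close>)
      have Dinv: "((\<lambda>\<kappa>. inverse (\<kappa> * ?r) ^ ?n) has_real_derivative - (real ?n * inverse ?r ^ ?n)) (at 1)"
      proof -
        have "((\<lambda>\<kappa>. inverse (\<kappa> * ?r)) has_real_derivative - inverse ?r) (at 1)"
          using r by (auto intro!: derivative_eq_intros simp: field_simps)
        from DERIV_power[OF this, of ?n]
        have "((\<lambda>\<kappa>. inverse (\<kappa> * ?r) ^ ?n) has_real_derivative real ?n * (- inverse ?r * inverse ?r ^ (?n - Suc 0))) (at 1)"
          by simp
        moreover have "inverse ?r * inverse ?r ^ (?n - Suc 0) = inverse ?r ^ ?n"
          using n by (cases ?n) auto
        ultimately show ?thesis by simp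
      qed
      have Dk': "(?k has_real_derivative
          - (real ?n * inverse ?r ^ ?n) * A + inverse ?r ^ ?n * (?r ^ (?n - 1) * f x * ?r - 12 / D * ?r\<^sup>2 * (u x * (1 - u x)) * G x)) (at 1)"
      proof -
        have "((\<lambda>\<kappa>. \<Phi> (\<kappa> * ?r) - \<Phi> R1 - (?w \<kappa>)\<^sup>2 * (3 - 2 * ?w \<kappa>) * G x) has_real_derivative
           ?r ^ (?n - 1) * f x * ?r - 0 - 12 / D * ?r\<^sup>2 * (u x * (1 - u x)) * G x) (at 1)"
          by (intro DERIV_diff Dphi DERIV_const DERIV_cmult_right Dchi)
        from DERIV_mult[OF Dinv this] show ?thesis
          by (rule DERIV_cong) (simp add: A_def \<eta>_def u_def mult.commute)
      qed
      have e1: "?r ^ (?n - 1) * f x * ?r = ?r ^ ?n * f x" using n by (cases ?n) auto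
      have e2: "inverse ?r ^ ?n * (?r ^ ?n * f x) = f x"
        using r by (simp add: power_inverse)
      have Dk: "(?k has_real_derivative - (real ?n * (inverse ?r ^ ?n * A)) + (f x - \<psi> x * G x)) (at 1)"
      proof (rule DERIV_cong[OF Dk'])
        have "- (N * i) * B + i * (P - c * g) = - (N * (i * B)) + (y - i * c * g)" if "i * P = y"
          for N i B P c g y :: real
          using that by (auto simp: algebra_simps)
        from this[OF e2] show "- (real ?n * inverse ?r ^ ?n) * A + inverse ?r ^ ?n *
            (?r ^ (?n - 1) * f x * ?r - 12 / D * ?r\<^sup>2 * (u x * (1 - u x)) * G x) =
          - (real ?n * (inverse ?r ^ ?n * A)) + (f x - \<psi> x * G x)"
          unfolding e1 \<psi>_def .
      qed
      \<comment> \<open>The positive scalings that keep \<open>\<kappa> *\<^sub>R x\<close> inside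
        the annulus, where the antiderivative formula for \<open>F\<close> holds.\<close>
      let ?S = "{0<..} \<inter> {a / ?r<..<b / ?r}"
      have "((\<lambda>\<kappa>. g0 (\<kappa> *\<^sub>R x)) has_real_derivative - (real ?n * (inverse ?r ^ ?n * A)) + (f x - \<psi> x * G x)) (at 1)"
      proof (rule has_field_derivative_transform_within_open[OF Dk, where S="?S"])
        show "1 \<in> ?S" using r by (simp add: divide_less_eq less_divide_eq)
        fix \<kappa> assume "\<kappa> \<in> ?S"
        then have l: "0 < \<kappa>" "a < \<kappa> * ?r" "\<kappa> * ?r < b" using r by (auto simp: divide_less_eq less_divide_eq)
        have "G (\<kappa> *\<^sub>R x) = G x" unfolding G_def radial_moment_def using l(1) by simp
        then show "?k \<kappa> = g0 (\<kappa> *\<^sub>R x)" using l \<Phi>(2)[OF l] by (simp add: g0_def \<eta>_def u_def)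
      qed (auto intro: open_Int)
      moreover have "((\<lambda>\<kappa>. g0 (\<kappa> *\<^sub>R x)) has_real_derivative frechet_derivative g0 (at x) x) (at 1)"
      proof -
        have "((\<lambda>\<kappa>. \<kappa> *\<^sub>R x) has_vector_derivative x) (at 1)"
          by (auto intro!: derivative_eq_intros)
        from frechet_derivative_curve[OF _ this, of g0] show ?thesis
          using real_analytic_on_differentiable[OF g0a x] by simp
      qed
      ultimately have "frechet_derivative g0 (at x) x = - (real ?n * (inverse ?r ^ ?n * A)) + (f x - \<psi> x * G x)"
        using DERIV_unique by blast
      moreover have "g0 x = inverse ?r ^ ?n * A"
        unfolding g0_def A_def using \<Phi>(2)[of 1] r by simp
      ultimately show ?thesis by simp
    qed
    have "divergence V x = real ?n * g0 x + frechet_derivative g0 (at x) x +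
       (\<Sum>p\<in>UNIV. \<Sum>q\<in>UNIV. frechet_derivative (\<lambda>x. \<psi> x * H p q x) (at x) (rot_gen p q x))"
      unfolding V_def[abs_def]
      by (rule divergence_radial_tangential)
         (use real_analytic_on_differentiable[OF g0a x] real_analytic_on_differentiable[OF ga x] in auto)
    also have "\<dots> = f x - \<psi> x * G x + \<psi> x * G x"
      unfolding rad tang H[OF x] by (simp add: sum_distrib_left)
    finally show ?thesis by simp
  qed
  \<comment> \<open>On the inner sphere \<open>F\<close> and \<eta> vanish; on the outer one \<eta>
    is 1 and \<open>F\<close> equals \<open>G\<close>. The factor \<open>u x * (1 - u x)\<close> in
    \<psi> vanishes on both.\<close>
  have bd: "V x = 0" if "norm x = R1 \<or> norm x = R2" for x
  proof -
    have x: "x \<in> ?\<Omega>" using that R by (auto simp: annulus_def)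
    obtain \<Phi> where \<Phi>':
      "\<forall>\<kappa>>0. a < \<kappa> * norm x \<longrightarrow> \<kappa> * norm x < b \<longrightarrow> F (\<kappa> *\<^sub>R x) = \<Phi> (\<kappa> * norm x) - \<Phi> R1"
      "G x = \<Phi> R2 - \<Phi> R1"
      using radial_primitive_eq[OF fa R x] unfolding F_def[symmetric] G_def[symmetric] by (elim exE conjE)
    note \<Phi> = \<Phi>'[rule_format]
    have Fx: "F x = \<Phi> (norm x) - \<Phi> R1" using \<Phi>(1)[of 1] x by (simp add: annulus_def)
    show ?thesis
    proof (cases "norm x = R1")
      case True
      then have "u x = 0" by (simp add: u_def)
      then have "\<psi> x = 0" "g0 x = 0" using Fx True by (simp_all add: \<psi>_def g0_def \<eta>_def)
      then show ?thesis by (simp add: V_def)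
    next
      case False
      with that have x2: "norm x = R2" by simp
      then have "u x = 1" using D by (simp add: u_def D_def)
      then have "\<psi> x = 0" "g0 x = 0" using Fx x2 \<Phi>(2) by (simp_all add: \<psi>_def g0_def \<eta>_def)
      then show ?thesis by (simp add: V_def)
    qed
  qed
  show ?thesis by (rule that[OF Va div bd])
qed

text \<open>The witness \<open>U\<close> is the extension \<open>V\<close> itself. The divergence is
  taken of \<open>V\<close> because difference quotients at boundary points leave the closed
  annulus.\<close>

theorem theorem1p1:
  fixes f :: "real^'n \<Rightarrow> real" and R1 R2 :: real
  assumes "CARD('n) \<ge> 2"
    and "0 < R1" and "R1 < R2"
    and "real_analytic_on_cannulus R1 R2 f"
    and "integral (annulus R1 R2) f = 0"
  shows "\<exists>U :: real^'n \<Rightarrow> real^'n. \<exists>d V.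
           analytic_extension R1 R2 U d V \<and>
           (\<forall>x\<in>cannulus R1 R2. divergence V x = f x) \<and>
           (\<forall>x\<in>cannulus R1 R2. (norm x = R1 \<or> norm x = R2) \<longrightarrow> U x = 0)"
proof -
  from assms(4) obtain d g where d: "0 < d" "d < 1"
    and g: "real_analytic_on g (annulus (R1 * (1 - d)) (R2 * (1 + d)))"
    and gf: "\<And>x. x \<in> cannulus R1 R2 \<Longrightarrow> g x = f x"
    unfolding real_analytic_on_cannulus_def analytic_extension_def by blast
  define a b where "a = R1 * (1 - d)" and "b = R2 * (1 + d)"
  have R: "0 < a" "a < R1" "R1 < R2" "R2 < b" using d assms(2,3) by (auto simp: a_def b_def)
  \<comment> \<open>Extension by zero makes the given analytic extension admissible and keeps its
    values on the closed annulus.\<close>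
  define h where "h x = (if x \<in> annulus a b then g x else 0)" for x
  have h: "admissible a b h"
    unfolding admissible_def using real_analytic_on_cong[OF g, of h] by (simp add: h_def a_def b_def)
  have sub: "cannulus R1 R2 \<subseteq> annulus a b" using R by (auto simp: cannulus_def annulus_def)
  have hf: "h x = f x" if "x \<in> cannulus R1 R2" for x using that sub gf by (auto simp: h_def)
  have sub': "annulus R1 R2 \<subseteq> cannulus R1 R2" by (auto simp: cannulus_def annulus_def)
  have "(\<integral>x. h x \<partial>shell_measure R1 R2) = 0"
  proof -
    \<comment> \<open>Continuity on the compact closed annulus gives Lebesgue integrability, so the
      gauge integral in the hypothesis is an integral against \<open>shell_measure\<close>.\<close>
    have "continuous_on (cannulus R1 R2) h"
      using h real_analytic_on_continuous_on continuous_on_subset[OF _ sub] unfolding admissible_def by blast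
    then have "set_integrable lborel (cannulus R1 R2) h"
      unfolding set_integrable_def by (rule borel_integrable_compact[OF compact_cannulus])
    then have si: "set_integrable lborel (annulus R1 R2) h"
      by (rule set_integrable_subset) (use sub' in auto)
    have "(\<integral>x. h x \<partial>shell_measure R1 R2) = (LINT x : annulus R1 R2 | lborel. h x)"
      by (simp add: integral_shell_measure[OF admissible_measurable[OF h]] set_lebesgue_integral_def)
    also have "\<dots> = integral (annulus R1 R2) h" by (rule set_borel_integral_eq_integral(2)[OF si])
    also have "\<dots> = integral (annulus R1 R2) f"
      by (rule Henstock_Kurzweil_Integration.integral_cong) (use hf sub' in auto)
    finally show ?thesis using assms(5) by simp
  qed
  then obtain V :: "real^'n \<Rightarrow> real^'n" where V: "real_analytic_on V (annulus a b)"
    "\<And>x. x \<in> annulus a b \<Longrightarrow> divergence V x = h x"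
    "\<And>x. norm x = R1 \<or> norm x = R2 \<Longrightarrow> V x = 0"
    using divergence_solution[OF assms(1) R h] by blast
  have "analytic_extension R1 R2 V d V"
    using V(1) d by (simp add: analytic_extension_def a_def b_def)
  moreover have "\<forall>x\<in>cannulus R1 R2. divergence V x = f x" using V(2) hf sub by auto
  ultimately show ?thesis using V(3) by blast
qed

end
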